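(* There exist $t_0,L\in\mathbb{N}$ such that for all $g,k\in\mathbb{N}$, the following hold for the graph $G_k^g$ defined in the context. (i) $G_k^g$ does not contain the wall $W_{t_0\times t_0}$ as an induced minor, and $G_k^g$ does not contain the complete bipartite graph $K_{t_0,t_0}$ as an induced minor. (ii) If $H$ is an induced subgraph of $G_k^g$ and $\mathrm{tw}(H)>L$, then $H$ contains an $\ell$-long theta as an induced subgraph for some $\ell\geq 2^g-1$.
   Context: $\mathbb{N}$ is the set of positive integers. Graphs have finite vertex sets, no loops and no parallel edges. $\mathrm{tw}$ denotes treewidth, and $\mathrm{dist}_T(a,b)$ is the length (number of edges) of a shortest path from $a$ to $b$ in $T$. A graph $H$ is an induced minor of $G$ if $H$ is isomorphic to a graph obtained from $G$ by a series of vertex deletions and edge contractions (deleting the loops and parallel edges produced by contractions). The graph $G_k^g$: for $g,k\in\mathbb{N}$, the vertex set of $G_k^g$ is partitioned into $k$ paths $P_1,\ldots,P_k$ of length $2^{k+g}$, where $P_i$ has vertices $P_i^0,P_i^1,\ldots,P_i^{2^{k+g}}$ in this order (with $P_i^x$ adjacent to $P_i^{x+1}$, and no other edges between vertices of $P_i$). For $1\leq i<j\leq k$, the vertices $P_i^x$ and $P_j^y$ are adjacent if and only if $x=y=b\cdot 2^{k-i+g}$ for some odd integer $b\in\{1,3,\ldots,2^i-1\}$. Wall: for $k\geq 2$, the $(k\times k)$-wall $W_{k\times k}$ is the following graph. Its vertices are pairs (row, column): row $1$ has columns $0,2,4,\ldots,2k-2$; each row $i$ with $2\leq i\leq k-1$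 has all columns $0,1,\ldots,2k-1$; row $k$ has those columns $j\in\{0,\ldots,2k-1\}$ with $j\equiv k \pmod 2$. Within each row, vertices with consecutive (existing) columns are adjacent. For $1\leq i\leq k-1$, the vertices $(i,j)$ and $(i+1,j)$ are adjacent whenever $0\le j\le 2k-1$ and $j\equiv i-1\pmod 2$. There are no other edges. $W_{1\times 1}$ is a single vertex. Theta: two vertex sets are anticomplete if they are disjoint and there is no edge between them; two paths are internally anticomplete if their interiors (the paths minus their ends) are anticomplete. A theta is a graph $T$ consisting of two non-adjacent vertices $a$ and $b$ and three pairwise internally anticomplete paths from $a$ to $b$, each of length at least $2$ (each path being an induced subgraph of $T$), and no other vertices or edges. The length of $T$ is $\mathrm{dist}_T(a,b)$. $T$ is an $\ell$-long theta if its length is at least $\ell$. *)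

theory Defs
  imports "Graph_Theory.Graph_Theory"
begin

text \<open>
  Finite simple graphs are the finite, loop-free, symmetric digraphs without parallel arcs
  of the locale \<^locale>\<open>pair_graph\<close>: an edge \<open>uv\<close> is the pair of arcs \<open>(u,v)\<close>, \<open>(v,u)\<close>.
\<close>

definition undirected :: "'a set \<Rightarrow> ('a \<Rightarrow> 'a \<Rightarrow> bool) \<Rightarrow> 'a pair_pre_digraph" where
  "undirected V E = \<lparr> pverts = V, parcs = {(u, v). u \<in> V \<and> v \<in> V \<and> (E u v \<or> E v u)} \<rparr>"

lemma pair_graph_undirected:
  assumes "finite V" "\<And>v. v \<in> V \<Longrightarrow> \<not> E v v"
  shows "pair_graph (undirected V E)"
proof -
  have "finite (V \<times> V)" "parcs (undirected V E) \<subseteq> V \<times> V"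
    using assms(1) by (auto simp: undirected_def)
  then have "finite (parcs (undirected V E))" by (rule rev_finite_subset)
  with assms show ?thesis
    by unfold_locales (auto simp: undirected_def symmetric_def sym_def)
qed


section \<open>The graph \<open>G\<^sub>k\<^sup>g\<close>\<close>

text \<open>The pair \<open>(i, x)\<close> stands for the vertex \<open>P\<^sub>i\<^sup>x\<close>.\<close>

definition Ggk :: "nat \<Rightarrow> nat \<Rightarrow> (nat \<times> nat) pair_pre_digraph" where
  "Ggk g k = undirected ({1..k} \<times> {0..2 ^ (k + g)})
     (\<lambda>(i, x) (j, y).
        i = j \<and> y = x + 1 \<or>
        i < j \<and> x = y \<and> (\<exists>b \<in> {1..2 ^ i - 1}. odd b \<and> x = b * 2 ^ (k - i + g)))"

lemma pair_graph_Ggk: "pair_graph (Ggk g k)"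
  unfolding Ggk_def by (rule pair_graph_undirected) auto


section \<open>Walls and complete bipartite graphs\<close>

definition wall_cols :: "nat \<Rightarrow> nat \<Rightarrow> nat set" where
  "wall_cols k i =
     (if i = 1 then {j. j \<le> 2 * k - 2 \<and> even j}
      else if i = k then {j. j \<le> 2 * k - 1 \<and> j mod 2 = k mod 2}
      else {0..2 * k - 1})"

definition wall :: "nat \<Rightarrow> (nat \<times> nat) pair_pre_digraph" where
  "wall k = undirected (SIGMA i : {1..k}. wall_cols k i)
     (\<lambda>(i, j) (i', j').
        i = i' \<and> j < j' \<and> (\<forall>c \<in> wall_cols k i. \<not> (j < c \<and> c < j')) \<or>
        i' = i + 1 \<and> j = j' \<and> j mod 2 = (i - 1) mod 2)"

lemma wall_1: "wall 1 = \<lparr> pverts = {(1, 0)}, parcs = {} \<rparr>"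
  by (auto simp: wall_def undirected_def wall_cols_def)

lemma pair_graph_wall: "pair_graph (wall k)"
proof -
  have "wall_cols k i \<subseteq> {..2 * k}" for i
    by (auto simp: wall_cols_def)
  then have "finite (wall_cols k i)" for i
    by (rule finite_subset) simp
  then show ?thesis
    unfolding wall_def by (intro pair_graph_undirected) auto
qed

definition complete_bipartite :: "nat \<Rightarrow> nat \<Rightarrow> (nat + nat) pair_pre_digraph" where
  "complete_bipartite m n = undirected ({..<m} <+> {..<n}) (\<lambda>u v. isl u \<and> \<not> isl v)"

lemma complete_bipartite_digraph_complete_bipartite:
  "complete_bipartite_digraph m n (complete_bipartite m n)"
proof -
  let ?U = "Inl ` {..<m} :: (nat + nat) set" and ?V = "Inr ` {..<n} :: (nat + nat) set"
  have "pverts (complete_bipartite m n) = ?U \<union> ?V"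
    "parcs (complete_bipartite m n) = ?U \<times> ?V \<union> ?V \<times> ?U"
    by (auto simp: complete_bipartite_def undirected_def)
  moreover have "card ?U = m" "card ?V = n" "?U \<inter> ?V = {}" "finite (?U \<union> ?V)"
    by (auto simp: card_image)
  ultimately show ?thesis
    unfolding complete_bipartite_digraph_pair_def by metis
qed


section \<open>Induced minors\<close>

definition delete_vertex :: "'a \<Rightarrow> 'a pair_pre_digraph \<Rightarrow> 'a pair_pre_digraph" where
  "delete_vertex v G =
     \<lparr> pverts = pverts G - {v}, parcs = {(x, y) \<in> parcs G. x \<noteq> v \<and> y \<noteq> v} \<rparr>"

text \<open>The vertex resulting from the contraction of \<open>uv\<close> is named \<open>u\<close>.\<close>

definition contract_edge :: "'a \<Rightarrow> 'a \<Rightarrow> 'a pair_pre_digraph \<Rightarrow> 'a pair_pre_digraph" where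
  "contract_edge u v G =
     (let f = (\<lambda>x. if x = v then u else x) in
      \<lparr> pverts = f ` pverts G, parcs = {(f x, f y) | x y. (x, y) \<in> parcs G \<and> f x \<noteq> f y} \<rparr>)"

inductive reduces_to :: "'a pair_pre_digraph \<Rightarrow> 'a pair_pre_digraph \<Rightarrow> bool" for G where
  refl: "reduces_to G G"
| delete: "reduces_to G H \<Longrightarrow> v \<in> pverts H \<Longrightarrow> reduces_to G (delete_vertex v H)"
| contract: "reduces_to G H \<Longrightarrow> (u, v) \<in> parcs H \<Longrightarrow> reduces_to G (contract_edge u v H)"

definition induced_minor :: "'b pair_pre_digraph \<Rightarrow> 'a pair_pre_digraph \<Rightarrow> bool" where
  "induced_minor H G \<longleftrightarrow> (\<exists>G'. reduces_to G G' \<and> digraph_iso H G')"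


section \<open>Treewidth\<close>

text \<open>
  The library predicate \<^const>\<open>tree\<close> is unsuitable here: it excludes directed cycles, and in a
  symmetric digraph every edge traversed back and forth is one. Cycles of the undirected graph are
  the directed cycles of length at least 3.
\<close>

definition undirected_tree :: "'a pair_pre_digraph \<Rightarrow> bool" where
  "undirected_tree T \<longleftrightarrow>
     pair_graph T \<and> connected T \<and> \<not> (\<exists>c. pre_digraph.cycle T c \<and> 3 \<le> length c)"

text \<open>Since decomposition trees are finite, natural numbers suffice as their nodes.\<close>

definition tree_decomposition ::
    "'a pair_pre_digraph \<Rightarrow> nat pair_pre_digraph \<Rightarrow> (nat \<Rightarrow> 'a set) \<Rightarrow> bool" where
  "tree_decomposition G T \<beta> \<longleftrightarrow>
     undirected_tree T \<and>
     (\<Union>t \<in> pverts T. \<beta> t) = pverts G \<and>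
     (\<forall>(u, v) \<in> parcs G. \<exists>t \<in> pverts T. u \<in> \<beta> t \<and> v \<in> \<beta> t) \<and>
     (\<forall>v \<in> pverts G. connected (with_proj T \<restriction> {t \<in> pverts T. v \<in> \<beta> t}))"

text \<open>
  The truncated subtraction affects only the graph without vertices, whose treewidth is
  0 here instead of the customary \<open>-1\<close>.
\<close>

definition decomposition_width :: "nat pair_pre_digraph \<Rightarrow> (nat \<Rightarrow> 'a set) \<Rightarrow> nat" where
  "decomposition_width T \<beta> = Max ((\<lambda>t. card (\<beta> t)) ` pverts T) - 1"

definition treewidth :: "'a pair_pre_digraph \<Rightarrow> nat" where
  "treewidth G = (LEAST w. \<exists>T \<beta>. tree_decomposition G T \<beta> \<and> w = decomposition_width T \<beta>)"


section \<open>Thetas\<close>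

definition path_graph :: "'a list \<Rightarrow> 'a pair_pre_digraph" where
  "path_graph p =
     \<lparr> pverts = set p, parcs = set (vwalk_arcs p) \<union> (set (vwalk_arcs p))\<inverse> \<rparr>"

definition path_between :: "'a pair_pre_digraph \<Rightarrow> 'a \<Rightarrow> 'a list \<Rightarrow> 'a \<Rightarrow> bool" where
  "path_between G a p b \<longleftrightarrow> vpath p G \<and> hd p = a \<and> last p = b"

definition interior :: "'a list \<Rightarrow> 'a set" where
  "interior p = set p - {hd p, last p}"

definition anticomplete :: "'a pair_pre_digraph \<Rightarrow> 'a set \<Rightarrow> 'a set \<Rightarrow> bool" where
  "anticomplete G X Y \<longleftrightarrow> X \<inter> Y = {} \<and> (\<forall>x \<in> X. \<forall>y \<in> Y. (x, y) \<notin> parcs G)"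

definition theta :: "'a pair_pre_digraph \<Rightarrow> 'a \<Rightarrow> 'a \<Rightarrow> bool" where
  "theta T a b \<longleftrightarrow>
     pair_graph T \<and> a \<noteq> b \<and> (a, b) \<notin> parcs T \<and>
     (\<exists>p :: nat \<Rightarrow> 'a list.
        (\<forall>i < 3. path_between T a (p i) b \<and> 2 \<le> vwalk_length (p i) \<and>
                 induced_subgraph (path_graph (p i)) T) \<and>
        (\<forall>i < 3. \<forall>j < 3. i \<noteq> j \<longrightarrow> anticomplete T (interior (p i)) (interior (p j))) \<and>
        pverts T = (\<Union>i < 3. pverts (path_graph (p i))) \<and>
        parcs T = (\<Union>i < 3. parcs (path_graph (p i))))"

text \<open>Only meaningful if \<open>a\<close> and \<open>b\<close> are connected in \<open>G\<close>, as they are in a theta.\<close>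

definition path_dist :: "'a pair_pre_digraph \<Rightarrow> 'a \<Rightarrow> 'a \<Rightarrow> nat" where
  "path_dist G a b = (LEAST n. \<exists>p. path_between G a p b \<and> vwalk_length p = n)"

definition long_theta :: "nat \<Rightarrow> 'a pair_pre_digraph \<Rightarrow> bool" where
  "long_theta l T \<longleftrightarrow> (\<exists>a b. theta T a b \<and> l \<le> path_dist T a b)"

end

theory Submission imports Defs begin

text \<open>
  Row \<open>i\<close> of the graph is a path, and every column \<open>x\<close> with vertical edges
  is a star: its centre lies in the row given by the level of \<open>x\<close>, and its leaves are
  the vertices of column \<open>x\<close> in all higher rows. The levels are distributed dyadically:
  half-way between two consecutive columns of level at most \<open>m\<close> lies a column of level
  \<open>m + 1\<close>. Three ideas carry the proof. Call two sets remote if they do not touch.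

  The first one is about strips. Take an induced subgraph \<open>H\<close> and call a column active
  if its centre is in \<open>H\<close>. If all active columns strictly between two active columns
  \<open>a\<close> and \<open>b\<close> have at least the levels of \<open>a\<close> and
  \<open>b\<close>, then a connected part of \<open>H\<close> that has entered the strip between
  them through their stars can leave it only through these stars (\<open>region_exit\<close>).
  Splitting a strip at an active column of lowest level gives smaller strips with the same property,
  and in a strip without active columns only disjoint pieces of rows are left.

  For the excluded induced minors, consider a model. If every star of an active column meets only
  boundedly many branch sets, then a family of connected unions of branch sets that touch pairwise,
  such that some member avoids any three given stars, is trapped in ever smaller strips, which is
  absurd (\<open>no_trapped_family\<close>, \<open>no_dense_minor\<close>). In a wall the bound is
  clear, as all branch sets meeting the star are adjacent to the one containing its centre, and
  crosses of a row and a zigzag path through two columns form the family. In a complete bipartite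
  graph the branch sets that meet the star are, except for the one containing its centre, all on the
  other side, so they are pairwise remote. Here the second idea is used: two connected sets which
  cross the same dyadic strip touch (\<open>crossing_sets_touch\<close>). From it one derives that
  at most nine pairwise remote sets meet a star whose centre they avoid, if they all touch three
  pairwise remote sets which avoid the star (\<open>star_bound\<close>).

  For the last part the third idea is that a connected subgraph on one side of an active column that
  is in contact with three vertices of its star contains an induced claw with these contacts as
  ends, and the claw and the centre of the star form an induced theta, whose ends lie in different
  columns with stars and hence have distance at least \<open>2 ^ g\<close>
  (\<open>theta_of_contacts\<close>). Without long thetas there are thus at most two contacts. So
  the components within a strip have at most four neighbours, and deleting at most nine vertices at
  a time suffices to pass to components within smaller strips or to parts around one column, which
  can be broken up further with a bounded number of neighbours (\<open>part_split\<close>). Such a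
  recursive decomposition by small separators is a tree decomposition of bounded width
  (\<open>dec_whole\<close>).
\<close>

section \<open>Connected sets\<close>

text \<open>Connectedness of the subgraph induced by \<open>S\<close>, stated through cuts; the empty set counts as
  connected.\<close>

definition conn :: "('a \<Rightarrow> 'a \<Rightarrow> bool) \<Rightarrow> 'a set \<Rightarrow> bool" where
  "conn E S \<longleftrightarrow> (\<forall>R. S \<inter> R \<noteq> {} \<longrightarrow> S - R \<noteq> {} \<longrightarrow> (\<exists>a\<in>S \<inter> R. \<exists>b\<in>S - R. E a b))"

text \<open>Two sets touch if they intersect or are joined by an edge.\<close>

definition touch :: "('a \<Rightarrow> 'a \<Rightarrow> bool) \<Rightarrow> 'a set \<Rightarrow> 'a set \<Rightarrow> bool" where
  "touch E A B \<longleftrightarrow> A \<inter> B \<noteq> {} \<or> (\<exists>a\<in>A. \<exists>b\<in>B. E a b)"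

text \<open>The vertex set of the component of \<open>s\<close> in the subgraph induced by \<open>S\<close>,
  for \<open>s \<in> S\<close>.\<close>

definition component :: "('a \<Rightarrow> 'a \<Rightarrow> bool) \<Rightarrow> 'a set \<Rightarrow> 'a \<Rightarrow> 'a set" where
  "component E S s = {v. (\<lambda>x y. x \<in> S \<and> y \<in> S \<and> E x y)\<^sup>*\<^sup>* s v}"

text \<open>The neighbours of \<open>C\<close> outside \<open>C\<close> in the subgraph induced by \<open>V\<close>.\<close>

definition nbs :: "('a \<Rightarrow> 'a \<Rightarrow> bool) \<Rightarrow> 'a set \<Rightarrow> 'a set \<Rightarrow> 'a set" where
  "nbs E V C = {v \<in> V - C. \<exists>w\<in>C. E v w}"

lemma connE:
  assumes "conn E S" "s \<in> S" "s \<in> R" "t \<in> S" "t \<notin> R"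
  obtains a b where "a \<in> S" "a \<in> R" "b \<in> S" "b \<notin> R" "E a b"
proof -
  have "S \<inter> R \<noteq> {}" "S - R \<noteq> {}" using assms(2-5) by blast+
  then have "\<exists>a\<in>S \<inter> R. \<exists>b\<in>S - R. E a b" using assms(1) unfolding conn_def by blast
  then show ?thesis using that by blast
qed

lemma conn_closed:
  assumes "conn E S" "s \<in> S" "s \<in> R" "\<And>a b. a \<in> S \<Longrightarrow> a \<in> R \<Longrightarrow> b \<in> S \<Longrightarrow> E a b \<Longrightarrow> b \<in> R"
  shows "S \<subseteq> R"
proof
  fix t assume "t \<in> S"
  show "t \<in> R"
    by (rule ccontr, rule connE[OF assms(1-3) \<open>t \<in> S\<close>], assumption) (use assms(4) in blast)
qed

lemma comp_self: "s \<in> component E S s"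
  by (simp add: component_def)

lemma comp_subset: "s \<in> S \<Longrightarrow> component E S s \<subseteq> S"
proof
  fix v assume s: "s \<in> S" and "v \<in> component E S s"
  then have "(\<lambda>x y. x \<in> S \<and> y \<in> S \<and> E x y)\<^sup>*\<^sup>* s v" by (simp add: component_def)
  then show "v \<in> S" using s by (induction rule: rtranclp_induct) auto
qed

lemma comp_step: "a \<in> component E S s \<Longrightarrow> s \<in> S \<Longrightarrow> b \<in> S \<Longrightarrow> E a b \<Longrightarrow> b \<in> component E S s"
  using comp_subset[of s S E]
  by (auto simp: component_def intro: rtranclp.rtrancl_into_rtrancl)

lemma Union_component: "\<Union> (component E S ` S) = S"
proof (intro equalityI subsetI)
  fix x assume "x \<in> \<Union> (component E S ` S)"
  then obtain s where "s \<in> S" "x \<in> component E S s" by blast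
  then show "x \<in> S" using comp_subset[of s S E] by blast
next
  fix x assume "x \<in> S"
  then show "x \<in> \<Union> (component E S ` S)" using comp_self[of x E S] by blast
qed

lemma touch_mono: "touch E A B \<Longrightarrow> A \<subseteq> A' \<Longrightarrow> B \<subseteq> B' \<Longrightarrow> touch E A' B'"
  unfolding touch_def by blast

lemma conn_empty: "conn E {}" and conn_single: "conn E {x}"
  by (auto simp: conn_def)

locale ugraph =
  fixes E :: "'a \<Rightarrow> 'a \<Rightarrow> bool"
  assumes sym: "E x y \<Longrightarrow> E y x"
begin

lemma touch_sym: "touch E A B \<Longrightarrow> touch E B A"
  unfolding touch_def using sym by blast

lemma conn_comp:
  assumes "s \<in> S"
  shows "conn E (component E S s)"
proof -
  let ?C = "component E S s"
  have reach: "\<exists>a\<in>?C \<inter> R. \<exists>b\<in>?C - R. E a b" if "s \<in> R" "t \<in> ?C - R" for R t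
  proof (rule ccontr)
    assume no: "\<not> ?thesis"
    have "(\<lambda>x y. x \<in> S \<and> y \<in> S \<and> E x y)\<^sup>*\<^sup>* s t" using that by (simp add: component_def)
    then have "t \<in> ?C \<inter> R"
    proof (induction rule: rtranclp_induct)
      case base
      show ?case using that comp_self by fast
    next
      case (step y z)
      then show ?case using comp_step[of y E S s z] assms no by blast
    qed
    then show False using that by blast
  qed
  show ?thesis unfolding conn_def
  proof (intro allI impI)
    fix R assume a: "?C \<inter> R \<noteq> {}" "?C - R \<noteq> {}"
    show "\<exists>a\<in>?C \<inter> R. \<exists>b\<in>?C - R. E a b"
    proof (cases "s \<in> R")
      case True
      then show ?thesis using reach a(2) by blast
    next
      case False
      then obtain b c where "b \<in> ?C \<inter> - R" "c \<in> ?C - (- R)" "E b c"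
        using reach[of "- R"] a(1) by blast
      then show ?thesis using sym by blast
    qed
  qed
qed

lemma comp_maximal:
  assumes "conn E C" "C \<subseteq> S" "s \<in> C"
  shows "C \<subseteq> component E S s"
  using assms by (intro conn_closed[OF assms(1,3)]) (auto simp: comp_self intro: comp_step)

lemma comp_eq:
  assumes "s \<in> S" "t \<in> component E S s"
  shows "component E S t = component E S s"
proof -
  have t: "t \<in> S" using comp_subset assms by fastforce
  have 1: "component E S s \<subseteq> component E S t"
    using comp_maximal conn_comp comp_subset assms by metis
  then have "s \<in> component E S t" using comp_self by fast
  then have "component E S t \<subseteq> component E S s"
    using comp_maximal conn_comp comp_subset t by metis
  with 1 show ?thesis by simp
qed

lemma conn_union:
  assumes "conn E A" "conn E B" "touch E A B"
  shows "conn E (A \<union> B)"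
  unfolding conn_def
proof (intro allI impI, rule ccontr)
  fix R assume a: "(A \<union> B) \<inter> R \<noteq> {}" "(A \<union> B) - R \<noteq> {}"
    and no: "\<not> (\<exists>a\<in>(A \<union> B) \<inter> R. \<exists>b\<in>A \<union> B - R. E a b)"
  have closed: "b \<in> R" if "a \<in> A \<union> B" "a \<in> R" "b \<in> A \<union> B" "E a b" for a b
    using that no by blast
  have one: "X \<subseteq> R" if "conn E X" "X \<subseteq> A \<union> B" "x \<in> X" "x \<in> R" for X x
    by (rule conn_closed[OF that(1,3,4)]) (use closed that(2) in blast)
  obtain x y where xy: "x \<in> A" "y \<in> B" "x = y \<or> E x y"
    using assms(3) unfolding touch_def by blast
  have "x \<in> R \<longleftrightarrow> y \<in> R" using xy closed sym by blast
  moreover obtain r where "r \<in> A \<union> B" "r \<in> R" using a(1) by blast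
  ultimately have "x \<in> R" "y \<in> R" using one[of A] one[of B] assms(1,2) xy(1,2) by blast+
  then show False using one[of A x] one[of B y] assms(1,2) xy(1,2) a(2) by blast
qed

lemma conn_insert:
  assumes "conn E A" "a \<in> A" "E a x"
  shows "conn E (insert x A)"
  using conn_union[OF assms(1) conn_single, of x] assms by (auto simp: touch_def)

lemma conn_chain:
  fixes S :: "nat \<Rightarrow> 'a set"
  assumes "\<And>i. i \<le> n \<Longrightarrow> conn E (S i)" "\<And>i. i < n \<Longrightarrow> touch E (S i) (S (Suc i))"
  shows "conn E (\<Union>i\<le>n. S i)"
  using assms
proof (induction n)
  case 0
  then show ?case by simp
next
  case (Suc n)
  have "conn E (S (Suc n) \<union> (\<Union>i\<le>n. S i))"
  proof (rule conn_union)
    show "touch E (S (Suc n)) (\<Union>i\<le>n. S i)"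
      using Suc.prems(2)[of n] touch_sym touch_mono by (metis UN_upper atMost_iff lessI order_refl)
  qed (use Suc in auto)
  then show ?case by (simp add: atMost_Suc)
qed

text \<open>A connected set which reaches both sides of a level set of a function that changes by at most
  one along each edge has a connected part between the two level sets that meets both.\<close>

lemma conn_up_to_level:
  fixes f :: "'a \<Rightarrow> int"
  assumes "conn E C" and lip: "\<forall>a b. E a b \<longrightarrow> \<bar>f a - f b\<bar> \<le> 1"
    and "a \<in> C" "f a \<le> t" "b \<in> C" "t \<le> f b"
  obtains C' c where "conn E C'" "C' \<subseteq> C" "a \<in> C'" "\<And>v. v \<in> C' \<Longrightarrow> f v \<le> t" "c \<in> C'" "f c = t"
proof -
  let ?S = "{v\<in>C. f v \<le> t}"
  let ?C = "component E ?S a"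
  have sub: "?C \<subseteq> ?S" by (rule comp_subset) (use assms in auto)
  have "\<exists>c\<in>?C. f c = t"
  proof (rule ccontr)
    assume no: "\<not> ?thesis"
    have "C \<subseteq> ?C"
    proof (rule conn_closed[OF assms(1) assms(3)])
      show "a \<in> ?C" by (rule comp_self)
      fix x y assume xy: "x \<in> C" "x \<in> ?C" "y \<in> C" "E x y"
      then have "f x \<le> t" "f x \<noteq> t" using sub no by auto
      then have "f y \<le> t" using lip xy(4) by fastforce
      then show "y \<in> ?C" using xy comp_step[of x E ?S a y] assms by auto
    qed
    then have "b \<in> ?S" using sub assms(5) by blast
    then have "f b = t" using assms(6) by simp
    then show False using no \<open>C \<subseteq> ?C\<close> assms(5) by blast
  qed
  then obtain c where c: "c \<in> ?C" "f c = t" by blast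
  show ?thesis
  proof (rule that[OF _ _ comp_self _ c])
    show "conn E ?C" by (rule conn_comp) (use assms in auto)
  qed (use sub in auto)
qed

lemma conn_between_levels:
  fixes f :: "'a \<Rightarrow> int"
  assumes "conn E C" and lip: "\<forall>a b. E a b \<longrightarrow> \<bar>f a - f b\<bar> \<le> 1"
    and "a \<in> C" "f a \<le> s" "b \<in> C" "t \<le> f b" "s \<le> t"
  obtains C' c d where "conn E C'" "C' \<subseteq> C" "\<And>v. v \<in> C' \<Longrightarrow> s \<le> f v \<and> f v \<le> t"
    "c \<in> C'" "f c = s" "d \<in> C'" "f d = t"
proof -
  have "f a \<le> t" using assms(4,7) by linarith
  then obtain C1 d where 1: "conn E C1" "C1 \<subseteq> C" "a \<in> C1" "\<And>v. v \<in> C1 \<Longrightarrow> f v \<le> t" "d \<in> C1" "f d = t"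
    using conn_up_to_level[OF assms(1) lip assms(3) _ assms(5,6)] by blast
  have lip': "\<forall>a b. E a b \<longrightarrow> \<bar>- f a - - f b\<bar> \<le> 1" using lip by (simp add: abs_minus_commute)
  have "- f d \<le> - s" "- s \<le> - f a" using 1(6) assms(4,7) by linarith+
  then obtain C2 c where 2: "conn E C2" "C2 \<subseteq> C1" "d \<in> C2" "\<And>v. v \<in> C2 \<Longrightarrow> - f v \<le> - s"
    "c \<in> C2" "- f c = - s"
    using conn_up_to_level[OF 1(1) lip' 1(5) _ 1(3)] by blast
  show ?thesis
  proof (rule that[OF 2(1)])
    show "C2 \<subseteq> C" using 1(2) 2(2) by blast
    show "s \<le> f v \<and> f v \<le> t" if "v \<in> C2" for v using 1(4) 2(2,4) that by force
  qed (use 1 2 in auto)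
qed

end

section \<open>Tree decompositions from separators\<close>

text \<open>A rooted tree decomposition of the subgraph induced by \<open>U\<close>: the nodes are the numbers below
  \<open>n\<close>, the root is \<open>0\<close>, every other node \<open>i\<close> has the smaller number \<open>par i\<close> as parent, every bag
  has at most \<open>c\<close> elements, and \<open>R\<close> is contained in the root bag. The nodes whose bags contain a
  given vertex form a subtree, since they have a topmost node \<open>t\<close>.\<close>

definition rooted_dec ::
  "('a \<Rightarrow> 'a \<Rightarrow> bool) \<Rightarrow> 'a set \<Rightarrow> 'a set \<Rightarrow> nat \<Rightarrow> nat \<Rightarrow> (nat \<Rightarrow> nat) \<Rightarrow> (nat \<Rightarrow> 'a set) \<Rightarrow> bool" where
  "rooted_dec E U R c n par \<beta> \<longleftrightarrow>
     0 < n \<and> (\<forall>i. 0 < i \<and> i < n \<longrightarrow> par i < i) \<and> R \<subseteq> \<beta> 0 \<and> (\<Union>i<n. \<beta> i) = U \<and>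
     (\<forall>i<n. finite (\<beta> i) \<and> card (\<beta> i) \<le> c) \<and>
     (\<forall>u\<in>U. \<forall>v\<in>U. E u v \<longrightarrow> (\<exists>i<n. u \<in> \<beta> i \<and> v \<in> \<beta> i)) \<and>
     (\<forall>v\<in>U. \<exists>t<n. v \<in> \<beta> t \<and> (\<forall>i<n. v \<in> \<beta> i \<longrightarrow> i \<noteq> t \<longrightarrow> 0 < i \<and> v \<in> \<beta> (par i)))"

lemma rooted_decD:
  assumes "rooted_dec E U R c n par \<beta>"
  shows "0 < n" "\<And>i. 0 < i \<Longrightarrow> i < n \<Longrightarrow> par i < i" "R \<subseteq> \<beta> 0" "(\<Union>i<n. \<beta> i) = U"
    "\<And>i. i < n \<Longrightarrow> finite (\<beta> i)" "\<And>i. i < n \<Longrightarrow> card (\<beta> i) \<le> c"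
    "\<And>u v. u \<in> U \<Longrightarrow> v \<in> U \<Longrightarrow> E u v \<Longrightarrow> \<exists>i<n. u \<in> \<beta> i \<and> v \<in> \<beta> i"
    "\<And>v. v \<in> U \<Longrightarrow> \<exists>t<n. v \<in> \<beta> t \<and> (\<forall>i<n. v \<in> \<beta> i \<longrightarrow> i \<noteq> t \<longrightarrow> 0 < i \<and> v \<in> \<beta> (par i))"
  using assms unfolding rooted_dec_def by simp_all

lemma rooted_dec_single:
  assumes "finite R" "card R \<le> c"
  shows "rooted_dec E R R c 1 id (\<lambda>_. R)"
  using assms by (auto simp: rooted_dec_def)

lemma rooted_dec_attach:
  assumes 1: "rooted_dec E U R c n par \<beta>" and 2: "rooted_dec E U' R' c n' par' \<beta>'"
    and meet: "U \<inter> U' \<subseteq> R \<inter> R'"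
    and edges: "\<And>u v. u \<in> U \<union> U' \<Longrightarrow> v \<in> U \<union> U' \<Longrightarrow> E u v \<Longrightarrow> (u \<in> U \<and> v \<in> U) \<or> (u \<in> U' \<and> v \<in> U')"
  shows "rooted_dec E (U \<union> U') R c (n + n')
    (\<lambda>i. if i < n then par i else if i = n then 0 else n + par' (i - n))
    (\<lambda>i. if i < n then \<beta> i else \<beta>' (i - n))" (is "rooted_dec E _ R c _ ?p ?b")
proof -
  note D1 = rooted_decD[OF 1] and D2 = rooted_decD[OF 2]
  have shift: "\<exists>j. i = n + j \<and> j < n'" if "i < n + n'" "\<not> i < n" for i
    using that by (intro exI[of _ "i - n"]) auto
  have par: "?p i < i" if "0 < i" "i < n + n'" for i
  proof (cases "i \<le> n")
    case True
    then show ?thesis using D1(1,2) that by auto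
  next
    case False
    then have "par' (i - n) < i - n" using D2(2)[of "i - n"] that by auto
    then show ?thesis using False by auto
  qed
  have "(\<Union>i<n + n'. ?b i) = (\<Union>i<n. \<beta> i) \<union> (\<Union>i<n'. \<beta>' i)"
  proof (intro equalityI subsetI)
    fix x assume "x \<in> (\<Union>i<n + n'. ?b i)"
    then obtain i where "i < n + n'" "x \<in> ?b i" by blast
    then show "x \<in> (\<Union>i<n. \<beta> i) \<union> (\<Union>i<n'. \<beta>' i)" using shift[of i] by (cases "i < n") auto
  next
    fix x assume "x \<in> (\<Union>i<n. \<beta> i) \<union> (\<Union>i<n'. \<beta>' i)"
    then consider i where "i < n" "x \<in> \<beta> i" | i where "i < n'" "x \<in> \<beta>' i" by blast
    then show "x \<in> (\<Union>i<n + n'. ?b i)"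
    proof cases
      case 1 then show ?thesis by (intro UN_I[of i]) auto
    next
      case 2 then show ?thesis by (intro UN_I[of "n + i"]) auto
    qed
  qed
  then have un: "(\<Union>i<n + n'. ?b i) = U \<union> U'" using D1(4) D2(4) by simp
  have fin: "finite (?b i) \<and> card (?b i) \<le> c" if "i < n + n'" for i
    using shift[OF that] D1(5,6) D2(5,6) by auto
  have edge: "\<exists>i<n + n'. u \<in> ?b i \<and> v \<in> ?b i" if "u \<in> U \<union> U'" "v \<in> U \<union> U'" "E u v" for u v
    using edges[OF that]
  proof
    assume "u \<in> U \<and> v \<in> U"
    then obtain i where "i < n" "u \<in> \<beta> i" "v \<in> \<beta> i" using D1(7) \<open>E u v\<close> by blast
    then show ?thesis by (intro exI[of _ i]) auto
  next
    assume "u \<in> U' \<and> v \<in> U'"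
    then obtain i where "i < n'" "u \<in> \<beta>' i" "v \<in> \<beta>' i" using D2(7) \<open>E u v\<close> by blast
    then show ?thesis by (intro exI[of _ "n + i"]) auto
  qed
  have top: "\<exists>t<n + n'. v \<in> ?b t \<and> (\<forall>i<n + n'. v \<in> ?b i \<longrightarrow> i \<noteq> t \<longrightarrow> 0 < i \<and> v \<in> ?b (?p i))"
    if v: "v \<in> U \<union> U'" for v
  proof (cases "v \<in> U")
    case True
    obtain t where t: "t < n" "v \<in> \<beta> t" "\<And>i. i < n \<Longrightarrow> v \<in> \<beta> i \<Longrightarrow> i \<noteq> t \<Longrightarrow> 0 < i \<and> v \<in> \<beta> (par i)"
      using D1(8)[OF True] by blast
    have "0 < i \<and> v \<in> ?b (?p i)" if i: "i < n + n'" "v \<in> ?b i" "i \<noteq> t" for i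
    proof (cases "i < n")
      case True
      then have "0 < i \<and> v \<in> \<beta> (par i)" using t(3) i by simp
      moreover from this have "par i < n" using D1(2)[of i] True by linarith
      ultimately show ?thesis using True by simp
    next
      case False
      then obtain j where j: "i = n + j" "j < n'" using shift i by blast
      have v': "v \<in> \<beta>' j" using i False j by simp
      then have "v \<in> U'" using j D2(4) by blast
      then have "v \<in> R" "v \<in> R'" using meet \<open>v \<in> U\<close> by auto
      then have v0: "v \<in> \<beta> 0" "v \<in> \<beta>' 0" using D1(3) D2(3) by auto
      show ?thesis
      proof (cases "j = 0")
        case True
        then show ?thesis using v0 D1(1) j by simp
      next
        case False
        obtain t' where t': "t' < n'" "\<And>i. i < n' \<Longrightarrow> v \<in> \<beta>' i \<Longrightarrow> i \<noteq> t' \<Longrightarrow> 0 < i \<and> v \<in> \<beta>' (par' i)"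
          using D2(8)[OF \<open>v \<in> U'\<close>] by blast
        have "t' = 0" using t'(2)[of 0] D2(1) v0 by blast
        then have "v \<in> \<beta>' (par' j)" using t'(2) j False v' by blast
        then show ?thesis using j False by simp
      qed
    qed
    then show ?thesis using t by (intro exI[of _ t]) auto
  next
    case False
    then have vU: "v \<in> U'" using v by simp
    obtain t where t: "t < n'" "v \<in> \<beta>' t" "\<And>i. i < n' \<Longrightarrow> v \<in> \<beta>' i \<Longrightarrow> i \<noteq> t \<Longrightarrow> 0 < i \<and> v \<in> \<beta>' (par' i)"
      using D2(8)[OF vU] by blast
    have "0 < i \<and> v \<in> ?b (?p i)" if i: "i < n + n'" "v \<in> ?b i" "i \<noteq> n + t" for i
    proof -
      have "\<not> i < n" using i(2) False D1(4) by auto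
      then obtain j where j: "i = n + j" "j < n'" using shift i by blast
      then have "0 < j \<and> v \<in> \<beta>' (par' j)" using t(3)[of j] i by auto
      then show ?thesis using j by simp
    qed
    then show ?thesis using t by (intro exI[of _ "n + t"]) auto
  qed
  show ?thesis unfolding rooted_dec_def
    using par un fin edge top D1(1,3) by simp
qed

lemma rooted_dec_attach_all:
  assumes fin: "finite \<D>" and R: "finite R" "card R \<le> c"
    and nbs: "\<And>D. D \<in> \<D> \<Longrightarrow> D \<subseteq> V - R \<and> nbs E V D \<subseteq> R \<and> (\<exists>n par \<beta>. rooted_dec E (D \<union> nbs E V D) (nbs E V D) c n par \<beta>)"
    and disj: "\<And>D D'. D \<in> \<D> \<Longrightarrow> D' \<in> \<D> \<Longrightarrow> D \<noteq> D' \<Longrightarrow> D \<inter> D' = {}"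
    and RV: "R \<subseteq> V" and symE: "\<And>x y. E x y \<Longrightarrow> E y x"
  shows "\<exists>n par \<beta>. rooted_dec E (R \<union> \<Union>\<D>) R c n par \<beta>"
  using fin nbs disj
proof (induction \<D> rule: finite_induct)
  case empty
  then show ?case using rooted_dec_single[OF R, of E] by auto
next
  case (insert D \<D>)
  have "\<exists>n par \<beta>. rooted_dec E (R \<union> \<Union>\<D>) R c n par \<beta>"
    by (rule insert.IH) (use insert.prems in auto)
  then obtain n par \<beta> where 1: "rooted_dec E (R \<union> \<Union>\<D>) R c n par \<beta>" by blast
  have D: "D \<subseteq> V - R" "nbs E V D \<subseteq> R" using insert.prems(1) by auto
  obtain n' par' \<beta>' where 2: "rooted_dec E (D \<union> nbs E V D) (nbs E V D) c n' par' \<beta>'"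
    using insert.prems(1)[OF insertI1] by (elim conjE exE)
  have disj: "D \<inter> D' = {}" if "D' \<in> \<D>" for D'
    using insert.prems(2)[of D D'] insert.hyps(2) that by blast
  have sub: "R \<union> \<Union>\<D> \<subseteq> V" using insert.prems(1) RV by blast
  have meet: "(R \<union> \<Union>\<D>) \<inter> (D \<union> nbs E V D) \<subseteq> R \<inter> nbs E V D"
  proof
    fix x assume x: "x \<in> (R \<union> \<Union>\<D>) \<inter> (D \<union> nbs E V D)"
    then have "x \<notin> D" using D(1) disj by blast
    then show "x \<in> R \<inter> nbs E V D" using x D(2) by blast
  qed
  have in_nbs: "v \<in> D \<union> nbs E V D" if "u \<in> D" "v \<in> V" "E u v" for u v
    using that(1,2) symE[OF that(3)] by (auto simp: nbs_def)
  have "(R \<union> \<Union>\<D>) \<union> (D \<union> nbs E V D) = R \<union> \<Union>(insert D \<D>)" using D by blast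
  moreover have "rooted_dec E ((R \<union> \<Union>\<D>) \<union> (D \<union> nbs E V D)) R c (n + n')
    (\<lambda>i. if i < n then par i else if i = n then 0 else n + par' (i - n))
    (\<lambda>i. if i < n then \<beta> i else \<beta>' (i - n))"
  proof (rule rooted_dec_attach[OF 1 2 meet])
    fix u v assume uv: "u \<in> (R \<union> \<Union>\<D>) \<union> (D \<union> nbs E V D)" "v \<in> (R \<union> \<Union>\<D>) \<union> (D \<union> nbs E V D)" "E u v"
    show "(u \<in> R \<union> \<Union>\<D> \<and> v \<in> R \<union> \<Union>\<D>) \<or> (u \<in> D \<union> nbs E V D \<and> v \<in> D \<union> nbs E V D)"
    proof (cases "u \<in> D \<or> v \<in> D")
      case True
      have "nbs E V D \<subseteq> V" by (auto simp: nbs_def)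
      then have "u \<in> V" "v \<in> V" using uv(1,2) sub D(1) by blast+
      then show ?thesis using True in_nbs[of u v] in_nbs[of v u] uv(3) symE[OF uv(3)] by blast
    next
      case False
      then show ?thesis using uv D by blast
    qed
  qed
  ultimately show ?case by auto
qed

text \<open>A graph has bounded tree-width if its components belong to a family \<open>P\<close> of connected sets with
  few neighbours, each of which can be broken into smaller members of the family by deleting few of
  its own vertices. The recursion puts the neighbours and the deleted vertices into one bag.\<close>

locale separable_family = ugraph E for E :: "'a \<Rightarrow> 'a \<Rightarrow> bool" +
  fixes V :: "'a set" and P :: "'a set \<Rightarrow> bool" and q p :: nat
  assumes finV: "finite V"
    and whole: "\<And>s. s \<in> V \<Longrightarrow> P (component E V s)"
    and few_nbs: "\<And>C. P C \<Longrightarrow> C \<subseteq> V \<and> card (nbs E V C) \<le> q"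
    and split: "\<And>C. P C \<Longrightarrow> \<exists>B\<subseteq>C. B \<noteq> {} \<and> card B \<le> p \<and> (\<forall>s\<in>C - B. P (component E (C - B) s))"
begin

lemma comps_disjoint:
  assumes "s \<in> S" "t \<in> S" "component E S s \<noteq> component E S t"
  shows "component E S s \<inter> component E S t = {}"
proof (rule ccontr)
  assume "\<not> ?thesis"
  then obtain x where "x \<in> component E S s" "x \<in> component E S t" by blast
  then show False using comp_eq assms by metis
qed

lemma nbs_comp: "s \<in> C - B \<Longrightarrow> C \<subseteq> V \<Longrightarrow> nbs E V (component E (C - B) s) \<subseteq> nbs E V C \<union> B"
  using comp_subset[of s "C - B" E] comp_step[of _ E "C - B" s] sym unfolding nbs_def by blast

lemma dec_member:
  assumes "P C"
  shows "\<exists>n par \<beta>. rooted_dec E (C \<union> nbs E V C) (nbs E V C) (q + p) n par \<beta>"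
  using assms
proof (induction "card C" arbitrary: C rule: less_induct)
  case less
  have C: "C \<subseteq> V" "card (nbs E V C) \<le> q" using few_nbs[OF less.prems] by auto
  obtain B where B: "B \<subseteq> C" "B \<noteq> {}" "card B \<le> p" "\<And>s. s \<in> C - B \<Longrightarrow> P (component E (C - B) s)"
    using split[OF less.prems] by blast
  let ?N = "nbs E V C" and ?\<D> = "component E (C - B) ` (C - B)"
  have fin: "finite C" "finite B" "finite ?N"
    using finite_subset[OF C(1) finV] finite_subset[OF B(1)] finite_subset[OF _ finV, of ?N]
    by (auto simp: nbs_def)
  have Nsub: "?N \<subseteq> V - C" by (auto simp: nbs_def)
  have cardR: "card (?N \<union> B) \<le> q + p"
    using card_Un_le[of ?N B] C(2) B(3) by linarith
  have "\<exists>n par \<beta>. rooted_dec E (?N \<union> B \<union> \<Union>?\<D>) (?N \<union> B) (q + p) n par \<beta>"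
  proof (rule rooted_dec_attach_all)
    fix D assume "D \<in> ?\<D>"
    then obtain s where s: "s \<in> C - B" "D = component E (C - B) s" by blast
    have sub: "D \<subseteq> C - B" unfolding s(2) by (rule comp_subset[OF s(1)])
    have "D \<subset> C" using sub B(1,2) by blast
    then have "card D < card C" using fin(1) psubset_card_mono by blast
    then have "\<exists>n par \<beta>. rooted_dec E (D \<union> nbs E V D) (nbs E V D) (q + p) n par \<beta>"
      using less.hyps B(4) s by blast
    then show "D \<subseteq> V - (?N \<union> B) \<and> nbs E V D \<subseteq> ?N \<union> B \<and>
        (\<exists>n par \<beta>. rooted_dec E (D \<union> nbs E V D) (nbs E V D) (q + p) n par \<beta>)"
      using sub Nsub C(1) nbs_comp[OF s(1) C(1)] s(2) by (intro conjI) blast+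
  next
    fix D D' assume D: "D \<in> ?\<D>" "D' \<in> ?\<D>" "D \<noteq> D'"
    then obtain s t where "s \<in> C - B" "D = component E (C - B) s" "t \<in> C - B" "D' = component E (C - B) t"
      by blast
    then show "D \<inter> D' = {}" using comps_disjoint D(3) by simp
  qed (use fin C B Nsub cardR sym in auto)
  then obtain n par \<beta> where dec: "rooted_dec E (?N \<union> B \<union> \<Union>?\<D>) (?N \<union> B) (q + p) n par \<beta>" by blast
  have "\<Union>?\<D> = C - B" by (rule Union_component)
  then have "?N \<union> B \<union> \<Union>?\<D> = C \<union> ?N" using B(1) by blast
  with dec have "rooted_dec E (C \<union> ?N) ?N (q + p) n par \<beta>"
    by (simp add: rooted_dec_def)
  then show ?case by blast
qed

lemma dec_whole: "\<exists>n par \<beta>. rooted_dec E V {} (q + p) n par \<beta>"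
proof -
  let ?\<D> = "component E V ` V"
  have "\<exists>n par \<beta>. rooted_dec E ({} \<union> \<Union>?\<D>) {} (q + p) n par \<beta>"
  proof (rule rooted_dec_attach_all)
    fix D assume "D \<in> ?\<D>"
    then obtain s where s: "s \<in> V" "D = component E V s" by blast
    have "nbs E V D = {}" using nbs_comp[of s V "{}"] s by (auto simp: nbs_def)
    then show "D \<subseteq> V - {} \<and> nbs E V D \<subseteq> {} \<and>
        (\<exists>n par \<beta>. rooted_dec E (D \<union> nbs E V D) (nbs E V D) (q + p) n par \<beta>)"
      using dec_member[OF whole[OF s(1)]] s comp_subset[of s V E] by simp
  next
    fix D D' assume D: "D \<in> ?\<D>" "D' \<in> ?\<D>" "D \<noteq> D'"
    then obtain s t where "s \<in> V" "D = component E V s" "t \<in> V" "D' = component E V t"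
      by blast
    then show "D \<inter> D' = {}" using comps_disjoint D(3) by simp
  qed (use finV sym in auto)
  moreover have "{} \<union> \<Union>?\<D> = V" using Union_component[of E V] by simp
  ultimately show ?thesis by simp
qed

end

text \<open>The symmetric digraph of the rooted tree on \<open>{..<n}\<close> given by the parent function.\<close>

definition parent_tree :: "nat \<Rightarrow> (nat \<Rightarrow> nat) \<Rightarrow> nat pair_pre_digraph" where
  "parent_tree n par = \<lparr> pverts = {..<n},
     parcs = {(i, j). (0 < i \<and> i < n \<and> j = par i) \<or> (0 < j \<and> j < n \<and> i = par j)} \<rparr>"

lemma connected_to_top:
  fixes G :: "(nat, 'b) pre_digraph"
  assumes top: "t \<in> verts G"
    and step: "\<And>i. i \<in> verts G \<Longrightarrow> i \<noteq> t \<Longrightarrow> par i \<in> verts G \<and> par i < i \<and> (i, par i) \<in> arcs_ends G"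
  shows "connected G"
proof -
  let ?M = "mk_symmetric G"
  have both: "(i, t) \<in> rtrancl_on (pverts ?M) (parcs ?M) \<and> (t, i) \<in> rtrancl_on (pverts ?M) (parcs ?M)"
    if "i \<in> verts G" for i
    using that
  proof (induction i rule: less_induct)
    case (less i)
    show ?case
    proof (cases "i = t")
      case True
      then show ?thesis using top by simp
    next
      case False
      note s = step[OF less.prems False]
      have arcs: "(i, par i) \<in> parcs ?M" "(par i, i) \<in> parcs ?M"
        using s by (auto simp: parcs_mk_symmetric arcs_ends_conv)
      have "(par i, t) \<in> rtrancl_on (pverts ?M) (parcs ?M)" "(t, par i) \<in> rtrancl_on (pverts ?M) (parcs ?M)"
        using less.IH s by auto
      then show ?thesis
        using arcs less.prems by (auto intro: converse_rtrancl_on_into_rtrancl_on rtrancl_on_into_rtrancl_on)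
    qed
  qed
  show ?thesis
    unfolding connected_def strongly_connected_def reachable_def
    using top both by (auto intro: rtrancl_on_trans)
qed

lemma pcas_nth:
  "pcas u p v \<Longrightarrow> set p \<subseteq> A \<Longrightarrow>
     (\<forall>i<length p. (pawalk_verts u p ! i, pawalk_verts u p ! Suc i) \<in> A) \<and>
     pawalk_verts u p ! 0 = u \<and> pawalk_verts u p ! length p = v \<and> length (pawalk_verts u p) = Suc (length p)"
proof (induction p arbitrary: u)
  case Nil
  then show ?case by simp
next
  case (Cons e p)
  then have IH: "\<forall>i<length p. (pawalk_verts (snd e) p ! i, pawalk_verts (snd e) p ! Suc i) \<in> A"
    "pawalk_verts (snd e) p ! 0 = snd e" "pawalk_verts (snd e) p ! length p = v"
    "length (pawalk_verts (snd e) p) = Suc (length p)" by auto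
  have "(pawalk_verts u (e # p) ! i, pawalk_verts u (e # p) ! Suc i) \<in> A" if "i < length (e # p)" for i
  proof (cases i)
    case 0
    then show ?thesis using Cons.prems IH(2) by auto
  next
    case (Suc j)
    then show ?thesis using IH(1) that by auto
  qed
  then show ?case using Cons.prems IH by auto
qed

text \<open>On a cycle both neighbours of the largest node would be its parent.\<close>

lemma undirected_tree_parent_tree:
  assumes n: "0 < n" and par: "\<And>i. 0 < i \<Longrightarrow> i < n \<Longrightarrow> par i < i"
  shows "undirected_tree (parent_tree n par)"
proof -
  let ?T = "parent_tree n par"
  have arcD: "i < n \<and> j < n \<and> i \<noteq> j \<and> (j < i \<longrightarrow> j = par i) \<and> (i < j \<longrightarrow> i = par j)"
    if "(i, j) \<in> parcs ?T" for i j
    using that par[of i] par[of j] by (auto simp: parent_tree_def)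
  have arcD': "par i < n" "par i \<noteq> i" "i \<noteq> par i" if "0 < i" "i < n" for i
    using par[OF that] that by auto
  have "parcs ?T \<subseteq> {..<n} \<times> {..<n}" using arcD by auto
  then have "finite (parcs ?T)" by (rule finite_subset) simp
  then have pg: "pair_graph ?T"
    using arcD' by unfold_locales (auto simp: parent_tree_def symmetric_def sym_def)
  have conn: "connected ?T"
  proof (rule connected_to_top[where t = 0 and par = par])
    show "0 \<in> verts (with_proj ?T)" using n by (simp add: parent_tree_def)
  next
    fix i assume "i \<in> verts (with_proj ?T)" "i \<noteq> 0"
    then show "par i \<in> verts (with_proj ?T) \<and> par i < i \<and> (i, par i) \<in> arcs_ends (with_proj ?T)"
      using par[of i] by (auto simp: parent_tree_def)
  qed
  have "\<not> (\<exists>c. pre_digraph.cycle ?T c \<and> 3 \<le> length c)"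
  proof
    assume "\<exists>c. pre_digraph.cycle ?T c \<and> 3 \<le> length c"
    then obtain c u where c: "pre_digraph.awalk ?T u c u"
      "distinct (tl (pre_digraph.awalk_verts ?T u c))" "3 \<le> length c"
      unfolding pre_digraph.cycle_def by blast
    let ?v = "\<lambda>i. pawalk_verts u c ! i" and ?m = "length c"
    have cas: "pcas u c u" "set c \<subseteq> parcs ?T"
      using c(1) by (simp_all add: pre_digraph.awalk_def cas_with_proj_eq)
    note walk = pcas_nth[OF cas]
    have arc: "(?v i, ?v (Suc i)) \<in> parcs ?T" if "i < ?m" for i using walk that by blast
    have ends: "?v 0 = ?v ?m" using walk by simp
    have inj: "i = j" if "?v i = ?v j" "i \<in> {1..?m}" "j \<in> {1..?m}" for i j
    proof -
      have len: "length (tl (pawalk_verts u c)) = ?m" using walk by simp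
      have "tl (pawalk_verts u c) ! (i - 1) = tl (pawalk_verts u c) ! (j - 1)"
        using that len by (cases i; cases j) (auto simp: nth_tl)
      then have "i - 1 = j - 1"
        using c(2) that len by (subst (asm) nth_eq_iff_index_eq) (auto simp: awalk_verts_with_proj_eq)
      then show ?thesis using that by auto
    qed
    define M where "M = Max (?v ` {1..?m})"
    have "M \<in> ?v ` {1..?m}" unfolding M_def using c(3) by (intro Max_in) auto
    then obtain i where i: "i \<in> {1..?m}" "?v i = M" by auto
    have le: "?v j \<le> M" if "j \<in> {1..?m}" for j unfolding M_def using that by (intro Max_ge) auto
    define prev where "prev = (if i = 1 then ?m else i - 1)"
    define nxt where "nxt = (if i = ?m then 1 else Suc i)"
    have pn: "prev \<in> {1..?m}" "nxt \<in> {1..?m}" "prev \<noteq> nxt"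
      using i(1) c(3) by (auto simp: prev_def nxt_def)
    have "(?v (i - 1), ?v (Suc (i - 1))) \<in> parcs ?T" by (rule arc) (use i in auto)
    then have "(?v prev, M) \<in> parcs ?T" using i ends by (auto simp: prev_def split: if_splits)
    then have p: "?v prev = par M" using arcD le[OF pn(1)] by (metis le_neq_implies_less)
    have "(M, ?v nxt) \<in> parcs ?T"
    proof (cases "i = ?m")
      case True
      then show ?thesis using arc[of 0] i ends c(3) by (cases c) (auto simp: nxt_def)
    next
      case False
      then show ?thesis using arc[of i] i by (auto simp: nxt_def)
    qed
    then have "?v nxt = par M" using arcD le[OF pn(2)] by (metis le_neq_implies_less)
    then show False using inj[of prev nxt] pn p by simp
  qed
  then show ?thesis using pg conn by (simp add: undirected_tree_def)
qed

lemma treewidth_le_of_rooted_dec: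
  assumes wf: "\<And>u v. (u, v) \<in> parcs H \<Longrightarrow> u \<in> pverts H \<and> v \<in> pverts H"
    and dec: "rooted_dec (\<lambda>u v. (u, v) \<in> parcs H) (pverts H) {} c n par \<beta>"
  shows "treewidth H \<le> c - 1"
proof -
  note D = rooted_decD[OF dec]
  let ?T = "parent_tree n par"
  have conn: "connected (with_proj ?T \<restriction> {t \<in> pverts ?T. v \<in> \<beta> t})" if v: "v \<in> pverts H" for v
  proof -
    let ?G = "with_proj ?T \<restriction> {t \<in> pverts ?T. v \<in> \<beta> t}"
    obtain t where t: "t < n" "v \<in> \<beta> t" "\<And>i. i < n \<Longrightarrow> v \<in> \<beta> i \<Longrightarrow> i \<noteq> t \<Longrightarrow> 0 < i \<and> v \<in> \<beta> (par i)"
      using D(8)[OF v] by blast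
    show ?thesis
    proof (rule connected_to_top[where t = t and par = par])
      show "t \<in> verts ?G" using t by (simp add: parent_tree_def)
    next
      fix i assume "i \<in> verts ?G" "i \<noteq> t"
      then have i: "i < n" "v \<in> \<beta> i" "0 < i" "v \<in> \<beta> (par i)" using t(3)[of i] by (auto simp: parent_tree_def)
      then have "par i < i" using D(2) by simp
      then show "par i \<in> verts ?G \<and> par i < i \<and> (i, par i) \<in> arcs_ends ?G"
        using i by (auto simp: parent_tree_def arcs_ends_conv induce_subgraph_def)
    qed
  qed
  have "tree_decomposition H ?T \<beta>"
    unfolding tree_decomposition_def
  proof (intro conjI)
    show "undirected_tree ?T" using undirected_tree_parent_tree D(1,2) by blast
    show "(\<Union>t\<in>pverts ?T. \<beta> t) = pverts H" using D(4) by (simp add: parent_tree_def)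
    show "\<forall>(u, v)\<in>parcs H. \<exists>t\<in>pverts ?T. u \<in> \<beta> t \<and> v \<in> \<beta> t"
      using D(7) wf by (fastforce simp: parent_tree_def)
  qed (use conn in blast)
  then have "treewidth H \<le> decomposition_width ?T \<beta>"
    unfolding treewidth_def by (intro Least_le) blast
  also have "\<dots> \<le> c - 1"
  proof -
    have "Max ((\<lambda>t. card (\<beta> t)) ` pverts ?T) \<le> c"
      using D(1,6) by (subst Max_le_iff) (auto simp: parent_tree_def)
    then show ?thesis by (simp add: decomposition_width_def)
  qed
  finally show ?thesis .
qed

section \<open>Rows, columns and dyadic strips\<close>

abbreviation row :: "nat \<times> nat \<Rightarrow> nat" where "row v \<equiv> fst v"
abbreviation pos :: "nat \<times> nat \<Rightarrow> int" where "pos v \<equiv> int (snd v)"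

text \<open>The constants below describe the graph for fixed \<open>g\<close> and \<open>k\<close>: its vertices \<open>V\<close>, its adjacency
  relation \<open>E\<close>, and the predicate \<open>cen i x\<close>, which says that column \<open>x\<close> has level \<open>i\<close>, that is, has
  its centre in row \<open>i\<close>. The vertices of row \<open>i\<close> with vertical edges lie at multiples of \<open>D i\<close>: an odd
  multiple is the centre of a star whose leaves are in the higher rows, an even one is a leaf of a
  star centred in a lower row. Positions are integers, so that both sides of a column can be treated
  alike.\<close>

locale dyadic_graph =
  fixes g k :: nat
  assumes g: "1 \<le> g"
begin

definition V :: "(nat \<times> nat) set" where "V = {1..k} \<times> {0..2 ^ (k + g)}"
definition E :: "nat \<times> nat \<Rightarrow> nat \<times> nat \<Rightarrow> bool" where "E u v \<longleftrightarrow> (u, v) \<in> parcs (Ggk g k)"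
definition D :: "nat \<Rightarrow> int" where "D i = 2 ^ (k - i + g)"
definition cen :: "nat \<Rightarrow> int \<Rightarrow> bool" where
  "cen i x \<longleftrightarrow> 1 \<le> i \<and> i \<le> k \<and> 0 < x \<and> x < 2 ^ (k + g) \<and> (\<exists>b. odd b \<and> x = b * D i)"

lemma D_pos: "0 < D i" by (simp add: D_def)

lemma D_mult: "i \<le> j \<Longrightarrow> j \<le> k \<Longrightarrow> D i = 2 ^ (j - i) * D j"
  by (simp add: D_def flip: power_add)

lemma D_Suc: "i < k \<Longrightarrow> D i = 2 * D (Suc i)"
  using D_mult[of i "Suc i"] by simp

lemma total_length: "i \<le> k \<Longrightarrow> (2::int) ^ (k + g) = 2 ^ i * D i"
  by (simp add: D_def flip: power_add)

lemma cen_nat: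
  assumes "1 \<le> i" "i \<le> k"
  shows "(\<exists>b\<in>{1..2 ^ i - 1}. odd b \<and> x = b * 2 ^ (k - i + g)) \<longleftrightarrow> cen i (int x)"
proof
  assume "\<exists>b\<in>{1..2 ^ i - 1}. odd b \<and> x = b * 2 ^ (k - i + g)"
  then obtain b where b: "1 \<le> b" "b \<le> 2 ^ i - 1" "odd b" "x = b * 2 ^ (k - i + g)" by auto
  then have "b < 2 ^ i" using assms by (cases "(2::nat) ^ i") auto
  then have "int b < int (2 ^ i)" by (simp only: of_nat_less_iff)
  then have "int b < 2 ^ i" by simp
  then have "int b * D i < 2 ^ i * D i" using D_pos[of i] by simp
  then show "cen i (int x)"
    using b assms D_pos[of i] total_length[of i]
    by (auto simp: cen_def D_def intro!: exI[of _ "int b"])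
next
  assume "cen i (int x)"
  then have x: "0 < int x" "int x < 2 ^ (k + g)" and "\<exists>b. odd b \<and> int x = b * D i"
    unfolding cen_def by blast+
  then obtain b where "odd b" "int x = b * D i" by blast
  note b = this x
  have "0 < b" using b(2,3) D_pos[of i] by (simp add: zero_less_mult_iff)
  have "b * D i < 2 ^ i * D i" using b(2,4) total_length[OF assms(2)] by simp
  then have "b < 2 ^ i" using D_pos[of i] by simp
  have "x = nat b * 2 ^ (k - i + g)"
    using b(2) \<open>0 < b\<close> by (simp add: D_def flip: of_nat_eq_iff[where ?'a = int])
  moreover have "nat b \<in> {1..2 ^ i - 1}"
    using \<open>0 < b\<close> \<open>b < 2 ^ i\<close> by (simp add: nat_le_iff of_nat_diff)
  moreover have "odd (nat b)" using b(1) \<open>0 < b\<close> by (simp add: even_nat_iff)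
  ultimately show "\<exists>b\<in>{1..2 ^ i - 1}. odd b \<and> x = b * 2 ^ (k - i + g)" by blast
qed

lemma E_iff:
  "E u v \<longleftrightarrow> u \<in> V \<and> v \<in> V \<and>
     ((row u = row v \<and> \<bar>pos u - pos v\<bar> = 1) \<or>
      (pos u = pos v \<and> ((cen (row u) (pos u) \<and> row u < row v) \<or> (cen (row v) (pos u) \<and> row v < row u))))"
proof -
  obtain i x j y where uv: "u = (i, x)" "v = (j, y)" by (cases u, cases v)
  have diff: "\<bar>int x - int y\<bar> = 1 \<longleftrightarrow> y = x + 1 \<or> x = y + 1" by linarith
  have "E u v \<longleftrightarrow> u \<in> V \<and> v \<in> V \<and>
      ((i = j \<and> y = x + 1 \<or> i < j \<and> x = y \<and> (\<exists>b\<in>{1..2 ^ i - 1}. odd b \<and> x = b * 2 ^ (k - i + g))) \<or>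
       (j = i \<and> x = y + 1 \<or> j < i \<and> y = x \<and> (\<exists>b\<in>{1..2 ^ j - 1}. odd b \<and> y = b * 2 ^ (k - j + g))))"
    unfolding E_def Ggk_def undirected_def uv V_def by simp
  also have "\<dots> \<longleftrightarrow> u \<in> V \<and> v \<in> V \<and>
      ((i = j \<and> y = x + 1 \<or> i < j \<and> x = y \<and> cen i (int x)) \<or>
       (j = i \<and> x = y + 1 \<or> j < i \<and> y = x \<and> cen j (int y)))"
  proof (rule conj_cong[OF HOL.refl], rule conj_cong[OF HOL.refl])
    assume "u \<in> V" "v \<in> V"
    then have "1 \<le> i" "i \<le> k" "1 \<le> j" "j \<le> k" unfolding uv V_def by auto
    note cen_nat[OF this(1,2), of x] cen_nat[OF this(3,4), of y]
    then show "((i = j \<and> y = x + 1 \<or> i < j \<and> x = y \<and> (\<exists>b\<in>{1..2 ^ i - 1}. odd b \<and> x = b * 2 ^ (k - i + g))) \<or>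
       (j = i \<and> x = y + 1 \<or> j < i \<and> y = x \<and> (\<exists>b\<in>{1..2 ^ j - 1}. odd b \<and> y = b * 2 ^ (k - j + g)))) \<longleftrightarrow>
      ((i = j \<and> y = x + 1 \<or> i < j \<and> x = y \<and> cen i (int x)) \<or>
       (j = i \<and> x = y + 1 \<or> j < i \<and> y = x \<and> cen j (int y)))" by argo
  qed
  also have "\<dots> \<longleftrightarrow> u \<in> V \<and> v \<in> V \<and>
     ((row u = row v \<and> \<bar>pos u - pos v\<bar> = 1) \<or>
      (pos u = pos v \<and> ((cen (row u) (pos u) \<and> row u < row v) \<or> (cen (row v) (pos u) \<and> row v < row u))))"
    unfolding uv fst_conv snd_conv diff by auto
  finally show ?thesis .
qed

lemma E_sym: "E u v \<Longrightarrow> E v u"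
  unfolding E_iff[of u v] E_iff[of v u] by (auto simp: abs_minus_commute)

sublocale ugraph E by unfold_locales (rule E_sym)

lemma E_V: "E u v \<Longrightarrow> u \<in> V \<and> v \<in> V" by (simp add: E_iff)

lemma E_neq: "E u v \<Longrightarrow> u \<noteq> v" by (auto simp: E_iff)

lemma E_pos: "\<forall>u v. E u v \<longrightarrow> \<bar>pos u - pos v\<bar> \<le> 1" by (auto simp: E_iff)

lemma V_bounds: "v \<in> V \<Longrightarrow> 1 \<le> row v \<and> row v \<le> k \<and> 0 \<le> pos v \<and> pos v \<le> 2 ^ (k + g)"
  using of_nat_mono[of "snd v" "2 ^ (k + g)", where ?'a = int] by (auto simp: V_def)

lemma cen_bounds: "cen i x \<Longrightarrow> 1 \<le> i \<and> i \<le> k \<and> 0 < x \<and> x < 2 ^ (k + g)"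
  by (simp add: cen_def)

lemma cen_dvd: "cen i x \<Longrightarrow> i \<le> j \<Longrightarrow> j \<le> k \<Longrightarrow> D j dvd x"
  by (auto simp: cen_def D_mult[of i j])

lemma cen_unique:
  assumes "cen i x" "cen j x"
  shows "i = j"
proof -
  have False if "cen i x" "cen j x" "i < j" for i j
  proof -
    obtain b c where b: "odd b" "x = b * D i" and c: "odd c" "x = c * D j" "j \<le> k"
      using \<open>cen i x\<close> \<open>cen j x\<close> by (auto simp: cen_def)
    have "c * D j = b * 2 ^ (j - i) * D j" using b c D_mult[of i j] that by simp
    then have "c = b * 2 ^ (j - i)" using D_pos[of j] by simp
    then show False using c(1) that(3) by simp
  qed
  then show ?thesis using assms by (metis linorder_neqE_nat)
qed

lemma cen_dvd_2: "cen i x \<Longrightarrow> 2 ^ g dvd x"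
  by (auto simp: cen_def D_def power_add)

lemma cen_far: "cen i x \<Longrightarrow> cen j y \<Longrightarrow> x \<noteq> y \<Longrightarrow> 2 ^ g \<le> \<bar>x - y\<bar>"
  using dvd_imp_le_int[of "x - y" "2 ^ g"] dvd_diff[OF cen_dvd_2[of i x] cen_dvd_2[of j y]] by simp

lemma two_le_pow: "(2::int) \<le> 2 ^ g"
  using power_increasing[OF g, of "2::int"] by simp

text \<open>Of two consecutive multiples of \<open>D i\<close> exactly one has its centre in row \<open>i\<close>.\<close>

lemma odd_end:
  assumes i: "1 \<le> i" "i \<le> k" and u: "D i dvd u" "0 \<le> u" "u + D i \<le> 2 ^ (k + g)"
  obtains x where "x = u \<or> x = u + D i" "cen i x" "\<And>y. u \<le> y \<Longrightarrow> y \<le> u + D i \<Longrightarrow> cen i y \<Longrightarrow> y = x"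
proof -
  obtain b where b: "u = b * D i" using u(1) by (metis dvd_def mult.commute)
  have b0: "0 \<le> b" using u(2) b D_pos[of i] by (simp add: zero_le_mult_iff)
  have "(b + 1) * D i \<le> 2 ^ i * D i" using u(3) b total_length[OF i(2)] by (simp add: algebra_simps)
  then have b1: "b + 1 \<le> 2 ^ i" using D_pos[of i] by simp
  have even: "even ((2::int) ^ i)" using i by simp
  have unique: "c = b \<or> c = b + 1" if "u \<le> c * D i" "c * D i \<le> u + D i" for c
  proof -
    have "b * D i \<le> c * D i" "c * D i \<le> (b + 1) * D i" using that b by (simp_all add: algebra_simps)
    then have "b \<le> c" "c \<le> b + 1" using D_pos[of i] by simp_all
    then show ?thesis by linarith
  qed
  show ?thesis
  proof (cases "odd b")
    case True
    then have "0 < b" using b0 by (cases "b = 0") auto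
    moreover have "b * D i < 2 ^ (k + g)" using u(3) b D_pos[of i] by linarith
    ultimately have "cen i u" using True b i D_pos[of i] by (auto simp: cen_def)
    moreover have "y = u" if y: "u \<le> y" "y \<le> u + D i" "cen i y" for y
    proof -
      obtain c where c: "odd c" "y = c * D i" using y(3) by (auto simp: cen_def)
      then have "c = b \<or> c = b + 1" using unique y by blast
      then have "c = b" using c(1) True by auto
      then show ?thesis using c(2) b by simp
    qed
    ultimately show ?thesis using that by blast
  next
    case False
    then have "b + 1 < 2 ^ i" using b1 even by (metis even_plus_one_iff order_less_le)
    then have "(b + 1) * D i < 2 ^ (k + g)" using total_length[OF i(2)] D_pos[of i] by simp
    moreover have "0 < (b + 1) * D i" using b0 D_pos[of i] by simp
    moreover have eq: "u + D i = (b + 1) * D i" using b by (simp add: algebra_simps)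
    moreover have "odd (b + 1)" using False by simp
    ultimately have "cen i (u + D i)" unfolding cen_def using i by metis
    moreover have "y = u + D i" if y: "u \<le> y" "y \<le> u + D i" "cen i y" for y
    proof -
      obtain c where c: "odd c" "y = c * D i" using y(3) by (auto simp: cen_def)
      then have "c = b \<or> c = b + 1" using unique y by blast
      then have "c = b + 1" using c(1) False by auto
      then show ?thesis using c(2) eq by simp
    qed
    ultimately show ?thesis using that by blast
  qed
qed

text \<open>Two connected sets which cross the same strip between consecutive multiples of \<open>D m\<close> in the
  rows from \<open>m\<close> on touch. If one of them contains the centre in row \<open>m\<close> on the boundary, then the
  other one contains this centre or one of its leaves; otherwise both avoid row \<open>m\<close>, and cross the
  left half of the strip.\<close>

lemma crossing_sets_touch:
  assumes "1 \<le> m" "m \<le> k" "D m dvd u" "0 \<le> u" "u + D m \<le> 2 ^ (k + g)"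
    and "conn E C" "C \<subseteq> {v\<in>V. u \<le> pos v \<and> pos v \<le> u + D m \<and> m \<le> row v}"
    and "conn E C'" "C' \<subseteq> {v\<in>V. u \<le> pos v \<and> pos v \<le> u + D m \<and> m \<le> row v}"
    and "a \<in> C" "pos a = u" "b \<in> C" "pos b = u + D m"
    and "a' \<in> C'" "pos a' = u" "b' \<in> C'" "pos b' = u + D m"
  shows "touch E C C'"
  using assms
proof (induction "k - m" arbitrary: m u C C' a b a' b' rule: less_induct)
  case less
  obtain x where x: "x = u \<or> x = u + D m" "cen m x" "\<And>y. u \<le> y \<Longrightarrow> y \<le> u + D m \<Longrightarrow> cen m y \<Longrightarrow> y = x"
    using odd_end[of m u] less.prems(1-5) by blast
  obtain c where c: "c \<in> C" "pos c = x" using x(1) less.prems by metis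
  obtain c' where c': "c' \<in> C'" "pos c' = x" using x(1) less.prems by metis
  have rows: "m \<le> row c" "m \<le> row c'" "c \<in> V" "c' \<in> V" "row c \<le> k" "row c' \<le> k"
    using c c' less.prems(7,9) V_bounds by blast+
  show ?case
  proof (cases "(\<exists>v\<in>C. row v = m \<and> pos v = x) \<or> (\<exists>v\<in>C'. row v = m \<and> pos v = x)")
    case True
    have centre: "v = w \<or> E v w" if "v \<in> V" "w \<in> V" "row v = m" "pos v = x" "pos w = x" "m \<le> row w" for v w
    proof (cases "row w = m")
      case True
      then show ?thesis using that by (auto intro: prod_eqI)
    next
      case False
      then show ?thesis using that x(2) by (auto simp: E_iff)
    qed
    from True show ?thesis
    proof
      assume "\<exists>v\<in>C. row v = m \<and> pos v = x"
      then obtain v where v: "v \<in> C" "row v = m" "pos v = x" by blast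
      then have "v = c' \<or> E v c'" using centre[of v c'] c' rows less.prems(7) by blast
      then show ?thesis using v c' unfolding touch_def by blast
    next
      assume "\<exists>v\<in>C'. row v = m \<and> pos v = x"
      then obtain v where v: "v \<in> C'" "row v = m" "pos v = x" by blast
      then have "v = c \<or> E c v" using centre[of v c] c rows less.prems(9) sym by blast
      then show ?thesis using v c unfolding touch_def by blast
    qed
  next
    case False
    have mk: "m < k"
    proof (rule ccontr)
      assume "\<not> m < k"
      then have "row c = m" using rows less.prems(2) by linarith
      then show False using False c by blast
    qed
    let ?w = "u + D (Suc m)"
    have w: "?w \<le> u + D m" using D_Suc[OF mk] D_pos[of "Suc m"] by linarith
    have half: "\<exists>C1 a1 b1. conn E C1 \<and> C1 \<subseteq> B \<and> C1 \<subseteq> {v\<in>V. u \<le> pos v \<and> pos v \<le> ?w \<and> Suc m \<le> row v}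
        \<and> a1 \<in> C1 \<and> pos a1 = u \<and> b1 \<in> C1 \<and> pos b1 = ?w"
      if B: "conn E B" "B \<subseteq> {v\<in>V. u \<le> pos v \<and> pos v \<le> u + D m \<and> m \<le> row v}"
        and ends: "a \<in> B" "pos a = u" "b \<in> B" "pos b = u + D m"
        and d: "d \<in> B" "pos d = x"
        and avoid: "\<not> (\<exists>v\<in>B. row v = m \<and> pos v = x)" for B a b d
    proof -
      have off: "B \<subseteq> {v. row v \<noteq> m}"
      proof (rule conn_closed[OF B(1) d(1)])
        show "d \<in> {v. row v \<noteq> m}" using avoid d by blast
        fix v w assume vw: "v \<in> B" "v \<in> {v. row v \<noteq> m}" "w \<in> B" "E v w"
        show "w \<in> {v. row v \<noteq> m}"
        proof (rule ccontr)
          assume "w \<notin> {v. row v \<noteq> m}"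
          then have "row w = m" "row v \<noteq> m" "m \<le> row v" using vw B(2) by auto
          then have "cen m (pos w)" using vw(4) by (auto simp: E_iff)
          then have "pos w = x" using x(3) B(2) vw(3) by auto
          then show False using avoid vw(3) \<open>row w = m\<close> by blast
        qed
      qed
      have "pos a \<le> u" "?w \<le> pos b" "u \<le> ?w" using ends w D_pos[of "Suc m"] by simp_all
      then obtain C1 c1 d1 where C1: "conn E C1" "C1 \<subseteq> B" "\<And>v. v \<in> C1 \<Longrightarrow> u \<le> pos v \<and> pos v \<le> ?w"
        "c1 \<in> C1" "pos c1 = u" "d1 \<in> C1" "pos d1 = ?w"
        using conn_between_levels[OF B(1) E_pos ends(1) _ ends(3)] by blast
      have "v \<in> V \<and> u \<le> pos v \<and> pos v \<le> ?w \<and> Suc m \<le> row v" if "v \<in> C1" for v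
      proof -
        have "v \<in> V" "m \<le> row v" "row v \<noteq> m" using B(2) off C1(2) that by auto
        then show ?thesis using C1(3)[OF that] by simp
      qed
      then show ?thesis using C1 by blast
    qed
    obtain C1 a1 b1 where 1: "conn E C1" "C1 \<subseteq> C" "C1 \<subseteq> {v\<in>V. u \<le> pos v \<and> pos v \<le> ?w \<and> Suc m \<le> row v}"
        "a1 \<in> C1" "pos a1 = u" "b1 \<in> C1" "pos b1 = ?w"
      using half[OF less.prems(6,7,10-13) c] False by blast
    obtain C2 a2 b2 where 2: "conn E C2" "C2 \<subseteq> C'" "C2 \<subseteq> {v\<in>V. u \<le> pos v \<and> pos v \<le> ?w \<and> Suc m \<le> row v}"
        "a2 \<in> C2" "pos a2 = u" "b2 \<in> C2" "pos b2 = ?w"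
      using half[OF less.prems(8,9,14-17) c'] False by blast
    have "touch E C1 C2"
    proof (rule less.hyps[of "Suc m" u])
      show "D (Suc m) dvd u" using less.prems(3) D_Suc[OF mk] by (metis dvd_mult_right)
      show "?w \<le> 2 ^ (k + g)" using w less.prems(5) by linarith
      show "a1 \<in> C1" "b1 \<in> C1" "a2 \<in> C2" "b2 \<in> C2" by fact+
    qed (use mk less.prems(1,2,4) 1 2 in auto)
    then show ?thesis using touch_mono 1(2) 2(2) by blast
  qed
qed

end

section \<open>Sets meeting a star\<close>

context dyadic_graph begin

text \<open>The star of a column consists of its centre and all vertices above; in a column without a
  centre it is the whole column.\<close>

definition star :: "int \<Rightarrow> (nat \<times> nat) set" where
  "star y = {v \<in> V. pos v = y \<and> (\<forall>m. cen m y \<longrightarrow> m \<le> row v)}"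

lemma star_cen: "cen m y \<Longrightarrow> star y = {v \<in> V. pos v = y \<and> m \<le> row v}"
  unfolding star_def using cen_unique by blast

text \<open>The rows above \<open>t\<close> between the two columns at distance \<open>D t\<close> from column \<open>y\<close>. When the level
  of \<open>y\<close> is at most \<open>t\<close>, this region can be left only through these two columns and through the
  centre of \<open>y\<close>.\<close>

definition inside :: "int \<Rightarrow> nat \<Rightarrow> (nat \<times> nat) set" where
  "inside y t = {v \<in> V. \<bar>pos v - y\<bar> < D t \<and> t < row v}"

lemma inside_exit:
  assumes y: "cen m y" "m \<le> t" "t \<le> k" and ab: "E a b" "a \<in> inside y t" "b \<notin> inside y t"
  shows "(\<bar>pos b - y\<bar> = D t \<and> t < row b) \<or> (row b = m \<and> pos b = y)"
proof (cases "row a = row b")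
  case True
  then have "\<bar>pos a - pos b\<bar> = 1" "b \<in> V" using ab(1) by (auto simp: E_iff)
  moreover have "\<bar>pos a - y\<bar> < D t" "t < row b" using ab(2) True by (auto simp: inside_def)
  ultimately show ?thesis using ab(3) by (auto simp: inside_def)
next
  case False
  then have v: "pos a = pos b" "b \<in> V" "cen (row b) (pos a) \<or> row a < row b"
    using ab(1) by (auto simp: E_iff)
  have a: "\<bar>pos a - y\<bar> < D t" "t < row a" using ab(2) by (auto simp: inside_def)
  then have b: "row b \<le> t" "cen (row b) (pos a)" using v ab(3) by (auto simp: inside_def)
  then have "D t dvd pos a - y" using dvd_diff[OF cen_dvd[OF b(2,1) y(3)] cen_dvd[OF y]] by blast
  then have "pos a = y" using a(1) D_pos[of t] dvd_imp_le_int[of "pos a - y" "D t"] by force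
  then show ?thesis using cen_unique y(1) b(2) v(1) by auto
qed

lemma strip_bounds:
  assumes "cen m y" "m \<le> t" "t \<le> k"
  shows "D t dvd y" "0 \<le> y - D t" "y + D t \<le> 2 ^ (k + g)"
proof -
  show "D t dvd y" using cen_dvd assms by blast
  then obtain c where c: "y = c * D t" by (metis dvd_def mult.commute)
  have "0 < c * D t" "c * D t < 2 ^ t * D t" using assms(1) c total_length[OF assms(3)] by (auto simp: cen_def)
  then have "0 < c" "c < 2 ^ t" using D_pos[of t] by (auto simp: zero_less_mult_iff)
  then have "1 * D t \<le> c * D t" "(c + 1) * D t \<le> 2 ^ t * D t"
    using D_pos[of t] by (auto intro!: mult_right_mono simp del: mult_1)
  then show "0 \<le> y - D t" "y + D t \<le> 2 ^ (k + g)"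
    using c total_length[OF assms(3)] by (simp_all add: algebra_simps)
qed

text \<open>Crossing a strip at distance between \<open>l\<close> and \<open>l + D r\<close> from column \<open>y\<close>, on the side given by
  the sign \<open>s\<close>.\<close>

definition crosses :: "int \<Rightarrow> int \<Rightarrow> nat \<Rightarrow> int \<Rightarrow> (nat \<times> nat) set \<Rightarrow> bool" where
  "crosses y s r l B \<longleftrightarrow> (\<exists>C\<subseteq>B. conn E C \<and>
     C \<subseteq> {v\<in>V. l \<le> s * (pos v - y) \<and> s * (pos v - y) \<le> l + D r \<and> r \<le> row v} \<and>
     (\<exists>a\<in>C. s * (pos a - y) = l) \<and> (\<exists>b\<in>C. s * (pos b - y) = l + D r))"

lemma crosses_touch:
  assumes s: "s = 1 \<or> s = -1" and r: "1 \<le> r" "r \<le> k" "D r dvd y" "D r dvd l" "0 \<le> l"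
    "0 \<le> y - (l + D r)" "y + (l + D r) \<le> 2 ^ (k + g)"
    and cr: "crosses y s r l B" "crosses y s r l B'"
  shows "touch E B B'"
proof -
  obtain C a b where C: "C \<subseteq> B" "conn E C" "a \<in> C" "s * (pos a - y) = l" "b \<in> C" "s * (pos b - y) = l + D r"
    "C \<subseteq> {v\<in>V. l \<le> s * (pos v - y) \<and> s * (pos v - y) \<le> l + D r \<and> r \<le> row v}"
    using cr(1) unfolding crosses_def by blast
  obtain C' a' b' where C': "C' \<subseteq> B'" "conn E C'" "a' \<in> C'" "s * (pos a' - y) = l" "b' \<in> C'" "s * (pos b' - y) = l + D r"
    "C' \<subseteq> {v\<in>V. l \<le> s * (pos v - y) \<and> s * (pos v - y) \<le> l + D r \<and> r \<le> row v}"
    using cr(2) unfolding crosses_def by blast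
  have "touch E C C'"
    using s
  proof
    assume s: "s = 1"
    show ?thesis
    proof (rule crossing_sets_touch[OF r(1,2), of "y + l" C C' a b a' b'])
      show "C \<subseteq> {v \<in> V. y + l \<le> pos v \<and> pos v \<le> y + l + D r \<and> r \<le> row v}" using C(7) s by auto
      show "C' \<subseteq> {v \<in> V. y + l \<le> pos v \<and> pos v \<le> y + l + D r \<and> r \<le> row v}" using C'(7) s by auto
    qed (use C(2-6) C'(2-6) s r D_pos[of r] in auto)
  next
    assume s: "s = -1"
    show ?thesis
    proof (rule crossing_sets_touch[OF r(1,2), of "y - l - D r" C C' b a b' a'])
      show "C \<subseteq> {v \<in> V. y - l - D r \<le> pos v \<and> pos v \<le> y - l - D r + D r \<and> r \<le> row v}" using C(7) s by auto
      show "C' \<subseteq> {v \<in> V. y - l - D r \<le> pos v \<and> pos v \<le> y - l - D r + D r \<and> r \<le> row v}" using C'(7) s by auto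
    qed (use C(2-6) C'(2-6) s r D_pos[of r] in auto)
  qed
  then show ?thesis using touch_mono C(1) C'(1) by blast
qed

lemma reach_border:
  assumes y: "cen m y" "m \<le> t" "t \<le> k" and B: "conn E B" "B \<subseteq> V" "\<And>v. v \<in> B \<Longrightarrow> \<not> (row v = m \<and> pos v = y)"
    and b: "b \<in> B" "\<bar>pos b - y\<bar> \<le> D t" "t < row b" and e: "e \<in> B" "e \<notin> inside y t"
  obtains C d where "conn E C" "C \<subseteq> B" "b \<in> C" "d \<in> C" "\<bar>pos d - y\<bar> = D t"
    "\<And>v. v \<in> C \<Longrightarrow> v \<in> V \<and> \<bar>pos v - y\<bar> \<le> D t \<and> t < row v"
proof -
  let ?S = "{v\<in>B. \<bar>pos v - y\<bar> \<le> D t \<and> t < row v}"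
  let ?C = "component E ?S b"
  have sub: "?C \<subseteq> ?S" by (rule comp_subset) (use b in auto)
  have "\<exists>d\<in>?C. \<bar>pos d - y\<bar> = D t"
  proof (rule ccontr)
    assume no: "\<not> ?thesis"
    then have ins: "?C \<subseteq> inside y t" using sub B(2) by (auto simp: inside_def order_less_le)
    have "B \<subseteq> ?C"
    proof (rule conn_closed[OF B(1) b(1)])
      show "b \<in> ?C" by (rule comp_self)
      fix u v assume uv: "u \<in> B" "u \<in> ?C" "v \<in> B" "E u v"
      have "v \<in> ?S"
      proof (cases "v \<in> inside y t")
        case True
        then show ?thesis using uv(3) by (auto simp: inside_def)
      next
        case False
        moreover have "u \<in> inside y t" using ins uv(2) by blast
        ultimately have "\<bar>pos v - y\<bar> = D t \<and> t < row v"
          using inside_exit[OF y uv(4)] B(3)[OF uv(3)] by blast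
        then show ?thesis using uv(3) by simp
      qed
      then show "v \<in> ?C" using comp_step[OF uv(2) _ _ uv(4)] b by blast
    qed
    then show False using e ins by blast
  qed
  moreover have "conn E ?C" by (rule conn_comp) (use b in auto)
  ultimately show ?thesis using that[of ?C] sub comp_self[of b E ?S] B(2) by blast
qed

lemma crosses_from_column:
  assumes y: "cen m y" "m \<le> t" "t \<le> k" and B: "conn E B" "B \<subseteq> V" "\<And>v. v \<in> B \<Longrightarrow> \<not> (row v = m \<and> pos v = y)"
    and b: "b \<in> B" "pos b = y" "t < row b" and e: "e \<in> B" "e \<notin> inside y t"
  obtains s where "s = 1 \<or> s = -1" "crosses y s t 0 B"
proof -
  have "\<bar>pos b - y\<bar> \<le> D t" using b(2) D_pos[of t] by simp
  then obtain C d where C: "conn E C" "C \<subseteq> B" "b \<in> C" "d \<in> C" "\<bar>pos d - y\<bar> = D t"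
    "\<And>v. v \<in> C \<Longrightarrow> v \<in> V \<and> \<bar>pos v - y\<bar> \<le> D t \<and> t < row v"
    using reach_border[OF y B b(1) _ b(3) e] by blast
  define s :: int where "s = (if pos d < y then -1 else 1)"
  have s: "s = 1 \<or> s = -1" "s * (pos d - y) = D t" using C(5) by (auto simp: s_def)
  have lip: "\<forall>u v. E u v \<longrightarrow> \<bar>s * (pos u - y) - s * (pos v - y)\<bar> \<le> 1"
  proof (intro allI impI)
    fix u v assume "E u v"
    then have "\<bar>pos u - pos v\<bar> \<le> 1" using E_pos by blast
    then show "\<bar>s * (pos u - y) - s * (pos v - y)\<bar> \<le> 1" using s(1) by auto
  qed
  have "s * (pos b - y) \<le> 0" "D t \<le> s * (pos d - y)" using b(2) s(2) by auto
  then obtain C' p q where C': "conn E C'" "C' \<subseteq> C" "\<And>v. v \<in> C' \<Longrightarrow> 0 \<le> s * (pos v - y) \<and> s * (pos v - y) \<le> D t"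
    "p \<in> C'" "s * (pos p - y) = 0" "q \<in> C'" "s * (pos q - y) = D t"
    using conn_between_levels[OF C(1) lip C(3) _ C(4) _ less_imp_le[OF D_pos]] by blast
  have "crosses y s t 0 B"
    unfolding crosses_def
  proof (intro exI[of _ C'] conjI)
    show "\<exists>a\<in>C'. s * (pos a - y) = 0" "\<exists>b\<in>C'. s * (pos b - y) = 0 + D t" using C'(4-7) by auto
    show "C' \<subseteq> {v \<in> V. 0 \<le> s * (pos v - y) \<and> s * (pos v - y) \<le> 0 + D t \<and> t \<le> row v}"
      using C'(2,3) C(6) by fastforce
  qed (use C' C(2) in auto)
  then show ?thesis using that s(1) by blast
qed

lemma stays_on_side:
  assumes s: "s = 1 \<or> s = -1" and C: "conn E C" "b \<in> C" "0 < s * (pos b - y)" "\<And>v. v \<in> C \<Longrightarrow> pos v \<noteq> y"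
    and v: "v \<in> C"
  shows "0 < s * (pos v - y)"
proof -
  have "C \<subseteq> {v. 0 < s * (pos v - y)}"
  proof (rule conn_closed[OF C(1,2)])
    fix u w assume uw: "u \<in> C" "u \<in> {v. 0 < s * (pos v - y)}" "w \<in> C" "E u w"
    then have "\<bar>pos u - pos w\<bar> \<le> 1" "pos w \<noteq> y" using E_pos C(4) by blast+
    then show "w \<in> {v. 0 < s * (pos v - y)}" using uw(2) s by auto
  qed (use C in auto)
  then show ?thesis using v by blast
qed

lemma crosses_from_side:
  assumes s: "s = 1 \<or> s = -1" and y: "cen m y" "m \<le> t" "t < k"
    and X: "conn E X" "X \<subseteq> V" "\<And>v. v \<in> X \<Longrightarrow> pos v = y \<Longrightarrow> row v \<le> t \<and> row v \<noteq> m"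
    and b: "b \<in> X" "0 < s * (pos b - y)" "s * (pos b - y) \<le> D (Suc t)" "t < row b"
    and e: "e \<in> X" "e \<notin> inside y t"
  shows "crosses y s (Suc t) (D (Suc t)) X"
proof -
  have D2: "D t = 2 * D (Suc t)" using D_Suc[OF y(3)] .
  have "\<bar>pos b - y\<bar> \<le> D t" using b(2,3) s D2 by auto
  then obtain C d where C: "conn E C" "C \<subseteq> X" "b \<in> C" "d \<in> C" "\<bar>pos d - y\<bar> = D t"
    "\<And>v. v \<in> C \<Longrightarrow> v \<in> V \<and> \<bar>pos v - y\<bar> \<le> D t \<and> t < row v"
    using reach_border[OF y(1,2) _ X(1,2) _ b(1) _ b(4) e] X(3) y(3) by (metis less_or_eq_imp_le)
  have off: "pos v \<noteq> y" if "v \<in> C" for v using C(2,6) X(3) that by (metis leD subsetD)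
  have side: "0 < s * (pos v - y)" if "v \<in> C" for v
    using stays_on_side[OF s C(1) C(3) b(2) off that] .
  then have d: "s * (pos d - y) = D t" using C(4,5) s D_pos[of t] by fastforce
  have lip: "\<forall>u v. E u v \<longrightarrow> \<bar>s * (pos u - y) - s * (pos v - y)\<bar> \<le> 1"
  proof (intro allI impI)
    fix u v assume "E u v"
    then have "\<bar>pos u - pos v\<bar> \<le> 1" using E_pos by blast
    then show "\<bar>s * (pos u - y) - s * (pos v - y)\<bar> \<le> 1" using s by auto
  qed
  have "D t \<le> s * (pos d - y)" "D (Suc t) \<le> D t" using d D2 D_pos[of "Suc t"] by auto
  then obtain C' p q where C': "conn E C'" "C' \<subseteq> C"
    "\<And>v. v \<in> C' \<Longrightarrow> D (Suc t) \<le> s * (pos v - y) \<and> s * (pos v - y) \<le> D t"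
    "p \<in> C'" "s * (pos p - y) = D (Suc t)" "q \<in> C'" "s * (pos q - y) = D t"
    using conn_between_levels[OF C(1) lip C(3) b(3) C(4)] by blast
  show ?thesis
    unfolding crosses_def
  proof (intro exI[of _ C'] conjI)
    show "\<exists>a\<in>C'. s * (pos a - y) = D (Suc t)" "\<exists>b\<in>C'. s * (pos b - y) = D (Suc t) + D (Suc t)"
      using C'(4-7) D2 by auto
    show "C' \<subseteq> {v \<in> V. D (Suc t) \<le> s * (pos v - y) \<and> s * (pos v - y) \<le> D (Suc t) + D (Suc t) \<and> Suc t \<le> row v}"
    proof
      fix v assume "v \<in> C'"
      then show "v \<in> {v \<in> V. D (Suc t) \<le> s * (pos v - y) \<and> s * (pos v - y) \<le> D (Suc t) + D (Suc t) \<and> Suc t \<le> row v}"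
        using C'(3)[of v] subsetD[OF C'(2), of v] C(6)[of v] D2 by auto
    qed
  qed (use C' C(2) D2 in auto)
qed

end

lemma two_distinct:
  assumes "2 \<le> card X"
  shows "\<exists>a\<in>X. \<exists>b\<in>X. a \<noteq> b"
proof (rule ccontr)
  assume "\<not> ?thesis"
  then have "card X \<le> Suc 0"
    using card_le_Suc0_iff_eq[of X] by (cases "finite X") auto
  then show False using assms by simp
qed

lemma rank_exists:
  fixes F :: "nat set"
  assumes "finite F" "0 < n" "n \<le> card F"
  shows "\<exists>t. card {x\<in>F. x \<le> t} = n"
proof -
  let ?c = "\<lambda>t. card {x\<in>F. x \<le> t}"
  have "F \<noteq> {}" using assms by auto
  then have "{x\<in>F. x \<le> Max F} = F" using assms(1) by auto
  then have ex: "n \<le> ?c (Max F)" using assms(3) by simp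
  define t where "t = (LEAST t. n \<le> ?c t)"
  have t: "n \<le> ?c t" unfolding t_def using ex by (rule LeastI)
  have "?c t \<le> n"
  proof (cases t)
    case 0
    have "?c t \<le> card {0::nat}" using 0 by (intro card_mono) auto
    then show ?thesis using assms(2) by simp
  next
    case (Suc t')
    then have "\<not> n \<le> ?c t'" unfolding t_def using not_less_Least by (metis lessI)
    moreover have "?c t \<le> card (insert t {x\<in>F. x \<le> t'})"
      using assms(1) Suc by (intro card_mono) auto
    moreover have "\<dots> \<le> Suc (?c t')" by (rule card_insert_le_m1) auto
    ultimately show ?thesis by linarith
  qed
  then show ?thesis using t by (intro exI[of _ t]) simp
qed

context dyadic_graph begin

text \<open>The bound on the number of pairwise remote sets that meet the star of a column \<open>y\<close> without
  its centre, given three pairwise remote sets which avoid this star and touch all of them. The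
  lowest row in which a set meets the star of \<open>y\<close> gives a linear order. Let \<open>t\<close> be the fourth of these
  rows. At most two of the sets that start up to row \<open>t\<close> also meet column \<open>y\<close> above row \<open>t\<close>, since
  such a set crosses the strip next to \<open>y\<close> on one of its two sides; likewise at most two of the sets
  that start above row \<open>t + 2\<close> leave the inner region \<open>inside y (t + 2)\<close>. Hence there are two low
  sets, which meet column \<open>y\<close> only up to row \<open>t\<close>, and one high set inside the inner region. Two of the sets \<open>A i\<close> approach the high set on the same side of
  \<open>y\<close>; they do not both cross the strip around the inner region, so one of them stays within
  \<open>inside y (t + 1)\<close>, and then both low sets cross the next strip to reach it.\<close>

lemma star_bound:
  fixes A B :: "nat \<Rightarrow> (nat \<times> nat) set"
  assumes y: "cen m y"
    and B: "\<And>j. j < 10 \<Longrightarrow> conn E (B j)" "\<And>j. j < 10 \<Longrightarrow> B j \<subseteq> V"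
      "\<And>i j. i < 10 \<Longrightarrow> j < 10 \<Longrightarrow> i \<noteq> j \<Longrightarrow> \<not> touch E (B i) (B j)"
      "\<And>j v. j < 10 \<Longrightarrow> v \<in> B j \<Longrightarrow> \<not> (row v = m \<and> pos v = y)"
      "\<And>j. j < 10 \<Longrightarrow> B j \<inter> star y \<noteq> {}"
    and A: "\<And>i. i < 3 \<Longrightarrow> conn E (A i)" "\<And>i. i < 3 \<Longrightarrow> A i \<subseteq> V"
      "\<And>i j. i < 3 \<Longrightarrow> j < 3 \<Longrightarrow> i \<noteq> j \<Longrightarrow> \<not> touch E (A i) (A j)"
      "\<And>i. i < 3 \<Longrightarrow> A i \<inter> star y = {}"
    and AB: "\<And>i j. i < 3 \<Longrightarrow> j < 10 \<Longrightarrow> touch E (A i) (B j)"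
  shows False
proof -
  have starB: "\<exists>r. m < r \<and> (\<exists>v\<in>B j. pos v = y \<and> row v = r)" if "j < 10" for j
    using B(5)[OF that] B(4)[OF that] y by (fastforce simp: star_cen[OF y] order_less_le)
  define f where "f j = (LEAST r. m < r \<and> (\<exists>v\<in>B j. pos v = y \<and> row v = r))" for j
  have f: "m < f j \<and> (\<exists>v\<in>B j. pos v = y \<and> row v = f j)" if "j < 10" for j
    unfolding f_def using starB[OF that] by (rule LeastI_ex)
  have f_least: "f j \<le> row v" if "j < 10" "v \<in> B j" "pos v = y" "m < row v" for j v
    unfolding f_def by (rule Least_le) (use that in blast)
  have f_k: "f j \<le> k" if j: "j < 10" for j
  proof -
    obtain v where "v \<in> B j" "row v = f j" using f[OF j] by blast
    then show ?thesis using B(2)[OF j] V_bounds[of v] by auto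
  qed
  have inj: "inj_on f {..<10}"
  proof (rule inj_onI)
    fix i j assume ij: "i \<in> {..<10}" "j \<in> {..<10}" "f i = f j"
    then obtain v w where "v \<in> B i" "w \<in> B j" "pos v = y" "pos w = y" "row v = row w" using f by (metis lessThan_iff)
    moreover from this have "v = w" by (simp add: prod_eq_iff)
    ultimately have "v \<in> B i \<inter> B j" by blast
    then have "touch E (B i) (B j)" unfolding touch_def by blast
    then show "i = j" using B(3) ij by blast
  qed
  have few: "card S \<le> 2" if t: "m \<le> t" "t \<le> k" and S: "S \<subseteq> {..<10}"
    and out: "\<And>j. j \<in> S \<Longrightarrow> (\<exists>v\<in>B j. pos v = y \<and> t < row v) \<and> \<not> B j \<subseteq> inside y t" for t S
  proof -
    have "\<exists>s. (s = 1 \<or> s = -1) \<and> crosses y s t 0 (B j)" if jS: "j \<in> S" for j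
    proof -
      have j: "j < 10" using jS S by blast
      obtain v e where v: "v \<in> B j" "pos v = y" "t < row v" and e: "e \<in> B j" "e \<notin> inside y t"
        using out[OF jS] by blast
      show ?thesis
        using crosses_from_column[OF y t B(1)[OF j] B(2)[OF j] B(4)[OF j] v e] by blast
    qed
    then obtain s where s: "\<And>j. j \<in> S \<Longrightarrow> (s j = 1 \<or> s j = -1) \<and> crosses y (s j) t 0 (B j)" by metis
    have "inj_on s S"
    proof (rule inj_onI, rule ccontr)
      fix i j assume ij: "i \<in> S" "j \<in> S" "s i = s j" "i \<noteq> j"
      note sb = strip_bounds[OF y t]
      have "touch E (B i) (B j)"
        by (rule crosses_touch[of "s i" t y 0]) (use s[OF ij(1)] s[OF ij(2)] ij(3) t sb cen_bounds[OF y] in auto)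
      then show False using B(3) ij S by blast
    qed
    moreover have "s ` S \<subseteq> {1, -1}" using s by blast
    ultimately have "card S \<le> card {1::int, -1}" by (rule card_inj_on_le) simp
    then show ?thesis by simp
  qed
  have "card (f ` {..<10}) = 10" using card_image[OF inj] by simp
  then obtain t where t: "card {x \<in> f ` {..<10}. x \<le> t} = 4"
    using rank_exists[of "f ` {..<10}" 4] by auto
  let ?L = "{j\<in>{..<10}. f j \<le> t}" and ?H = "{j\<in>{..<10}. t + 2 < f j}"
  have "{x \<in> f ` {..<10}. x \<le> t} = f ` ?L" by blast
  then have L: "card ?L = 4" using t card_image[OF inj_on_subset[OF inj, of ?L]] by auto
  have mid: "card {j\<in>{..<10}. f j = t + 1 \<or> f j = t + 2} \<le> 2"
  proof -
    have "card {j\<in>{..<10}. f j = t + 1 \<or> f j = t + 2} \<le> card {t + 1, t + 2}"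
      by (rule card_inj_on_le[of f]) (auto intro: inj_on_subset[OF inj])
    then show ?thesis by simp
  qed
  have H: "4 \<le> card ?H"
  proof -
    let ?M = "{j\<in>{..<10}. f j = t + 1 \<or> f j = t + 2}"
    have "?L \<union> ?M \<union> ?H = {..<10}" by auto
    then have "card (?L \<union> ?M \<union> ?H) = 10" by simp
    then have "10 \<le> card ?L + card ?M + card ?H"
      using card_Un_le[of "?L \<union> ?M" ?H] card_Un_le[of ?L ?M] by linarith
    then show ?thesis using L mid by linarith
  qed
  obtain j0 where "j0 \<in> ?L" using L by (metis card.empty equals0I zero_neq_numeral)
  then have mt: "m < t" using f[of j0] by auto
  obtain h0 where h0: "h0 \<in> ?H" using H by (metis card.empty equals0I not_numeral_le_zero)
  then have tk: "t + 2 < k" using f_k[of h0] by auto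
  have "card {j\<in>?L. \<exists>v\<in>B j. pos v = y \<and> t < row v} \<le> 2"
  proof (rule few[of t])
    fix j assume j: "j \<in> {j\<in>?L. \<exists>v\<in>B j. pos v = y \<and> t < row v}"
    then obtain v where "v \<in> B j" "row v = f j" using f[of j] by auto
    then have "v \<in> B j" "v \<notin> inside y t" using j by (auto simp: inside_def)
    then show "(\<exists>v\<in>B j. pos v = y \<and> t < row v) \<and> \<not> B j \<subseteq> inside y t" using j by blast
  qed (use mt tk in auto)
  then have "2 \<le> card (?L - {j\<in>?L. \<exists>v\<in>B j. pos v = y \<and> t < row v})"
    using L by (subst card_Diff_subset) auto
  then obtain j1 j2 where "j1 \<in> ?L - {j\<in>?L. \<exists>v\<in>B j. pos v = y \<and> t < row v}"
    "j2 \<in> ?L - {j\<in>?L. \<exists>v\<in>B j. pos v = y \<and> t < row v}" "j1 \<noteq> j2"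
    using two_distinct by meson
  then have low: "j1 < 10" "j2 < 10" "j1 \<noteq> j2" "f j1 \<le> t" "f j2 \<le> t"
    "\<And>v. v \<in> B j1 \<Longrightarrow> pos v = y \<Longrightarrow> row v \<le> t" "\<And>v. v \<in> B j2 \<Longrightarrow> pos v = y \<Longrightarrow> row v \<le> t"
    by (auto simp: not_less)
  have "card {j\<in>?H. \<not> B j \<subseteq> inside y (t + 2)} \<le> 2"
  proof (rule few[of "t + 2"])
    fix j assume j: "j \<in> {j\<in>?H. \<not> B j \<subseteq> inside y (t + 2)}"
    then show "(\<exists>v\<in>B j. pos v = y \<and> t + 2 < row v) \<and> \<not> B j \<subseteq> inside y (t + 2)" using f[of j] by auto
  qed (use mt tk in auto)
  then have "card {j\<in>?H. \<not> B j \<subseteq> inside y (t + 2)} \<noteq> card ?H" using H by linarith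
  then have "{j\<in>?H. \<not> B j \<subseteq> inside y (t + 2)} \<noteq> ?H" by metis
  then obtain h where "h \<in> ?H" "B h \<subseteq> inside y (t + 2)" by blast
  then have h: "h < 10" "B h \<subseteq> inside y (t + 2)" by simp_all
  have near: "\<exists>a\<in>A i. \<bar>pos a - y\<bar> \<le> D (t + 2) \<and> t + 2 < row a \<and> pos a \<noteq> y" if i: "i < 3" for i
  proof -
    obtain a b where ab: "a \<in> A i" "b \<in> B h" "b = a \<or> E b a"
      using AB[OF i h(1)] sym unfolding touch_def by blast
    have not_star: "\<not> (pos a = y \<and> m \<le> row a)" using A(2,4)[OF i] ab(1) by (auto simp: star_cen[OF y])
    have "a \<in> inside y (t + 2) \<or> (\<bar>pos a - y\<bar> = D (t + 2) \<and> t + 2 < row a) \<or> (row a = m \<and> pos a = y)"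
      using inside_exit[OF y, of "t + 2" b a] ab h(2) mt tk by auto
    then have "\<bar>pos a - y\<bar> \<le> D (t + 2) \<and> t + 2 < row a" using not_star by (auto simp: inside_def)
    then show ?thesis using not_star mt ab(1) by (intro bexI[of _ a]) auto
  qed
  then obtain a where a: "\<And>i. i < 3 \<Longrightarrow> a i \<in> A i \<and> \<bar>pos (a i) - y\<bar> \<le> D (t + 2) \<and> t + 2 < row (a i) \<and> pos (a i) \<noteq> y"
    by metis
  obtain i1 i2 where i12: "i1 < 3" "i2 < 3" "i1 \<noteq> i2" "pos (a i1) < y \<longleftrightarrow> pos (a i2) < y"
  proof -
    have "(pos (a 0) < y \<longleftrightarrow> pos (a 1) < y) \<or> (pos (a 0) < y \<longleftrightarrow> pos (a 2) < y) \<or> (pos (a 1) < y \<longleftrightarrow> pos (a 2) < y)"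
      by blast
    then show ?thesis using that[of 0 1] that[of 0 2] that[of 1 2] by auto
  qed
  define s :: int where "s = (if pos (a i1) < y then -1 else 1)"
  have s: "s = 1 \<or> s = -1" by (auto simp: s_def)
  have side: "0 < s * (pos (a i) - y) \<and> s * (pos (a i) - y) \<le> D (t + 2)" if "i = i1 \<or> i = i2" for i
    using that i12 a[OF i12(1)] a[OF i12(2)] by (auto simp: s_def)
  have A_off: "row v \<le> t" if "i < 3" "v \<in> A i" "pos v = y" for i v
    using A(2,4)[OF that(1)] that(2,3) mt by (auto simp: star_cen[OF y])
  have A_off': "row v \<noteq> m" if "i < 3" "v \<in> A i" "pos v = y" for i v
    using A(2,4)[OF that(1)] that(2,3) mt by (auto simp: star_cen[OF y])
  have "\<exists>i. (i = i1 \<or> i = i2) \<and> A i \<subseteq> inside y (t + 1)"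
  proof (rule ccontr)
    assume no: "\<not> ?thesis"
    have cr: "crosses y s (Suc (t + 1)) (D (Suc (t + 1))) (A i)" if i: "i = i1 \<or> i = i2" for i
    proof -
      have i3: "i < 3" using i i12 by auto
      obtain e where e: "e \<in> A i" "e \<notin> inside y (t + 1)" using no i by blast
      show ?thesis
      proof (rule crosses_from_side[OF s y, of "t + 1" "A i" "a i" e])
        fix v assume "v \<in> A i" "pos v = y"
        then show "row v \<le> t + 1 \<and> row v \<noteq> m" using A_off[OF i3] A_off'[OF i3] by fastforce
      qed (use mt tk A(1,2)[OF i3] a[OF i3] side[OF i] e in auto)
    qed
    have D2: "D (t + 1) = D (t + 2) + D (t + 2)" using D_Suc[of "t + 1"] tk by simp
    have sb1: "D (t + 2) dvd y" by (rule strip_bounds[OF y]) (use mt tk in auto)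
    have sb2: "0 \<le> y - D (t + 1)" "y + D (t + 1) \<le> 2 ^ (k + g)"
      by (rule strip_bounds[OF y]; use mt tk in simp)+
    have "touch E (A i1) (A i2)"
      by (rule crosses_touch[OF s, of "t + 2" y "D (t + 2)"])
        (use cr sb1 sb2 D2 D_pos[of "t + 2"] tk in auto)
    then show False using A(3) i12 by blast
  qed
  then obtain i where i: "i = i1 \<or> i = i2" "A i \<subseteq> inside y (t + 1)" by blast
  have i3: "i < 3" using i i12 by auto
  have A_side: "0 < s * (pos v - y)" if "v \<in> A i" for v
  proof (rule stays_on_side[OF s A(1)[OF i3] _ _ _ that])
    show "a i \<in> A i" using a[OF i3] by blast
    show "0 < s * (pos (a i) - y)" using side[OF i(1)] by blast
    show "pos w \<noteq> y" if "w \<in> A i" for w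
      using A_off[OF i3 that] i(2) that by (auto simp: inside_def)
  qed
  have cr: "crosses y s (Suc t) (D (Suc t)) (B j)"
    if j: "j < 10" "f j \<le> t" "\<And>v. v \<in> B j \<Longrightarrow> pos v = y \<Longrightarrow> row v \<le> t" for j
  proof -
    obtain u b where ub: "u \<in> A i" "b \<in> B j" "u = b \<or> E u b"
      using AB[OF i3 j(1)] unfolding touch_def by blast
    have "b \<in> inside y (t + 1) \<or> (\<bar>pos b - y\<bar> = D (t + 1) \<and> t + 1 < row b) \<or> (row b = m \<and> pos b = y)"
      using inside_exit[OF y, of "t + 1" u b] ub i(2) mt tk by auto
    then have b: "\<bar>pos b - y\<bar> \<le> D (t + 1)" "t + 1 < row b"
      using B(4)[OF j(1) ub(2)] by (auto simp: inside_def)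
    then have "pos b \<noteq> y" using j(3)[OF ub(2)] by auto
    moreover have "\<bar>pos u - pos b\<bar> \<le> 1" using ub(3) E_pos by fastforce
    ultimately have b_side: "0 < s * (pos b - y)" using A_side[OF ub(1)] s by auto
    obtain e where e: "e \<in> B j" "pos e = y" "row e = f j" using f[OF j(1)] by blast
    show ?thesis
    proof (rule crosses_from_side[OF s y, of t "B j" b e])
      show "s * (pos b - y) \<le> D (Suc t)" using b(1) s b_side by auto
      show "e \<notin> inside y t" using e j(2) by (auto simp: inside_def)
      fix v assume "v \<in> B j" "pos v = y"
      then show "row v \<le> t \<and> row v \<noteq> m" using j(3) B(4)[OF j(1)] by blast
    qed (use mt tk B(1,2)[OF j(1)] ub b b_side e in auto)
  qed
  have D2: "D t = D (t + 1) + D (t + 1)" using D_Suc[of t] tk by simp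
  have sb1: "D (t + 1) dvd y" by (rule strip_bounds[OF y]) (use mt tk in auto)
  have sb2: "0 \<le> y - D t" "y + D t \<le> 2 ^ (k + g)"
    by (rule strip_bounds[OF y]; use mt tk in simp)+
  have "touch E (B j1) (B j2)"
    by (rule crosses_touch[OF s, of "t + 1" y "D (t + 1)"])
      (use cr[of j1] cr[of j2] low sb1 sb2 D2 D_pos[of "t + 1"] tk in auto)
  then show False using B(3) low by blast
qed

end

section \<open>Nested strips\<close>

context dyadic_graph begin

text \<open>A column is active in \<open>H\<close> if \<open>H\<close> contains its centre. A strip between columns \<open>a\<close> and \<open>b\<close> is
  nested if no active column inside it has a smaller level than its ends; then the connected parts
  of \<open>H\<close> leave \<open>region a b\<close> only through the stars of \<open>a\<close> and \<open>b\<close>. Positions outside the graph are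
  admitted as ends; they impose no condition on the rows.\<close>

definition act :: "(nat \<times> nat) set \<Rightarrow> int \<Rightarrow> bool" where
  "act H y \<longleftrightarrow> (\<exists>v\<in>H. pos v = y \<and> cen (row v) y)"

definition region :: "int \<Rightarrow> int \<Rightarrow> (nat \<times> nat) set" where
  "region a b = {v \<in> V. a < pos v \<and> pos v < b \<and> (\<forall>m. cen m a \<or> cen m b \<longrightarrow> m \<le> row v)}"

definition nested :: "(nat \<times> nat) set \<Rightarrow> int \<Rightarrow> int \<Rightarrow> bool" where
  "nested H a b \<longleftrightarrow> (\<forall>y m m'. act H y \<and> a < y \<and> y < b \<and> cen m y \<and> (cen m' a \<or> cen m' b) \<longrightarrow> m' \<le> m)"

definition strip_end :: "(nat \<times> nat) set \<Rightarrow> int \<Rightarrow> bool" where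
  "strip_end H a \<longleftrightarrow> act H a \<or> a < 0 \<or> 2 ^ (k + g) < a"

text \<open>The column \<open>y\<close> of level \<open>m\<close> is active and has the lowest level in the strip.\<close>

definition lowest :: "(nat \<times> nat) set \<Rightarrow> int \<Rightarrow> int \<Rightarrow> nat \<Rightarrow> int \<Rightarrow> bool" where
  "lowest H a b m y \<longleftrightarrow> act H y \<and> cen m y \<and> a < y \<and> y < b \<and>
     (\<forall>y' m'. act H y' \<and> a < y' \<and> y' < b \<and> cen m' y' \<longrightarrow> m \<le> m')"

lemma region_exit:
  assumes H: "H \<subseteq> V" and n: "nested H a b" and u: "u \<in> region a b" "u \<in> H" and v: "v \<in> H" "E u v"
  shows "v \<in> region a b \<or> v \<in> star a \<or> v \<in> star b"
proof -
  have vV: "v \<in> V" using v H by blast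
  have ru: "m \<le> row u" if "cen m a \<or> cen m b" for m using u that by (auto simp: region_def)
  show ?thesis
  proof (cases "row u = row v")
    case True
    then have "\<bar>pos u - pos v\<bar> = 1" using v(2) by (auto simp: E_iff)
    then have "a \<le> pos v" "pos v \<le> b" using u(1) by (auto simp: region_def)
    moreover have "m \<le> row v" if "cen m a \<or> cen m b" for m using ru[OF that] True by simp
    ultimately show ?thesis using vV by (auto simp: region_def star_def)
  next
    case False
    then have e: "pos v = pos u" "row u < row v \<or> cen (row v) (pos u)" using v(2) by (auto simp: E_iff)
    have p: "a < pos v" "pos v < b" using u(1) e by (auto simp: region_def)
    have "m \<le> row v" if m: "cen m a \<or> cen m b" for m
      using e(2)
    proof
      assume "row u < row v"
      then show ?thesis using ru[OF m] by simp
    next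
      assume c: "cen (row v) (pos u)"
      then have "act H (pos v)" using v(1) e(1) by (auto simp: act_def)
      then show ?thesis using n c p e(1) m unfolding nested_def by metis
    qed
    then show ?thesis using p vV by (auto simp: region_def)
  qed
qed

lemma conn_in_region:
  assumes H: "H \<subseteq> V" and n: "nested H a b" and U: "conn E U" "U \<subseteq> H" "u \<in> U" "u \<in> region a b"
    and avoid: "U \<inter> star a = {}" "U \<inter> star b = {}"
  shows "U \<subseteq> region a b"
proof (rule conn_closed[OF U(1,3,4)])
  fix v w assume "v \<in> U" "v \<in> region a b" "w \<in> U" "E v w"
  then show "w \<in> region a b" using region_exit[OF H n, of v w] U(2) avoid by blast
qed

lemma lowest_exists:
  assumes "act H y0" "a < y0" "y0 < b"
  obtains m y where "lowest H a b m y"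
proof -
  let ?P = "\<lambda>m. \<exists>y. act H y \<and> a < y \<and> y < b \<and> cen m y"
  have ex: "\<exists>m. ?P m" using assms unfolding act_def by blast
  define m where "m = (LEAST m. ?P m)"
  have "?P m" unfolding m_def using ex by (rule LeastI_ex)
  moreover have "m \<le> m'" if "?P m'" for m' unfolding m_def using that by (rule Least_le)
  ultimately show ?thesis using that unfolding lowest_def by blast
qed

lemma nested_halves:
  assumes "nested H a b" "lowest H a b m y"
  shows "nested H a y" "nested H y b"
proof -
  have y: "cen m y" "a < y" "y < b" "\<And>y' m'. act H y' \<Longrightarrow> a < y' \<Longrightarrow> y' < b \<Longrightarrow> cen m' y' \<Longrightarrow> m \<le> m'"
    using assms(2) unfolding lowest_def by blast+
  have n: "m' \<le> n" if "act H x" "a < x" "x < b" "cen n x" "cen m' a \<or> cen m' b \<or> cen m' y" for x n m'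
    using that assms(1) y(4)[OF that(1-4)] cen_unique[OF y(1)] unfolding nested_def by blast
  show "nested H a y" "nested H y b"
    unfolding nested_def using n y(2,3) by force+
qed

lemma strip_end_star: "\<not> act H a \<Longrightarrow> strip_end H a \<Longrightarrow> star a = {}"
  using V_bounds unfolding strip_end_def star_def by fastforce

lemma region_halves:
  assumes "v \<in> region a b" "cen m y" "m \<le> row v" "pos v \<noteq> y"
  shows "v \<in> region a y \<or> v \<in> region y b"
proof -
  have "m' \<le> row v" if "cen m' a \<or> cen m' b \<or> cen m' y" for m'
    using that assms(1,3) cen_unique[OF assms(2)] by (auto simp: region_def)
  then show ?thesis using assms(1,4) by (auto simp: region_def)
qed

text \<open>A family of pairwise touching connected sets, such that any three stars of active columns are
  avoided by some member, would be trapped in smaller and smaller nested strips.\<close>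

lemma no_trapped_family:
  assumes H: "H \<subseteq> V"
    and U: "\<And>U. U \<in> \<U> \<Longrightarrow> conn E U \<and> U \<subseteq> H \<and> (\<exists>v\<in>U. cen (row v) (pos v))"
    and pairwise: "\<And>U U'. U \<in> \<U> \<Longrightarrow> U' \<in> \<U> \<Longrightarrow> touch E U U'"
    and avoid: "\<And>a b y. \<exists>U\<in>\<U>. \<forall>z\<in>{a, b, y}. act H z \<longrightarrow> U \<inter> star z = {}"
  shows False
proof -
  have "False" if "nested H a b" "strip_end H a" "strip_end H b" "U \<in> \<U>" "U \<subseteq> region a b" for a b U
    using that
  proof (induction "nat (b - a)" arbitrary: a b U rule: less_induct)
    case less
    obtain v where v: "v \<in> U" "cen (row v) (pos v)" "v \<in> H" using U less.prems(4) by blast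
    then have "act H (pos v)" "a < pos v" "pos v < b"
      using less.prems(5) by (auto simp: act_def region_def)
    then obtain m y where low: "lowest H a b m y" using lowest_exists by blast
    then have y: "act H y" "cen m y" "a < y" "y < b" by (auto simp: lowest_def)
    obtain U' where U': "U' \<in> \<U>" "\<forall>z\<in>{a, b, y}. act H z \<longrightarrow> U' \<inter> star z = {}"
      using avoid[of a b y] by (elim bexE)
    have off: "U' \<inter> star z = {}" if "z \<in> {a, b, y}" for z
      using bspec[OF U'(2) that] strip_end_star[of H z] less.prems(2,3) y(1) that by blast
    note cU = U[OF less.prems(4)] and cU' = U[OF U'(1)]
    have "\<exists>w\<in>U'. w \<in> region a b"
    proof -
      obtain s t where st: "s \<in> U" "t \<in> U'" "s = t \<or> E s t"
        using pairwise[OF less.prems(4) U'(1)] unfolding touch_def by blast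
      then have "t \<in> region a b \<or> t \<in> star a \<or> t \<in> star b"
        using region_exit[OF H less.prems(1), of s t] less.prems(5) cU cU' by blast
      then show ?thesis using off st(2) by blast
    qed
    then have sub: "U' \<subseteq> region a b"
      using conn_in_region[OF H less.prems(1)] cU' off by blast
    obtain w where w: "w \<in> U'" "cen (row w) (pos w)" "w \<in> H" using cU' by blast
    then have "w \<in> region a b" using sub by blast
    then have wr: "w \<in> V" "a < pos w" "pos w < b" by (auto simp: region_def)
    have "act H (pos w)" using w by (auto simp: act_def)
    then have mw: "m \<le> row w" using low w(2) wr(2,3) unfolding lowest_def by blast
    then have "pos w \<noteq> y" using off[of y] w(1) wr(1) by (auto simp: star_cen[OF y(2)])
    then have halves: "w \<in> region a y \<or> w \<in> region y b"
      using region_halves[OF \<open>w \<in> region a b\<close> y(2) mw] by blast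
    have ends: "strip_end H y" using y(1) by (simp add: strip_end_def)
    note nh = nested_halves[OF less.prems(1) low]
    from halves show False
    proof
      assume "w \<in> region a y"
      then have "U' \<subseteq> region a y" using conn_in_region[OF H nh(1)] cU' w(1) off by blast
      then show False using less.hyps[of y a U'] nh(1) less.prems(2) ends U'(1) y(3,4) by simp
    next
      assume "w \<in> region y b"
      then have "U' \<subseteq> region y b" using conn_in_region[OF H nh(2)] cU' w(1) off by blast
      then show False using less.hyps[of b y U'] nh(2) less.prems(3) ends U'(1) y(3,4) by simp
    qed
  qed
  moreover obtain U0 where U0: "U0 \<in> \<U>" using avoid by blast
  moreover have nocen: "\<not> cen m (-1)" "\<not> cen m (2 ^ (k + g) + 1)" for m using cen_bounds by fastforce+
  moreover have "nested H (-1) (2 ^ (k + g) + 1)" using nocen by (simp add: nested_def)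
  moreover have "U0 \<subseteq> region (-1) (2 ^ (k + g) + 1)"
    using U[OF U0] H V_bounds nocen by (fastforce simp: region_def)
  ultimately show False by (fastforce simp: strip_end_def)
qed

end

section \<open>Models of induced minors\<close>

text \<open>Induced minors are described by their models: pairwise disjoint connected branch sets, where
  two branch sets are joined by an edge exactly if the vertices which they represent are adjacent.\<close>

definition minor_model ::
  "('a \<Rightarrow> 'a \<Rightarrow> bool) \<Rightarrow> 'a set \<Rightarrow> ('b \<Rightarrow> 'b \<Rightarrow> bool) \<Rightarrow> 'b set \<Rightarrow> ('b \<Rightarrow> 'a set) \<Rightarrow> bool" where
  "minor_model E V F W X \<longleftrightarrow>
     (\<forall>h\<in>W. X h \<noteq> {} \<and> conn E (X h) \<and> X h \<subseteq> V) \<and>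
     (\<forall>h\<in>W. \<forall>h'\<in>W. h \<noteq> h' \<longrightarrow> X h \<inter> X h' = {} \<and> (F h h' \<longleftrightarrow> touch E (X h) (X h')))"

lemma minor_modelI:
  assumes "\<And>h. h \<in> W \<Longrightarrow> X h \<noteq> {} \<and> conn E (X h) \<and> X h \<subseteq> V"
    and "\<And>h h'. h \<in> W \<Longrightarrow> h' \<in> W \<Longrightarrow> h \<noteq> h' \<Longrightarrow> X h \<inter> X h' = {} \<and> (F h h' \<longleftrightarrow> touch E (X h) (X h'))"
  shows "minor_model E V F W X"
  using assms unfolding minor_model_def by simp

lemma minor_modelD:
  assumes "minor_model E V F W X"
  shows "\<And>h. h \<in> W \<Longrightarrow> X h \<noteq> {}" "\<And>h. h \<in> W \<Longrightarrow> conn E (X h)" "\<And>h. h \<in> W \<Longrightarrow> X h \<subseteq> V"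
    "\<And>h h'. h \<in> W \<Longrightarrow> h' \<in> W \<Longrightarrow> h \<noteq> h' \<Longrightarrow> X h \<inter> X h' = {}"
    "\<And>h h'. h \<in> W \<Longrightarrow> h' \<in> W \<Longrightarrow> h \<noteq> h' \<Longrightarrow> F h h' \<longleftrightarrow> touch E (X h) (X h')"
  using assms unfolding minor_model_def by blast+

lemma conn_model_union:
  assumes X: "minor_model E V F W X" and S: "conn F S" "S \<subseteq> W"
  shows "conn E (\<Union>h\<in>S. X h)"
  unfolding conn_def
proof (intro allI impI, rule ccontr)
  fix R assume ne: "(\<Union>h\<in>S. X h) \<inter> R \<noteq> {}" "(\<Union>h\<in>S. X h) - R \<noteq> {}"
    and no: "\<not> (\<exists>a\<in>(\<Union>h\<in>S. X h) \<inter> R. \<exists>b\<in>(\<Union>h\<in>S. X h) - R. E a b)"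
  note M = minor_modelD[OF X]
  have closed: "b \<in> R" if "h \<in> S" "h' \<in> S" "a \<in> X h" "a \<in> R" "b \<in> X h'" "E a b" for a b h h'
    using that no by blast
  have whole: "X h \<subseteq> R" if h: "h \<in> S" "a \<in> X h" "a \<in> R" for h a
  proof (rule conn_closed[OF M(2) h(2,3)])
    show "h \<in> W" using h S(2) by blast
  qed (use closed h(1) in blast)
  obtain h0 a0 where h0: "h0 \<in> S" "a0 \<in> X h0" "a0 \<in> R" using ne(1) by blast
  have "S \<subseteq> {h. X h \<subseteq> R}"
  proof (rule conn_closed[OF S(1) h0(1)])
    show "h0 \<in> {h. X h \<subseteq> R}" using whole h0 by blast
    fix h h' assume h: "h \<in> S" "h \<in> {h. X h \<subseteq> R}" "h' \<in> S" "F h h'"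
    show "h' \<in> {h. X h \<subseteq> R}"
    proof (cases "h = h'")
      case False
      then obtain a b where "a \<in> X h" "b \<in> X h'" "a = b \<or> E a b"
        using M(5)[of h h'] h S(2) unfolding touch_def by blast
      then show ?thesis using closed[OF h(1,3)] whole[OF h(3)] h(2) by blast
    qed (use h in simp)
  qed
  then show False using ne(2) by blast
qed

context dyadic_graph begin

text \<open>Without centres there are no vertical edges, so a branch set that touches three others cannot
  be part of a union of branch sets without centres: in a single row it has only two neighbours.\<close>

lemma claw_has_centre:
  assumes X: "minor_model E V F W X" and S: "S \<subseteq> W"
    and h: "h \<in> S" "\<And>i. i < 3 \<Longrightarrow> l i \<in> S \<and> l i \<noteq> h \<and> F h (l i)"
    and dist: "\<And>i j. i < 3 \<Longrightarrow> j < 3 \<Longrightarrow> i \<noteq> j \<Longrightarrow> l i \<noteq> l (j::nat)"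
  shows "\<exists>v\<in>(\<Union>h\<in>S. X h). cen (row v) (pos v)"
proof (rule ccontr)
  assume no: "\<not> ?thesis"
  note M = minor_modelD[OF X]
  have flat: "row a = row b \<and> \<bar>pos a - pos b\<bar> = 1" if "a \<in> X i" "b \<in> X j" "i \<in> S" "j \<in> S" "E a b" for a b i j
    using that(5) no that(1-4) by (fastforce simp: E_iff)
  have "\<exists>a b. a \<in> X h \<and> b \<in> X (l i) \<and> E a b" if "i < 3" for i
    using M(5)[of h "l i"] M(4)[of h "l i"] h that S unfolding touch_def by blast
  then obtain a b where ab: "\<And>i. i < 3 \<Longrightarrow> a i \<in> X h \<and> b i \<in> X (l i) \<and> E (a i) (b i)" by metis
  have ab': "row (b i) = row (a i)" "\<bar>pos (a i) - pos (b i)\<bar> = 1" if "i < 3" for i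
    using flat[of "a i" h "b i" "l i"] ab[OF that] h that by auto
  have same_row: "row v = row (a 0)" if "v \<in> X h" for v
  proof -
    have "X h \<subseteq> {v. row v = row (a 0)}"
    proof (rule conn_closed[OF M(2)])
      show "a 0 \<in> X h" using ab[of 0] by simp
      fix x y assume "x \<in> X h" "x \<in> {v. row v = row (a 0)}" "y \<in> X h" "E x y"
      then show "y \<in> {v. row v = row (a 0)}" using flat[of x h y h] h(1) by auto
    qed (use h S in auto)
    then show ?thesis using that by blast
  qed
  have b_row: "row (b i) = row (a 0)" if "i < 3" for i using ab'[OF that] same_row ab[OF that] by simp
  have b_off: "b i \<notin> X h" if "i < 3" for i using ab[OF that] M(4)[of h "l i"] h that S by blast
  have off: "pos w \<noteq> pos (b i)" if w: "w \<in> X h" and i: "i < 3" for w i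
  proof
    assume "pos w = pos (b i)"
    then have "w = b i" using same_row[OF w] b_row[OF i] by (simp add: prod_eq_iff)
    then show False using b_off[OF i] w by simp
  qed
  have side: "(pos v < pos (b i)) = (pos (a i) < pos (b i))" if v: "v \<in> X h" and i: "i < 3" for v i
  proof -
    define s :: int where "s = (if pos (a i) < pos (b i) then -1 else 1)"
    have s: "s = 1 \<or> s = -1" by (simp add: s_def)
    have "0 < s * (pos (a i) - pos (b i))" using ab'(2)[OF i] by (auto simp: s_def)
    then have "0 < s * (pos v - pos (b i))"
      using stays_on_side[OF s M(2), of h "a i" "pos (b i)" v] off[OF _ i] ab[OF i] h(1) S v by blast
    then show ?thesis using ab'(2)[OF i] by (auto simp: s_def split: if_splits)
  qed
  have clash: False if ij: "i < 3" "j < 3" "i \<noteq> j" "(pos (a i) < pos (b i)) = (pos (a j) < pos (b j))" for i j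
  proof -
    have "X (l i) \<inter> X (l j) = {}"
      using M(4)[of "l i" "l j"] h(2)[OF ij(1)] h(2)[OF ij(2)] dist[OF ij(1-3)] S by blast
    then have "b i \<noteq> b j" using ab[OF ij(1)] ab[OF ij(2)] by (metis disjoint_iff)
    then have "pos (b i) \<noteq> pos (b j)" using b_row[OF ij(1)] b_row[OF ij(2)] by (simp add: prod_eq_iff)
    have m: "a i \<in> X h" "a j \<in> X h" using ab[OF ij(1)] ab[OF ij(2)] by blast+
    note facts = \<open>pos (b i) \<noteq> pos (b j)\<close> side[OF m(1) ij(2)] side[OF m(2) ij(1)] off[OF m(1) ij(2)]
      off[OF m(2) ij(1)] ab'(2)[OF ij(1)] ab'(2)[OF ij(2)]
    show False
    proof (cases "pos (a i) < pos (b i)")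
      case True
      then have "pos (a i) < pos (b j)" "pos (a j) < pos (b i)" "pos (a j) < pos (b j)" using facts ij(4) by simp_all
      then show False using True facts(1,6,7) by linarith
    next
      case False
      then have "\<not> pos (a i) < pos (b j)" "\<not> pos (a j) < pos (b i)" "\<not> pos (a j) < pos (b j)" using facts ij(4) by simp_all
      then show False using False facts(1,4-7) by linarith
    qed
  qed
  show False using clash[of 0 1] clash[of 0 2] clash[of 1 2] by auto
qed

text \<open>In a model of a graph with a dense family of connected sets, where every star of an active
  column meets few branch sets, the unions of branch sets over the family would be trapped.\<close>

lemma no_dense_minor:
  assumes X: "minor_model E V F W X"
    and fam: "\<And>S. S \<in> \<F> \<Longrightarrow> S \<subseteq> W \<and> conn F S"
    and claw: "\<And>S. S \<in> \<F> \<Longrightarrow> \<exists>h\<in>S. \<exists>l. (\<forall>i<3. l i \<in> S \<and> l i \<noteq> h \<and> F h (l i)) \<and>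
                (\<forall>i<3. \<forall>j<3. i \<noteq> j \<longrightarrow> l i \<noteq> l (j::nat))"
    and pairwise: "\<And>S S'. S \<in> \<F> \<Longrightarrow> S' \<in> \<F> \<Longrightarrow> touch F S S'"
    and stars: "\<And>h m y v. h \<in> W \<Longrightarrow> v \<in> X h \<Longrightarrow> cen m y \<Longrightarrow> row v = m \<Longrightarrow> pos v = y \<Longrightarrow>
                 card {h\<in>W. X h \<inter> star y \<noteq> {}} \<le> q"
    and avoid: "\<And>Z. Z \<subseteq> W \<Longrightarrow> card Z \<le> 3 * q \<Longrightarrow> \<exists>S\<in>\<F>. S \<inter> Z = {}"
  shows False
proof (rule no_trapped_family[of "\<Union>h\<in>W. X h" "(\<lambda>S. \<Union>h\<in>S. X h) ` \<F>"])
  note M = minor_modelD[OF X]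
  let ?H = "\<Union>h\<in>W. X h"
  show "?H \<subseteq> V" using M(3) by blast
  show "conn E U \<and> U \<subseteq> ?H \<and> (\<exists>v\<in>U. cen (row v) (pos v))" if U: "U \<in> (\<lambda>S. \<Union>h\<in>S. X h) ` \<F>" for U
  proof -
    obtain S where S: "S \<in> \<F>" "U = (\<Union>h\<in>S. X h)" using U by blast
    obtain h l where "h \<in> S" "\<forall>i<3. l i \<in> S \<and> l i \<noteq> h \<and> F h (l i)"
      "\<forall>i<3. \<forall>j<3. i \<noteq> j \<longrightarrow> l i \<noteq> l (j::nat)" using claw[OF S(1)] by blast
    then have "\<exists>v\<in>U. cen (row v) (pos v)"
      unfolding S(2) using claw_has_centre[OF X, of S h l] fam[OF S(1)] by blast
    then show ?thesis using conn_model_union[OF X] fam[OF S(1)] S(2) by blast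
  qed
  show "touch E U U'" if UU: "U \<in> (\<lambda>S. \<Union>h\<in>S. X h) ` \<F>" "U' \<in> (\<lambda>S. \<Union>h\<in>S. X h) ` \<F>" for U U'
  proof -
    obtain S S' where S: "S \<in> \<F>" "U = (\<Union>h\<in>S. X h)" "S' \<in> \<F>" "U' = (\<Union>h\<in>S'. X h)" using UU by blast
    obtain h h' where h: "h \<in> S" "h' \<in> S'" "h = h' \<or> F h h'"
      using pairwise[OF S(1,3)] unfolding touch_def by blast
    have hW: "h \<in> W" "h' \<in> W" using fam S h by blast+
    have "touch E (X h) (X h')"
    proof (cases "h = h'")
      case True
      then show ?thesis using M(1)[OF hW(1)] by (auto simp: touch_def)
    next
      case False
      then show ?thesis using h(3) M(5)[OF hW False] by simp
    qed
    then show ?thesis using touch_mono[of E "X h" "X h'" U U'] S h by blast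
  qed
  fix a b y
  define Z where "Z z = {h\<in>W. act ?H z \<and> X h \<inter> star z \<noteq> {}}" for z
  have card: "card (Z z) \<le> q" for z
  proof (cases "act ?H z")
    case True
    then obtain v where v: "v \<in> ?H" "pos v = z" "cen (row v) z" by (auto simp: act_def)
    then obtain h where h: "h \<in> W" "v \<in> X h" by blast
    then show ?thesis using stars[OF h v(3) _ v(2)] True by (simp add: Z_def)
  qed (simp add: Z_def)
  have "Z a \<union> Z b \<union> Z y \<subseteq> W" by (auto simp: Z_def)
  moreover have "card (Z a \<union> Z b \<union> Z y) \<le> 3 * q"
    using card_Un_le[of "Z a \<union> Z b" "Z y"] card_Un_le[of "Z a" "Z b"] card[of a] card[of b] card[of y]
    by linarith
  ultimately obtain S where S: "S \<in> \<F>" "S \<inter> (Z a \<union> Z b \<union> Z y) = {}" using avoid by blast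
  have "(\<Union>h\<in>S. X h) \<inter> star z = {}" if z: "z \<in> {a, b, y}" "act ?H z" for z
  proof -
    have "S \<inter> Z z = {}" using S(2) z(1) by auto
    then show ?thesis using z(2) fam[OF S(1)] unfolding Z_def by blast
  qed
  then show "\<exists>U\<in>(\<lambda>S. \<Union>h\<in>S. X h) ` \<F>. \<forall>z\<in>{a, b, y}. act ?H z \<longrightarrow> U \<inter> star z = {}"
    using S(1) by blast
qed

end

text \<open>Loop-free symmetric digraphs without parallel arcs; in contrast to \<^locale>\<open>pair_graph\<close>,
  finiteness is not required.\<close>

definition simple_graph :: "'a pair_pre_digraph \<Rightarrow> bool" where
  "simple_graph G \<longleftrightarrow> (\<forall>u v. (u, v) \<in> parcs G \<longrightarrow>
     u \<in> pverts G \<and> v \<in> pverts G \<and> u \<noteq> v \<and> (v, u) \<in> parcs G)"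

abbreviation adj :: "'a pair_pre_digraph \<Rightarrow> 'a \<Rightarrow> 'a \<Rightarrow> bool" where
  "adj G u v \<equiv> (u, v) \<in> parcs G"

lemma ugraph_adj: "simple_graph G \<Longrightarrow> ugraph (adj G)"
  by unfold_locales (auto simp: simple_graph_def)

lemma simple_graph_pair_graph:
  assumes "pair_graph G"
  shows "simple_graph G"
proof -
  interpret pair_graph G by fact
  show ?thesis
    unfolding simple_graph_def
    using in_arcsD1 in_arcsD2 pair_sym_arcs
    by (auto simp: symmetric_def sym_def dest: pair_no_loops)
qed

lemma model_of_reduction:
  assumes "reduces_to G H" and G: "simple_graph G"
  shows "simple_graph H \<and> (\<exists>X. minor_model (adj G) (pverts G) (adj H) (pverts H) X)"
  using assms(1)
proof (induction rule: reduces_to.induct)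
  case refl
  have "minor_model (adj G) (pverts G) (adj G) (pverts G) (\<lambda>v. {v})"
    by (simp add: minor_model_def conn_single touch_def)
  then show ?case using G by blast
next
  case (delete H v)
  then obtain X where X: "minor_model (adj G) (pverts G) (adj H) (pverts H) X" by blast
  have "minor_model (adj G) (pverts G) (adj (delete_vertex v H)) (pverts (delete_vertex v H)) X"
    using X by (simp add: minor_model_def delete_vertex_def)
  moreover have "simple_graph (delete_vertex v H)"
    using delete.IH by (auto simp: simple_graph_def delete_vertex_def)
  ultimately show ?case by blast
next
  case (contract H u v)
  then obtain X where X: "minor_model (adj G) (pverts G) (adj H) (pverts H) X" by blast
  have H: "simple_graph H" using contract.IH by blast
  then have uv: "u \<in> pverts H" "v \<in> pverts H" "u \<noteq> v" "adj H v u"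
    using contract.hyps by (auto simp: simple_graph_def)
  interpret ugraph "adj G" by (rule ugraph_adj[OF G])
  note M = minor_modelD[OF X]
  let ?f = "\<lambda>x. if x = v then u else x" and ?H = "contract_edge u v H"
  let ?X = "\<lambda>h. if h = u then X u \<union> X v else X h"
  have verts: "pverts ?H = pverts H - {v}" using uv by (auto simp: contract_edge_def)
  have arcs: "adj ?H a b \<longleftrightarrow> (\<exists>x y. adj H x y \<and> ?f x = a \<and> ?f y = b \<and> a \<noteq> b)" for a b
    by (auto simp: contract_edge_def)
  have "simple_graph ?H"
    unfolding simple_graph_def
  proof (intro allI impI)
    fix a b assume "adj ?H a b"
    then obtain x y where "adj H x y" "?f x = a" "?f y = b" "a \<noteq> b" unfolding arcs by blast
    moreover from this have "adj H y x" "x \<in> pverts H" "y \<in> pverts H" using H by (auto simp: simple_graph_def)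
    ultimately show "a \<in> pverts ?H \<and> b \<in> pverts ?H \<and> a \<noteq> b \<and> adj ?H b a"
      unfolding arcs verts using uv by (auto split: if_splits)
  qed
  moreover have "minor_model (adj G) (pverts G) (adj ?H) (pverts ?H) ?X"
  proof (rule minor_modelI)
    have "touch (adj G) (X u) (X v)" using M(5)[of u v] uv contract.hyps by simp
    then have "conn (adj G) (X u \<union> X v)" using conn_union M(2)[OF uv(1)] M(2)[OF uv(2)] by simp
    then show "?X h \<noteq> {} \<and> conn (adj G) (?X h) \<and> ?X h \<subseteq> pverts G" if "h \<in> pverts ?H" for h
      using M(1-3)[of h] M(3)[OF uv(2)] that verts by auto
  next
    fix h h' assume h: "h \<in> pverts ?H" "h' \<in> pverts ?H" "h \<noteq> h'"
    then have hh: "h \<in> pverts H" "h' \<in> pverts H" "h \<noteq> v" "h' \<noteq> v" using verts by auto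
    have "?X h \<inter> ?X h' = {}"
      using M(4)[OF hh(1,2) h(3)] M(4)[OF uv(2) hh(1) hh(3)[symmetric]]
        M(4)[OF uv(2) hh(2) hh(4)[symmetric]] h(3) by (cases "h = u"; cases "h' = u") auto
    moreover have "adj ?H h h' \<longleftrightarrow> adj H h h' \<or> (h = u \<and> adj H v h') \<or> (h' = u \<and> adj H h v)"
    proof
      assume "adj ?H h h'"
      then show "adj H h h' \<or> (h = u \<and> adj H v h') \<or> (h' = u \<and> adj H h v)"
      proof -
        obtain x y where xy: "adj H x y" "?f x = h" "?f y = h'" using \<open>adj ?H h h'\<close> unfolding arcs by blast
        have "x = h \<or> (h = u \<and> x = v)" "y = h' \<or> (h' = u \<and> y = v)" using xy(2,3) by (auto split: if_splits)
        then show ?thesis using xy(1) h(3) by blast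
      qed
    next
      assume "adj H h h' \<or> (h = u \<and> adj H v h') \<or> (h' = u \<and> adj H h v)"
      then consider "adj H h h'" | "h = u" "adj H v h'" | "h' = u" "adj H h v" by blast
      then show "adj ?H h h'"
      proof cases
        case 1 then show ?thesis unfolding arcs using hh h(3) by (intro exI[of _ h] exI[of _ h']) auto
      next
        case 2 then show ?thesis unfolding arcs using hh h(3) by (intro exI[of _ v] exI[of _ h']) auto
      next
        case 3 then show ?thesis unfolding arcs using hh h(3) by (intro exI[of _ h] exI[of _ v]) auto
      qed
    qed
    moreover have "touch (adj G) (?X h) (?X h') \<longleftrightarrow>
        touch (adj G) (X h) (X h') \<or> (h = u \<and> touch (adj G) (X v) (X h')) \<or> (h' = u \<and> touch (adj G) (X h) (X v))"
      using h(3) by (auto simp: touch_def)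
    ultimately show "?X h \<inter> ?X h' = {} \<and> (adj ?H h h' \<longleftrightarrow> touch (adj G) (?X h) (?X h'))"
      using M(5)[OF hh(1,2) h(3)] M(5)[OF uv(2) hh(2)] M(5)[OF hh(1) uv(2)] hh(3,4) by auto
  qed
  ultimately show ?case by blast
qed

lemma model_of_induced_minor:
  assumes "induced_minor W G" "simple_graph G"
  obtains X where "minor_model (adj G) (pverts G) (adj W) (pverts W) X"
proof -
  obtain G' where G': "reduces_to G G'" "digraph_iso (with_proj W) (with_proj G')"
    using assms(1) unfolding induced_minor_def by blast
  obtain X where X: "minor_model (adj G) (pverts G) (adj G') (pverts G') X"
    using model_of_reduction[OF G'(1) assms(2)] by blast
  obtain h where h: "pre_digraph.digraph_isomorphism (with_proj W) h" "with_proj G' = app_iso h (with_proj W)"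
    using G'(2) unfolding digraph_iso_def by blast
  let ?f = "iso_verts h"
  have inj: "inj_on ?f (pverts W)"
    using h(1) by (simp add: pre_digraph.digraph_isomorphism_def)
  have wf: "wf_digraph (with_proj W)" using h(1) by (simp add: pre_digraph.digraph_isomorphism_def)
  have fst: "fst = iso_tail h" and snd: "snd = iso_head h"
    using arg_cong[OF h(2), of tail] arg_cong[OF h(2), of head] by simp_all
  have "iso_arcs h (a, b) = (?f a, ?f b)" if "adj W a b" for a b
    using h(1) that unfolding pre_digraph.digraph_isomorphism_def
    by (auto simp: fst[symmetric] snd[symmetric] prod_eq_iff)
  then have "iso_arcs h ` parcs W = (\<lambda>(a, b). (?f a, ?f b)) ` parcs W"
    by (intro image_cong) auto
  then have arcs: "parcs G' = (\<lambda>(a, b). (?f a, ?f b)) ` parcs W"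
    using arg_cong[OF h(2), of arcs] by simp
  have verts: "pverts G' = ?f ` pverts W"
    using arg_cong[OF h(2), of verts] by simp
  have wf': "a \<in> pverts W \<and> b \<in> pverts W" if "adj W a b" for a b
    using wf_digraph.head_in_verts[OF wf, of "(a, b)"] wf_digraph.tail_in_verts[OF wf, of "(a, b)"] that by simp
  have adj: "adj W a b \<longleftrightarrow> adj G' (?f a) (?f b)" if "a \<in> pverts W" "b \<in> pverts W" for a b
  proof
    assume "adj G' (?f a) (?f b)"
    then obtain c d where "adj W c d" "?f a = ?f c" "?f b = ?f d" unfolding arcs by auto
    moreover from this have "a = c" "b = d" using inj wf' that by (auto dest: inj_onD)
    ultimately show "adj W a b" by simp
  qed (auto simp: arcs)
  have "minor_model (adj G) (pverts G) (adj W) (pverts W) (X \<circ> ?f)"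
  proof (rule minor_modelI)
    fix a assume "a \<in> pverts W"
    then show "(X \<circ> ?f) a \<noteq> {} \<and> conn (adj G) ((X \<circ> ?f) a) \<and> (X \<circ> ?f) a \<subseteq> pverts G"
      using minor_modelD(1-3)[OF X, of "?f a"] verts by simp
  next
    fix a b assume ab: "a \<in> pverts W" "b \<in> pverts W" "a \<noteq> b"
    then have "?f a \<noteq> ?f b" using inj by (auto dest: inj_onD)
    then show "(X \<circ> ?f) a \<inter> (X \<circ> ?f) b = {} \<and> (adj W a b \<longleftrightarrow> touch (adj G) ((X \<circ> ?f) a) ((X \<circ> ?f) b))"
      using minor_modelD(4,5)[OF X, of "?f a" "?f b"] verts ab adj by simp
  qed
  then show ?thesis using that by blast
qed

lemma minor_model_restrict:
  assumes X: "minor_model E V F W X" and sub: "W' \<subseteq> W"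
  shows "minor_model E V F W' X"
proof (rule minor_modelI)
  show "X h \<noteq> {} \<and> conn E (X h) \<and> X h \<subseteq> V" if "h \<in> W'" for h
    using minor_modelD(1-3)[OF X subsetD[OF sub that]] by simp
  show "X h \<inter> X h' = {} \<and> (F h h' \<longleftrightarrow> touch E (X h) (X h'))" if "h \<in> W'" "h' \<in> W'" "h \<noteq> h'" for h h'
    using minor_modelD(4,5)[OF X subsetD[OF sub that(1)] subsetD[OF sub that(2)] that(3)] by simp
qed

section \<open>Excluding walls and complete bipartite graphs\<close>

context dyadic_graph begin

lemma star_neighbours:
  assumes X: "minor_model E V F W X" and h: "h \<in> W" "h' \<in> W" "h \<noteq> h'"
    and v: "v \<in> X h" "cen (row v) (pos v)" and meet: "X h' \<inter> star (pos v) \<noteq> {}"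
  shows "F h h'"
proof -
  note M = minor_modelD[OF X]
  obtain w where w: "w \<in> X h'" "w \<in> star (pos v)" using meet by blast
  have vV: "v \<in> V" using M(3)[OF h(1)] v(1) by blast
  have wV: "w \<in> V" "pos w = pos v" "row v \<le> row w" using w(2) by (auto simp: star_cen[OF v(2)])
  moreover have "w \<noteq> v" using M(4)[OF h] v(1) w(1) by blast
  ultimately have "E v w" using vV v(2) by (auto simp: E_iff prod_eq_iff)
  then show ?thesis using M(5)[OF h] v(1) w(1) unfolding touch_def by blast
qed

lemma bipartite_star_bound:
  fixes a b :: "nat \<Rightarrow> 'b"
  assumes X: "minor_model E V F W X" and n: "4 \<le> n"
    and nodes: "\<And>i. i < n \<Longrightarrow> a i \<in> W \<and> b i \<in> W" "inj_on a {..<n}" "inj_on b {..<n}"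
    and edges: "\<And>i j. i < n \<Longrightarrow> j < n \<Longrightarrow> a i \<noteq> b j \<and> F (a i) (b j) \<and> \<not> F (a i) (a j) \<and> \<not> F (b i) (b j)"
    and v: "i0 < n" "v \<in> X (a i0)" "cen (row v) (pos v)"
  shows "card {j\<in>{..<n}. X (b j) \<inter> star (pos v) \<noteq> {}} \<le> 9"
proof (rule ccontr)
  let ?J = "{j\<in>{..<n}. X (b j) \<inter> star (pos v) \<noteq> {}}"
  note M = minor_modelD[OF X]
  assume "\<not> card ?J \<le> 9"
  then have "10 \<le> card ?J" by simp
  then obtain J where J: "J \<subseteq> ?J" "card J = 10" by (rule obtain_subset_with_card_n)
  then have "finite J" using card.infinite by force
  then obtain f :: "nat \<Rightarrow> nat" where f: "bij_betw f {0..<10} J" using ex_bij_betw_nat_finite[of J] J(2) by auto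
  have fJ: "f j < n" "X (b (f j)) \<inter> star (pos v) \<noteq> {}" if "j < 10" for j
  proof -
    have "f j \<in> J" using f that by (auto simp: bij_betw_def)
    then show "f j < n" "X (b (f j)) \<inter> star (pos v) \<noteq> {}" using J(1) by auto
  qed
  have f_inj: "f i \<noteq> f j" if "i < 10" "j < 10" "i \<noteq> j" for i j
    using f that by (auto simp: bij_betw_def inj_on_def)
  define c where "c i = (if i < i0 then i else Suc i)" for i
  have c: "c i < n" "c i \<noteq> i0" if "i < 3" for i using that n by (auto simp: c_def)
  have c_inj: "c i \<noteq> c j" if "i \<noteq> j" for i j using that by (auto simp: c_def)
  show False
  proof (rule star_bound[OF v(3), of "\<lambda>j. X (b (f j))" "\<lambda>i. X (a (c i))"])
    fix j :: nat assume j: "j < 10"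
    show "conn E (X (b (f j)))" "X (b (f j)) \<subseteq> V" using M(2,3) nodes(1) fJ(1)[OF j] by blast+
    show "X (b (f j)) \<inter> star (pos v) \<noteq> {}" using fJ(2)[OF j] .
    fix w assume w: "w \<in> X (b (f j))"
    show "\<not> (row w = row v \<and> pos w = pos v)"
    proof
      assume "row w = row v \<and> pos w = pos v"
      then have "w = v" by (simp add: prod_eq_iff)
      then show False using M(4)[of "b (f j)" "a i0"] w v nodes(1) edges[OF v(1) fJ(1)[OF j]] fJ(1)[OF j] by fastforce
    qed
  next
    fix i j :: nat assume ij: "i < 10" "j < 10" "i \<noteq> j"
    have "b (f i) \<noteq> b (f j)" using nodes(3) fJ(1)[OF ij(1)] fJ(1)[OF ij(2)] f_inj[OF ij] by (auto simp: inj_on_def)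
    then show "\<not> touch E (X (b (f i))) (X (b (f j)))"
      using M(5) nodes(1) edges fJ(1)[OF ij(1)] fJ(1)[OF ij(2)] by blast
  next
    fix i :: nat assume i: "i < 3"
    show "conn E (X (a (c i)))" "X (a (c i)) \<subseteq> V" using M(2,3) nodes(1) c(1)[OF i] by blast+
    have ne: "a i0 \<noteq> a (c i)" using nodes(2) v(1) c[OF i] by (auto simp: inj_on_def)
    show "X (a (c i)) \<inter> star (pos v) = {}"
      using star_neighbours[OF X _ _ ne v(2,3)] nodes(1) edges v(1) c(1)[OF i] by blast
  next
    fix i j :: nat assume ij: "i < 3" "j < 3" "i \<noteq> j"
    have "a (c i) \<noteq> a (c j)" using nodes(2) c(1)[OF ij(1)] c(1)[OF ij(2)] c_inj[OF ij(3)] by (auto simp: inj_on_def)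
    then show "\<not> touch E (X (a (c i))) (X (a (c j)))"
      using M(5) nodes(1) edges c(1)[OF ij(1)] c(1)[OF ij(2)] by blast
  next
    fix i j :: nat assume ij: "i < 3" "j < 10"
    show "touch E (X (a (c i))) (X (b (f j)))"
      using M(5)[of "a (c i)" "b (f j)"] nodes(1) edges[OF c(1)[OF ij(1)] fJ(1)[OF ij(2)]]
        c(1)[OF ij(1)] fJ(1)[OF ij(2)] by blast
  qed
qed

end

lemma adj_complete_bipartite:
  "adj (complete_bipartite n n) h h' \<longleftrightarrow>
    h \<in> {..<n} <+> {..<n} \<and> h' \<in> {..<n} <+> {..<n} \<and> isl h \<noteq> isl h'"
  by (auto simp: complete_bipartite_def undirected_def)

text \<open>The dense family consists of the stars whose leaves form one of the triples of consecutive
  vertices that partition the other side.\<close>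

lemma (in dyadic_graph) no_complete_bipartite_minor:
  assumes X: "minor_model E V (adj (complete_bipartite 100 100)) (pverts (complete_bipartite 100 100)) X"
  shows False
proof -
  let ?K = "complete_bipartite 100 100" and ?W = "{..<100} <+> {..<100} :: (nat + nat) set"
  have W: "pverts ?K = ?W" by (simp add: complete_bipartite_def undirected_def)
  note X = X[unfolded W]
  let ?S = "\<lambda>i b. {Inl i, Inr (3 * b), Inr (3 * b + 1), Inr (3 * b + 2)} :: (nat + nat) set"
  let ?\<F> = "{?S i b | i b. i < 100 \<and> b < 33}"
  interpret K: ugraph "adj ?K" by unfold_locales (auto simp: adj_complete_bipartite)
  show False
  proof (rule no_dense_minor[OF X, of ?\<F> 10])
    fix S assume "S \<in> ?\<F>"
    then obtain i b where S: "S = ?S i b" "i < 100" "b < 33" by blast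
    have e: "adj ?K (Inl i) (Inr (3 * b + n))" if "n < 3" for n
      using S(2,3) that by (auto simp: adj_complete_bipartite)
    have "conn (adj ?K) (insert (Inr (3 * b + 0)) (insert (Inr (3 * b + 1)) (insert (Inr (3 * b + 2)) {Inl i})))"
      by (intro K.conn_insert[where a = "Inl i"] conn_single e) simp_all
    then have "conn (adj ?K) (insert (Inr (3 * b)) (insert (Inr (3 * b + 1)) (insert (Inr (3 * b + 2)) {Inl i})))"
      by simp
    moreover have "S = insert (Inr (3 * b)) (insert (Inr (3 * b + 1)) (insert (Inr (3 * b + 2)) {Inl i}))"
      using S(1) by auto
    ultimately show "S \<subseteq> ?W \<and> conn (adj ?K) S" using S by auto
    show "\<exists>h\<in>S. \<exists>l. (\<forall>n<3. l n \<in> S \<and> l n \<noteq> h \<and> adj ?K h (l n)) \<and> (\<forall>i<3. \<forall>j<3. i \<noteq> j \<longrightarrow> l i \<noteq> l (j::nat))"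
    proof (intro bexI[of _ "Inl i"] exI[of _ "\<lambda>n. Inr (3 * b + n)"] conjI allI impI)
      fix n :: nat assume "n < 3"
      then have "n = 0 \<or> n = 1 \<or> n = 2" by auto
      then show "Inr (3 * b + n) \<in> S" using S(1) by auto
      show "adj ?K (Inl i) (Inr (3 * b + n))" using S(2,3) \<open>n < 3\<close> by (auto simp: adj_complete_bipartite)
    qed (use S in auto)
  next
    fix S S' assume "S \<in> ?\<F>" "S' \<in> ?\<F>"
    then obtain i b i' b' where S: "S = ?S i b" "i < 100" "b < 33" "S' = ?S i' b'" "i' < 100" "b' < 33" by blast
    have "adj ?K (Inl i) (Inr (3 * b'))" using S by (auto simp: adj_complete_bipartite)
    then show "touch (adj ?K) S S'" unfolding touch_def S(1,4) by blast
  next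
    fix h v m y assume h: "h \<in> ?W" "v \<in> X h" "cen m y" "row v = m" "pos v = y"
    let ?Z = "{h\<in>?W. X h \<inter> star y \<noteq> {}}"
    have c: "cen (row v) (pos v)" using h by simp
    have bound: "card ?Z \<le> 10"
      if h: "h = a i" "i < 100" and ab: "(a = Inl \<and> b = Inr) \<or> (a = Inr \<and> b = Inl)"
      for a b :: "nat \<Rightarrow> nat + nat" and i
    proof -
      have few: "card {j\<in>{..<100}. X (b j) \<inter> star (pos v) \<noteq> {}} \<le> 9"
        by (rule bipartite_star_bound[OF X, of 100 a b i v])
          (use ab h \<open>v \<in> X h\<close> c in \<open>auto simp: adj_complete_bipartite inj_on_def\<close>)
      have "?Z \<subseteq> insert h (b ` {j\<in>{..<100}. X (b j) \<inter> star (pos v) \<noteq> {}})"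
      proof
        fix h' assume h': "h' \<in> ?Z"
        show "h' \<in> insert h (b ` {j\<in>{..<100}. X (b j) \<inter> star (pos v) \<noteq> {}})"
        proof (cases "h' = h")
          case False
          then have "adj ?K h h'"
            using star_neighbours[OF X \<open>h \<in> ?W\<close> _ _ \<open>v \<in> X h\<close> c, of h'] h' \<open>pos v = y\<close> by auto
          then show ?thesis using h' h(1) ab \<open>pos v = y\<close> by (auto simp: adj_complete_bipartite)
        qed simp
      qed
      then have "card ?Z \<le> card (insert h (b ` {j\<in>{..<100}. X (b j) \<inter> star (pos v) \<noteq> {}}))"
        by (rule card_mono[rotated]) simp
      also have "\<dots> \<le> Suc (card (b ` {j\<in>{..<100}. X (b j) \<inter> star (pos v) \<noteq> {}}))"
        by (rule card_insert_le_m1) auto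
      also have "\<dots> \<le> Suc (card {j\<in>{..<100}. X (b j) \<inter> star (pos v) \<noteq> {}})"
        using card_image_le[of "{j\<in>{..<100}. X (b j) \<inter> star (pos v) \<noteq> {}}" b] by simp
      finally show ?thesis using few by simp
    qed
    show "card ?Z \<le> 10" using h(1) bound[of Inl _ Inr] bound[of Inr _ Inl] by blast
  next
    fix Z :: "(nat + nat) set" assume Z: "Z \<subseteq> ?W" "card Z \<le> 3 * 10"
    have fin: "finite Z" using Z(1) by (rule finite_subset) simp
    have "\<exists>i\<in>{..<100}. Inl i \<notin> Z"
    proof (rule ccontr)
      assume "\<not> ?thesis"
      then have "Inl ` {..<100} \<subseteq> Z" by blast
      then have "card (Inl ` {..<100::nat} :: (nat + nat) set) \<le> card Z" using fin card_mono by blast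
      then show False using Z(2) by (simp add: card_image)
    qed
    then obtain i where i: "i < 100" "Inl i \<notin> Z" by blast
    let ?g = "\<lambda>h. case h of Inl i \<Rightarrow> i | Inr j \<Rightarrow> j div 3"
    have "\<not> {..<33} \<subseteq> ?g ` Z"
    proof
      assume "{..<33} \<subseteq> ?g ` Z"
      then have "card {..<33::nat} \<le> card (?g ` Z)" using fin by (intro card_mono) auto
      then show False using card_image_le[OF fin, of ?g] Z(2) by simp
    qed
    then obtain b where b: "b < 33" "b \<notin> ?g ` Z" by blast
    have "?S i b \<inter> Z = {}"
    proof -
      have "Inr (3 * b + n) \<notin> Z" if "n < 3" for n
      proof
        assume "Inr (3 * b + n) \<in> Z"
        then have "?g (Inr (3 * b + n)) \<in> ?g ` Z" by (rule imageI)
        then show False using b(2) that by simp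
      qed
      from this[of 0] this[of 1] this[of 2] show ?thesis using i(2) by simp
    qed
    then show "\<exists>S\<in>?\<F>. S \<inter> Z = {}" using i(1) b(1) by blast
  qed
qed

text \<open>The part of the wall between its first and its last row.\<close>

definition brick_rows :: "nat \<Rightarrow> (nat \<times> nat) set" where
  "brick_rows t = {2..t - 1} \<times> {0..2 * t - 1}"

lemma brick_rows_subset: "brick_rows t \<subseteq> pverts (wall t)"
  by (auto simp: brick_rows_def wall_def undirected_def wall_cols_def)

lemma adj_wall:
  assumes "(i, j) \<in> brick_rows t" "(i', j') \<in> brick_rows t"
  shows "adj (wall t) (i, j) (i', j') \<longleftrightarrow>
    (i = i' \<and> (j' = j + 1 \<or> j = j' + 1)) \<or>
    (i' = i + 1 \<and> j = j' \<and> j mod 2 = (i - 1) mod 2) \<or>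
    (i = i' + 1 \<and> j = j' \<and> j mod 2 = (i' - 1) mod 2)"
proof -
  have cols: "wall_cols t i = {0..2 * t - 1}" "wall_cols t i' = {0..2 * t - 1}"
    using assms by (auto simp: wall_cols_def brick_rows_def)
  have V: "(i, j) \<in> pverts (wall t)" "(i', j') \<in> pverts (wall t)" using assms brick_rows_subset by blast+
  have next_col: "x < y \<and> (\<forall>c\<in>{0..2 * t - 1}. \<not> (x < c \<and> c < y)) \<longleftrightarrow> y = x + 1" if "y \<le> 2 * t - 1" for x y :: nat
  proof
    assume a: "x < y \<and> (\<forall>c\<in>{0..2 * t - 1}. \<not> (x < c \<and> c < y))"
    then have "\<not> x + 1 < y" using that by auto
    then show "y = x + 1" using a by simp
  qed auto
  have bounds: "j \<le> 2 * t - 1" "j' \<le> 2 * t - 1" using assms by (auto simp: brick_rows_def)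
  have "adj (wall t) (i, j) (i', j') \<longleftrightarrow>
    (i = i' \<and> (j < j' \<and> (\<forall>c\<in>wall_cols t i. \<not> (j < c \<and> c < j'))) \<or> i' = i + 1 \<and> j = j' \<and> j mod 2 = (i - 1) mod 2) \<or>
    (i' = i \<and> (j' < j \<and> (\<forall>c\<in>wall_cols t i'. \<not> (j' < c \<and> c < j))) \<or> i = i' + 1 \<and> j' = j \<and> j' mod 2 = (i' - 1) mod 2)"
    using V unfolding wall_def undirected_def by auto
  then show ?thesis unfolding cols next_col[OF bounds(1)] next_col[OF bounds(2)] by auto
qed

lemma simple_graph_wall: "simple_graph (wall t)"
  using simple_graph_pair_graph[OF pair_graph_wall] .

text \<open>The dense family of the wall consists of crosses: a row together with the zigzag path through
  two consecutive columns.\<close>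

definition cross :: "nat \<Rightarrow> nat \<Rightarrow> nat \<Rightarrow> (nat \<times> nat) set" where
  "cross t i j = {i} \<times> {0..2 * t - 1} \<union> {2..t - 1} \<times> {2 * j, 2 * j + 1}"

lemma conn_cross:
  assumes i: "2 \<le> i" "i \<le> t - 1" and j: "j < t"
  shows "conn (adj (wall t)) (cross t i j)"
proof -
  interpret ugraph "adj (wall t)" by (rule ugraph_adj[OF simple_graph_wall])
  let ?A = "adj (wall t)"
  have "conn ?A (\<Union>c\<le>2 * t - 1. {(i, c)})"
  proof (rule conn_chain)
    fix c assume "c < 2 * t - 1"
    then have "?A (i, c) (i, Suc c)" using i by (subst adj_wall) (auto simp: brick_rows_def)
    then show "touch ?A {(i, c)} {(i, Suc c)}" by (simp add: touch_def)
  qed (rule conn_single)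
  also have "(\<Union>c\<le>2 * t - 1. {(i, c)}) = {i} \<times> {0..2 * t - 1}" by auto
  finally have row: "conn ?A ({i} \<times> {0..2 * t - 1})" .
  have "conn ?A (\<Union>n\<le>t - 3. {(n + 2, 2 * j), (n + 2, 2 * j + 1)})"
  proof (rule conn_chain)
    fix n assume n: "n \<le> t - 3"
    have "?A (n + 2, 2 * j + 1) (n + 2, 2 * j)" using n i j by (subst adj_wall) (auto simp: brick_rows_def)
    then show "conn ?A {(n + 2, 2 * j), (n + 2, 2 * j + 1)}"
      using conn_insert[OF conn_single] by blast
  next
    fix n assume n: "n < t - 3"
    define c where "c = (if even n then 2 * j + 1 else 2 * j)"
    have "c mod 2 = (n + 1) mod 2" unfolding c_def by (cases "even n") (auto simp: mod2_eq_if)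
    then have "?A (n + 2, c) (Suc n + 2, c)" using n i j by (subst adj_wall) (auto simp: brick_rows_def c_def)
    then show "touch ?A {(n + 2, 2 * j), (n + 2, 2 * j + 1)} {(Suc n + 2, 2 * j), (Suc n + 2, 2 * j + 1)}"
      unfolding touch_def c_def by (auto split: if_splits)
  qed
  also have "(\<Union>n\<le>t - 3. {(n + 2, 2 * j), (n + 2, 2 * j + 1)}) = {2..t - 1} \<times> {2 * j, 2 * j + 1}"
  proof (intro equalityI subsetI)
    fix v assume "v \<in> {2..t - 1} \<times> {2 * j, 2 * j + 1}"
    then have "fst v - 2 \<le> t - 3" "fst v - 2 + 2 = fst v" "snd v = 2 * j \<or> snd v = 2 * j + 1" by auto
    then have "fst v - 2 \<in> {..t - 3}" "v \<in> {(fst v - 2 + 2, 2 * j), (fst v - 2 + 2, 2 * j + 1)}"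
      by (auto simp: prod_eq_iff)
    then show "v \<in> (\<Union>n\<le>t - 3. {(n + 2, 2 * j), (n + 2, 2 * j + 1)})" by blast
  qed (use i in auto)
  finally have col: "conn ?A ({2..t - 1} \<times> {2 * j, 2 * j + 1})" .
  have "(i, 2 * j) \<in> {i} \<times> {0..2 * t - 1} \<inter> ({2..t - 1} \<times> {2 * j, 2 * j + 1})" using i j by auto
  then have "touch ?A ({i} \<times> {0..2 * t - 1}) ({2..t - 1} \<times> {2 * j, 2 * j + 1})"
    unfolding touch_def by blast
  then show ?thesis unfolding cross_def using conn_union row col by blast
qed

lemma (in dyadic_graph) no_wall_minor:
  assumes X: "minor_model E V (adj (wall t)) (pverts (wall t)) X" and t: "30 \<le> t"
  shows False
proof -
  let ?A = "adj (wall t)" and ?\<F> = "{cross t i j | i j. 2 \<le> i \<and> i \<le> t - 2 \<and> 1 \<le> j \<and> j \<le> t - 2}"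
  note X' = minor_model_restrict[OF X brick_rows_subset]
  have fin: "finite (brick_rows t)" by (simp add: brick_rows_def)
  show False
  proof (rule no_dense_minor[OF X', of ?\<F> 5])
    fix S assume "S \<in> ?\<F>"
    then obtain i j where S: "S = cross t i j" and i: "2 \<le> i" "i \<le> t - 2" and j: "1 \<le> j" "j \<le> t - 2" by blast
    show "S \<subseteq> brick_rows t \<and> conn ?A S"
      using conn_cross[of i t j] i j t by (auto simp: S cross_def brick_rows_def)
    define c where "c = (if even i then 2 * j + 1 else 2 * j)"
    have c: "c mod 2 = (i - 1) mod 2"
      unfolding c_def using i by (cases i) (auto simp: mod2_eq_if)
    have cb: "2 \<le> c" "c + 1 \<le> 2 * t - 1" "c = 2 * j \<or> c = 2 * j + 1" using j t by (auto simp: c_def)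
    define l where "l n = (if n = 0 then (i, c - 1) else if n = 1 then (i, c + 1) else (i + 1, c))" for n :: nat
    have "(i, c) \<in> brick_rows t" "(i, c - 1) \<in> brick_rows t" "(i, c + 1) \<in> brick_rows t" "(i + 1, c) \<in> brick_rows t"
      using i t cb by (auto simp: brick_rows_def)
    then have "?A (i, c) (i, c - 1)" "?A (i, c) (i, c + 1)" "?A (i, c) (i + 1, c)"
      using c cb(1) by (simp_all add: adj_wall)
    moreover have "(i, c - 1) \<in> S" "(i, c + 1) \<in> S" "(i + 1, c) \<in> S"
      using i t cb by (auto simp: S cross_def)
    ultimately have l: "l n \<in> S \<and> l n \<noteq> (i, c) \<and> ?A (i, c) (l n)" if "n < 3" for n
      using cb(1) by (auto simp: l_def)
    moreover have "l n \<noteq> l n'" if "n < 3" "n' < 3" "n \<noteq> n'" for n n'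
      using that cb by (auto simp: l_def)
    moreover have "(i, c) \<in> S" using cb by (auto simp: S cross_def)
    ultimately show "\<exists>h\<in>S. \<exists>l. (\<forall>n<3. l n \<in> S \<and> l n \<noteq> h \<and> ?A h (l n)) \<and> (\<forall>i<3. \<forall>j<3. i \<noteq> j \<longrightarrow> l i \<noteq> l (j::nat))"
      by blast
  next
    fix S S' assume "S \<in> ?\<F>" "S' \<in> ?\<F>"
    then obtain i j i' j' where S: "S = cross t i j" "S' = cross t i' j'" "2 \<le> i" "i \<le> t - 2" "j' \<le> t - 2" by blast
    then have "(i, 2 * j') \<in> S \<inter> S'" using t by (auto simp: cross_def)
    then show "touch ?A S S'" unfolding touch_def by blast
  next
    fix h v m y assume h: "h \<in> brick_rows t" "v \<in> X h" "cen m y" "row v = m" "pos v = y"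
    obtain i j where ij: "h = (i, j)" by (cases h)
    have "{h\<in>brick_rows t. X h \<inter> star y \<noteq> {}} \<subseteq> set [(i, j), (i, j + 1), (i, j - 1), (i + 1, j), (i - 1, j)]"
    proof
      fix h' assume h': "h' \<in> {h\<in>brick_rows t. X h \<inter> star y \<noteq> {}}"
      obtain i' j' where ij': "h' = (i', j')" by (cases h')
      show "h' \<in> set [(i, j), (i, j + 1), (i, j - 1), (i + 1, j), (i - 1, j)]"
      proof (cases "h' = h")
        case False
        then have "?A h h'" using star_neighbours[OF X' h(1) _ _ h(2), of h'] h h' by auto
        then show ?thesis using adj_wall[of i j t i' j'] h(1) h' ij ij' by auto
      qed (simp add: ij)
    qed
    then have "card {h\<in>brick_rows t. X h \<inter> star y \<noteq> {}} \<le> card (set [(i, j), (i, j + 1), (i, j - 1), (i + 1, j), (i - 1, j)])"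
      by (rule card_mono[rotated]) simp
    also have "\<dots> \<le> 5" using card_length[of "[(i, j), (i, j + 1), (i, j - 1), (i + 1, j), (i - 1, j)]"] by simp
    finally show "card {h\<in>brick_rows t. X h \<inter> star y \<noteq> {}} \<le> 5" .
  next
    fix Z :: "(nat \<times> nat) set" assume Z: "Z \<subseteq> brick_rows t" "card Z \<le> 3 * 5"
    have finZ: "finite Z" using Z(1) fin by (rule finite_subset)
    have avoid: "\<exists>x\<in>I. x \<notin> f ` Z" if "finite I" "15 < card I" for I :: "nat set" and f :: "nat \<times> nat \<Rightarrow> nat"
    proof (rule ccontr)
      assume "\<not> ?thesis"
      then have "I \<subseteq> f ` Z" by blast
      then have "card I \<le> card (f ` Z)" using finZ by (intro card_mono) auto
      then show False using card_image_le[OF finZ, of f] Z(2) that(2) by simp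
    qed
    have "15 < card {2..t - 2}" "15 < card {1..t - 2}" using t by auto
    then obtain i j where i: "i \<in> {2..t - 2}" "i \<notin> fst ` Z"
      and j: "j \<in> {1..t - 2}" "j \<notin> (\<lambda>z. snd z div 2) ` Z"
      using avoid[of "{2..t - 2}" fst] avoid[of "{1..t - 2}" "\<lambda>z. snd z div 2"] by blast
    have "cross t i j \<inter> Z = {}"
    proof (rule ccontr)
      assume "cross t i j \<inter> Z \<noteq> {}"
      then obtain z where z: "z \<in> cross t i j" "z \<in> Z" by blast
      then have "fst z = i \<or> snd z div 2 = j" by (auto simp: cross_def)
      then show False using z(2) i(2) j(2) by blast
    qed
    then show "\<exists>S\<in>?\<F>. S \<inter> Z = {}" using i(1) j(1) by fastforce
  qed
qed

section \<open>Induced claws and thetas\<close>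

text \<open>Lists of vertices that form induced paths.\<close>

fun ipath :: "('a \<Rightarrow> 'a \<Rightarrow> bool) \<Rightarrow> 'a list \<Rightarrow> bool" where
  "ipath E [] \<longleftrightarrow> True"
| "ipath E (x # p) \<longleftrightarrow> x \<notin> set p \<and> (\<forall>y\<in>set p. E x y \<longleftrightarrow> y = hd p) \<and> ipath E p"

lemma ipath_distinct: "ipath E p \<Longrightarrow> distinct p"
  by (induction p) auto

lemma ipath_append:
  assumes "ipath E p" "ipath E q" "set p \<inter> set q = {}" "p \<noteq> []" "q \<noteq> []" "E (last p) (hd q)"
    and "\<And>x y. x \<in> set p \<Longrightarrow> y \<in> set q \<Longrightarrow> E x y \<Longrightarrow> x = last p \<and> y = hd q"
  shows "ipath E (p @ q)"
  using assms
proof (induction p)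
  case Nil
  then show ?case by simp
next
  case (Cons x p)
  show ?case
  proof (cases "p = []")
    case True
    then show ?thesis using Cons.prems by auto
  next
    case False
    have IH: "ipath E (p @ q)"
      by (rule Cons.IH) (use Cons.prems False in auto)
    have "E x y \<longleftrightarrow> y = hd p" if "y \<in> set (p @ q)" for y
    proof (cases "y \<in> set p")
      case True
      then show ?thesis using Cons.prems(1) by simp
    next
      case y: False
      then have "y \<in> set q" using that by simp
      moreover have "x \<noteq> last p" using Cons.prems(1) False by auto
      ultimately have "\<not> E x y" using Cons.prems(7)[of x y] False by auto
      moreover have "y \<noteq> hd p" using y False by auto
      ultimately show ?thesis by simp
    qed
    then show ?thesis using Cons.prems IH False by simp
  qed
qed

lemma ipath_appendD: "ipath E (p @ q) \<Longrightarrow> ipath E p \<and> ipath E q"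
proof (induction p)
  case (Cons x p)
  then show ?case by (cases p) auto
qed simp

lemma ipath_cross:
  "ipath E (p @ q) \<Longrightarrow> x \<in> set p \<Longrightarrow> y \<in> set q \<Longrightarrow> E x y \<Longrightarrow> x = last p \<and> y = hd q"
proof (induction p)
  case (Cons z p)
  show ?case
  proof (cases "x = z")
    case True
    then have y: "y = hd (p @ q)" using Cons.prems by auto
    have "p = []"
    proof (rule ccontr)
      assume "p \<noteq> []"
      then have "y \<in> set p" using y by simp
      then show False using ipath_distinct[OF Cons.prems(1)] Cons.prems(3) by auto
    qed
    then show ?thesis using True y by simp
  next
    case False
    then have "x \<in> set p" using Cons.prems by simp
    then show ?thesis using Cons by auto
  qed
qed simp

lemma ipath_join: "ipath E (p @ q) \<Longrightarrow> p \<noteq> [] \<Longrightarrow> q \<noteq> [] \<Longrightarrow> E (last p) (hd q)"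
proof (induction p)
  case (Cons x p)
  then show ?case by (cases p) auto
qed simp

lemma ipath_rev:
  assumes "\<And>x y. E x y \<Longrightarrow> E y x" "ipath E p"
  shows "ipath E (rev p)"
  using assms(2)
proof (induction p)
  case (Cons x p)
  show ?case
  proof (cases "p = []")
    case False
    have "ipath E (rev p @ [x])"
      by (rule ipath_append) (use Cons False assms(1) in \<open>auto simp: last_rev\<close>)
    then show ?thesis by simp
  qed simp
qed simp

lemma ipath_arcs:
  assumes "\<And>x y. E x y \<Longrightarrow> E y x" "\<And>x. \<not> E x x" "ipath E p" "x \<in> set p" "y \<in> set p"
  shows "E x y \<longleftrightarrow> (x, y) \<in> set (vwalk_arcs p) \<or> (y, x) \<in> set (vwalk_arcs p)"
  using assms(3-5)
proof (induction p rule: vwalk_arcs.induct)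
  case (3 u v p)
  have mem: "a \<in> set q \<and> b \<in> set q" if "(a, b) \<in> set (vwalk_arcs q)" for a b :: 'a and q
    using that by (induction q rule: vwalk_arcs.induct) auto
  have u: "u \<notin> set (v # p)" "\<And>y. y \<in> set (v # p) \<Longrightarrow> E u y \<longleftrightarrow> y = v" "ipath E (v # p)"
    using "3.prems"(1) by auto
  have nu: "(a, b) \<notin> set (vwalk_arcs (v # p))" if "a = u \<or> b = u" for a b
    using mem[of a b "v # p"] u(1) that by auto
  consider "x = u" "y = u" | "x = u" "y \<in> set (v # p)" | "y = u" "x \<in> set (v # p)" | "x \<in> set (v # p)" "y \<in> set (v # p)"
    using "3.prems"(2,3) by auto
  then show ?case
  proof cases
    case 1
    then show ?thesis using assms(2) u(1) nu by auto
  next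
    case 2
    then show ?thesis using u(1,2) nu by auto
  next
    case 3
    then show ?thesis using u(1) u(2)[of x] nu assms(1) by auto
  next
    case 4
    then show ?thesis using "3.IH"[OF u(3)] u(1) by auto
  qed
qed (use assms(2) in auto)

context ugraph begin

lemma ipath_to_set:
  assumes K: "conn E K" "s \<in> K" "t \<in> K" "t \<in> T"
  obtains p where "ipath E p" "p \<noteq> []" "hd p = s" "set p \<subseteq> K" "last p \<in> T" "\<And>x. x \<in> set (butlast p) \<Longrightarrow> x \<notin> T"
proof -
  let ?P = "\<lambda>s p. ipath E p \<and> p \<noteq> [] \<and> hd p = s \<and> set p \<subseteq> K \<and> last p \<in> T \<and> (\<forall>x\<in>set (butlast p). x \<notin> T)"
  have "K \<subseteq> {s. \<exists>p. ?P s p}"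
  proof (rule conn_closed[OF K(1,3)])
    show "t \<in> {s. \<exists>p. ?P s p}" using K by (intro CollectI exI[of _ "[t]"]) auto
    fix a b assume ab: "a \<in> K" "a \<in> {s. \<exists>p. ?P s p}" "b \<in> K" "E a b"
    then obtain p where p: "?P a p" by blast
    have Eb: "E b a" using sym ab(4) .
    show "b \<in> {s. \<exists>p. ?P s p}"
    proof (cases "b \<in> T \<or> b \<in> set p")
      case True
      then consider "b \<in> T" | "b \<in> set p" by blast
      then show ?thesis
      proof cases
        case 1
        then show ?thesis using ab(3) by (intro CollectI exI[of _ "[b]"]) auto
      next
        case 2
        then obtain p1 p2 where "p = p1 @ b # p2" by (meson split_list)
        then have "?P b (b # p2)" using p ipath_appendD[of E p1 "b # p2"] by (auto simp: butlast_append)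
        then show ?thesis by blast
      qed
    next
      case False
      have "\<exists>y\<in>set p. E b y" using p Eb by (metis hd_in_set)
      then obtain p1 y p2 where y: "p = p1 @ y # p2" "E b y" "\<forall>z\<in>set p2. \<not> E b z"
        using split_list_last_prop[OF \<open>\<exists>y\<in>set p. E b y\<close>] by blast
      have "ipath E (b # y # p2)"
        using p y False ipath_appendD[of E p1 "y # p2"] by auto
      moreover have "set (b # y # p2) \<subseteq> K" "last (b # y # p2) \<in> T" using p y ab(3) by auto
      moreover have "x \<notin> T" if "x \<in> set (butlast (b # y # p2))" for x
        using that p y(1) False by (auto simp: butlast_append)
      ultimately have "?P b (b # y # p2)" by simp
      then show ?thesis by blast
    qed
  qed
  then show ?thesis using K(2) that by blast
qed

text \<open>A connected set in a triangle-free graph that contains three vertices which have at most one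
  neighbour in it contains an induced subdivided claw with these three vertices as ends. The centre
  of the claw is \<open>w\<close>; the legs \<open>p1\<close>, \<open>p2\<close> and \<open>p3\<close> are given without it. The claw is found on an
  induced path between two of the vertices together with a shortest connection of the third one to
  this path.\<close>

lemma induced_claw:
  assumes irrefl: "\<And>x. \<not> E x x"
    and tf: "\<And>x y z. x \<in> K \<Longrightarrow> y \<in> K \<Longrightarrow> z \<in> K \<Longrightarrow> E x y \<Longrightarrow> E y z \<Longrightarrow> \<not> E x z"
    and K: "conn E K" and t: "t1 \<in> K" "t2 \<in> K" "t3 \<in> K" "t1 \<noteq> t2" "t1 \<noteq> t3" "t2 \<noteq> t3"
    and deg: "\<And>t x y. t \<in> {t1, t2, t3} \<Longrightarrow> x \<in> K \<Longrightarrow> y \<in> K \<Longrightarrow> E t x \<Longrightarrow> E t y \<Longrightarrow> x = y"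
  obtains w p1 p2 p3 where "w \<in> K" "set p1 \<union> set p2 \<union> set p3 \<subseteq> K"
    "p1 \<noteq> []" "p2 \<noteq> []" "p3 \<noteq> []" "hd p1 = t1" "hd p2 = t2" "hd p3 = t3"
    "ipath E (p1 @ [w])" "ipath E (p2 @ [w])" "ipath E (p3 @ [w])"
    "\<not> touch E (set p1) (set p2)" "\<not> touch E (set p1) (set p3)" "\<not> touch E (set p2) (set p3)"
proof -
  obtain P where P: "ipath E P" "P \<noteq> []" "hd P = t1" "set P \<subseteq> K" "last P = t2"
    using ipath_to_set[OF K t(1,2), of "{t2}"] by auto
  have inner: "False" if "P = A @ t # B" "A \<noteq> []" "B \<noteq> []" "t \<in> {t1, t2, t3}" for A t B
  proof -
    have "E (last A) t" using ipath_join[of E A "t # B"] P(1) that by simp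
    moreover have "E t (hd B)" using ipath_join[of E "A @ [t]" B] P(1) that by simp
    moreover have "last A \<in> set A" "hd B \<in> set B" using that by simp_all
    then have "last A \<noteq> hd B" using ipath_distinct[OF P(1)] that(1) by auto
    moreover have "last A \<in> K" "hd B \<in> K" using P(4) that by auto
    ultimately show False using deg[OF that(4)] sym by blast
  qed
  have t3P: "t3 \<notin> set P"
  proof
    assume "t3 \<in> set P"
    then obtain A B where AB: "P = A @ t3 # B" by (meson split_list)
    then have "A \<noteq> []" "B \<noteq> []" using P(3,5) t by (auto simp: hd_append)
    then show False using inner AB by blast
  qed
  let ?T = "{v. v \<in> set P \<or> (\<exists>u\<in>set P. E v u)}"
  have "t1 \<in> ?T" using P(2,3) by auto
  then obtain Q where Q: "ipath E Q" "Q \<noteq> []" "hd Q = t3" "set Q \<subseteq> K" "last Q \<in> ?T"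
    "\<And>x. x \<in> set (butlast Q) \<Longrightarrow> x \<notin> ?T"
    by (rule ipath_to_set[OF K t(3) t(1)]) (rule that)
  define q where "q = last Q"
  have Qq: "Q = butlast Q @ [q]" using Q(2) by (simp add: q_def)
  have qP: "q \<notin> set P"
  proof
    assume q: "q \<in> set P"
    have ne: "butlast Q \<noteq> []"
    proof
      assume "butlast Q = []"
      then have "Q = [q]" using Qq by simp
      then have "hd Q = q" by (metis list.sel(1))
      then show False using Q(3) q t3P by simp
    qed
    then have "E (last (butlast Q)) q" using ipath_join[of E "butlast Q" "[q]"] Q(1) Qq by simp
    then have "last (butlast Q) \<in> ?T" using q by blast
    then show False using Q(6) ne last_in_set by blast
  qed
  have QP: "\<not> touch E (set (butlast Q)) (set P)" using Q(6) unfolding touch_def by blast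
  have "set (butlast Q @ [q]) = insert q (set (butlast Q))" by simp
  then have setQ: "set Q = insert q (set (butlast Q))" by (subst Qq)
  have disjQ: "set Q \<inter> set P = {}" using QP qP unfolding touch_def setQ by blast
  have qK: "q \<in> K" using Q(2,4) by (auto simp: q_def)
  have "\<exists>u\<in>set P. E q u" using Q(5) qP by (auto simp: q_def)
  then obtain A u B where AB: "P = A @ u # B" "E q u" "\<forall>z\<in>set A. \<not> E q z"
    using split_list_first_prop[OF \<open>\<exists>u\<in>set P. E q u\<close>] by blast
  have uK: "u \<in> K" using AB(1) P(4) by auto
  show ?thesis
  proof (cases "\<exists>z\<in>set B. E q z")
    case False
    \<comment> \<open>the connection ends at a vertex with one neighbour \<open>u\<close> on the path, which is the centre\<close>
    have "A \<noteq> []"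
    proof
      assume A: "A = []"
      then have "u = t1" "B \<noteq> []" using AB(1) P(3,5) t(4) by auto
      moreover have "E u (hd B)" using ipath_join[of E "[u]" B] P(1) AB(1) A \<open>B \<noteq> []\<close> by simp
      moreover have "hd B \<in> K" using hd_in_set[OF \<open>B \<noteq> []\<close>] P(4) AB(1) by auto
      ultimately have "q = hd B" using deg[of t1 q "hd B"] sym[OF AB(2)] qK by blast
      then show False using qP AB(1) \<open>B \<noteq> []\<close> by simp
    qed
    have "B \<noteq> []"
    proof
      assume B: "B = []"
      then have "u = t2" using AB(1) P(5) by simp
      moreover have "E (last A) u" using ipath_join[of E A "u # B"] P(1) AB(1) \<open>A \<noteq> []\<close> by simp
      moreover have "last A \<in> K" using last_in_set[OF \<open>A \<noteq> []\<close>] P(4) AB(1) by auto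
      ultimately have "q = last A" using deg[of t2 q "last A"] sym[of "last A" u] sym[OF AB(2)] qK by blast
      then show False using qP AB(1) \<open>A \<noteq> []\<close> by simp
    qed
    have dist: "u \<notin> set A" "u \<notin> set B" "set A \<inter> set B = {}" using ipath_distinct[OF P(1)] AB(1) by auto
    have p1: "ipath E (A @ [u])" using ipath_appendD[of E "A @ [u]" B] P(1) AB(1) by simp
    have "ipath E (rev (u # B))" using ipath_rev[of E "u # B"] sym ipath_appendD[of E A "u # B"] P(1) AB(1) by blast
    then have p2: "ipath E (rev B @ [u])" by simp
    have p3: "ipath E (Q @ [u])"
    proof (rule ipath_append[OF Q(1) _ _ Q(2)])
      show "set Q \<inter> set [u] = {}" using disjQ AB(1) by auto
      show "E (last Q) (hd [u])" using AB(2) by (simp add: q_def)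
      fix x y assume xy: "x \<in> set Q" "y \<in> set [u]" "E x y"
      have "x \<notin> set (butlast Q)" using QP xy(2,3) AB(1) unfolding touch_def by auto
      then show "x = last Q \<and> y = hd [u]" using xy setQ by (auto simp: q_def)
    qed auto
    have n12: "\<not> touch E (set A) (set B)"
      using ipath_cross[of E A "u # B"] P(1) AB(1) dist unfolding touch_def by fastforce
    have nq: "\<not> E x y" if "x \<in> set Q" "y \<in> set A \<union> set B" for x y
    proof (cases "x \<in> set (butlast Q)")
      case True
      then show ?thesis using QP that(2) AB(1) unfolding touch_def by auto
    next
      case F: False
      then have "x = q" using that(1) setQ by blast
      then show ?thesis using that(2) AB(3) False by blast
    qed
    have n13: "\<not> touch E (set A) (set Q)" "\<not> touch E (set (rev B)) (set Q)"
      using nq sym disjQ AB(1) unfolding touch_def by fastforce+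
    show ?thesis
    proof (rule that[of u A "rev B" Q])
      show "set A \<union> set (rev B) \<union> set Q \<subseteq> K" using P(4) AB(1) Q(4) by auto
      show "hd A = t1" using P(3) AB(1) \<open>A \<noteq> []\<close> by simp
      show "hd (rev B) = t2" using P(5) AB(1) \<open>B \<noteq> []\<close> by (simp add: hd_rev)
    qed (use uK \<open>A \<noteq> []\<close> \<open>B \<noteq> []\<close> Q p1 p2 p3 n12 n13 in auto)
  next
    case True
    \<comment> \<open>the last vertex \<open>q\<close> of the connection has several neighbours on the path: it is the centre,
      and the part of the path between the first and the last neighbour is dropped\<close>
    then obtain M z C where B: "B = M @ z # C" "E q z" "\<forall>x\<in>set C. \<not> E q x"
      using split_list_last_prop[OF True] by blast
    have Pdec: "P = (A @ [u]) @ (M @ z # C)" using AB(1) B(1) by simp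
    have zK: "z \<in> K" using Pdec P(4) by auto
    have dP: "distinct ((A @ [u]) @ (M @ z # C))" using ipath_distinct[OF P(1)] Pdec by simp
    have "M \<noteq> []"
    proof
      assume "M = []"
      then have "E u z" using ipath_join[of E "A @ [u]" "z # C"] P(1) Pdec by simp
      then show False using tf[of q u z] qK uK zK AB(2) B(2) by blast
    qed
    have p1: "ipath E ((A @ [u]) @ [q])"
    proof (rule ipath_append)
      show "ipath E (A @ [u])" using ipath_appendD[of E "A @ [u]" "M @ z # C"] P(1) Pdec by simp
      show "set (A @ [u]) \<inter> set [q] = {}" using qP Pdec by auto
      show "E (last (A @ [u])) (hd [q])" using AB(2) sym by simp
      fix x y assume "x \<in> set (A @ [u])" "y \<in> set [q]" "E x y"
      then show "x = last (A @ [u]) \<and> y = hd [q]" using AB(3) sym by auto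
    qed auto
    have "ipath E (z # C)" using ipath_appendD[of E "(A @ [u]) @ M" "z # C"] P(1) Pdec by simp
    then have rC: "ipath E (rev C @ [z])" using ipath_rev[of E "z # C"] sym by simp
    have p2: "ipath E ((rev C @ [z]) @ [q])"
    proof (rule ipath_append[OF rC])
      show "set (rev C @ [z]) \<inter> set [q] = {}" using qP Pdec by auto
      show "E (last (rev C @ [z])) (hd [q])" using B(2) sym by simp
      fix x y assume "x \<in> set (rev C @ [z])" "y \<in> set [q]" "E x y"
      then show "x = last (rev C @ [z]) \<and> y = hd [q]" using B(3) sym by auto
    qed auto
    have n12: "\<not> touch E (set (A @ [u])) (set (rev C @ [z]))"
    proof -
      have "y \<noteq> hd (M @ z # C)" if "y \<in> set (z # C)" for y
        using dP that \<open>M \<noteq> []\<close> by (cases M) auto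
      then have "\<not> E x y" if "x \<in> set (A @ [u])" "y \<in> set (z # C)" for x y
        using ipath_cross[of E "A @ [u]" "M @ z # C" x y] P(1) Pdec that by auto
      then show ?thesis using dP unfolding touch_def by auto
    qed
    have ne: "butlast Q \<noteq> []"
    proof
      assume "butlast Q = []"
      then have "Q = [q]" using Qq by simp
      then have "q = t3" using Q(3) by (metis list.sel(1))
      then have "u = z" using deg[of t3 u z] uK zK AB(2) B(2) by simp
      then show False using dP by auto
    qed
    have n3: "\<not> touch E (set (A @ [u])) (set (butlast Q))" "\<not> touch E (set (rev C @ [z])) (set (butlast Q))"
      using QP sym unfolding touch_def Pdec by fastforce+
    have hdQ: "hd (butlast Q) = t3" using Q(3) Qq ne by (metis hd_append2)
    show ?thesis
    proof (rule that[of q "A @ [u]" "rev C @ [z]" "butlast Q"])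
      show "set (A @ [u]) \<union> set (rev C @ [z]) \<union> set (butlast Q) \<subseteq> K"
        using P(4) Pdec Q(4) by (auto dest: in_set_butlastD)
      show "hd (A @ [u]) = t1" using P(3) AB(1) by (cases A) auto
      show "hd (rev C @ [z]) = t2" using P(5) Pdec by (cases C rule: rev_cases) (auto simp: hd_append)
      show "ipath E (butlast Q @ [q])" using Q(1) Qq by simp
    qed (use qK p1 p2 ne n12 n3 hdQ in auto)
  qed
qed

end

text \<open>The subgraph of \<open>H\<close> induced by \<open>U\<close>.\<close>

definition induce :: "'a pair_pre_digraph \<Rightarrow> 'a set \<Rightarrow> 'a pair_pre_digraph" where
  "induce H U = \<lparr> pverts = U, parcs = {(u, v). (u, v) \<in> parcs H \<and> u \<in> U \<and> v \<in> U} \<rparr>"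

lemma adj_induce: "adj (induce H U) u v \<longleftrightarrow> adj H u v \<and> u \<in> U \<and> v \<in> U"
  and pverts_induce: "pverts (induce H U) = U"
  by (auto simp: induce_def)

lemma wf_simple_graph: "simple_graph H \<Longrightarrow> wf_digraph (with_proj H)"
  by unfold_locales (auto simp: simple_graph_def)

lemma pair_graph_simple_graph:
  assumes "simple_graph H" "finite (pverts H)"
  shows "pair_graph H"
proof -
  have "parcs H \<subseteq> pverts H \<times> pverts H" using assms(1) by (auto simp: simple_graph_def)
  then have "finite (parcs H)" using assms(2) finite_subset by blast
  then show ?thesis using assms
    by unfold_locales (auto simp: simple_graph_def symmetric_def sym_def)
qed

lemma simple_graph_induce: "simple_graph H \<Longrightarrow> simple_graph (induce H U)"
  by (auto simp: simple_graph_def induce_def)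

lemma induced_subgraph_induce:
  assumes "simple_graph H" "U \<subseteq> pverts H"
  shows "induced_subgraph (with_proj (induce H U)) (with_proj H)"
  using assms wf_simple_graph[OF assms(1)] wf_simple_graph[OF simple_graph_induce[OF assms(1)], of U]
  by (auto simp: induced_subgraph_def subgraph_def compatible_def induce_def)

lemma simple_graph_path_graph:
  assumes "distinct p"
  shows "simple_graph (path_graph p)"
proof -
  have "a \<in> set p \<and> b \<in> set p \<and> a \<noteq> b" if "(a, b) \<in> set (vwalk_arcs p)" for a b
    using that assms by (induction p rule: vwalk_arcs.induct) auto
  then show ?thesis by (auto simp: simple_graph_def path_graph_def)
qed

lemma ipath_cong:
  "(\<And>x y. x \<in> set p \<Longrightarrow> y \<in> set p \<Longrightarrow> E x y = E' x y) \<Longrightarrow> ipath E p = ipath E' p"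
  by (induction p) auto

text \<open>Three induced paths from \<open>a\<close> to \<open>b\<close> with pairwise remote interiors form an induced theta.\<close>

lemma theta_of_ipaths:
  assumes H: "simple_graph H" "finite (pverts H)"
    and p: "\<And>i. i < 3 \<Longrightarrow> ipath (adj H) (a # q i @ [b])" "\<And>i. i < 3 \<Longrightarrow> set (a # q i @ [b]) \<subseteq> pverts H"
      "\<And>i. i < (3::nat) \<Longrightarrow> q i \<noteq> []"
    and far: "\<And>i j. i < 3 \<Longrightarrow> j < 3 \<Longrightarrow> i \<noteq> j \<Longrightarrow> \<not> touch (adj H) (set (q i)) (set (q j))"
  shows "theta (induce H (\<Union>i<3. set (a # q i @ [b]))) a b"
proof -
  define P where "P i = a # q i @ [b]" for i
  define U where "U = (\<Union>i<3. set (P i))"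
  let ?T = "induce H U"
  note p = p[folded P_def]
  have P: "P i \<noteq> []" "hd (P i) = a" "last (P i) = b" "set (P i) = insert a (insert b (set (q i)))"
    "length (P i) = length (q i) + 2" for i
    by (auto simp: P_def)
  have T: "simple_graph ?T" by (rule simple_graph_induce[OF H(1)])
  have UH: "U \<subseteq> pverts H" using p(2) unfolding U_def by blast
  have sub: "set (P i) \<subseteq> U" if "i < 3" for i using that unfolding U_def by blast
  have irrefl: "\<not> adj H x x" and symH: "adj H x y \<Longrightarrow> adj H y x" for x y using H(1) by (auto simp: simple_graph_def)
  have dist: "distinct (P i)" if "i < 3" for i using ipath_distinct[OF p(1)[OF that]] .
  have arcs: "adj ?T x y \<longleftrightarrow> (x, y) \<in> parcs (path_graph (P i))" if "i < 3" "x \<in> set (P i)" "y \<in> set (P i)" for i x y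
  proof -
    have "x \<in> U" "y \<in> U" using sub[OF that(1)] that(2,3) by blast+
    then have "adj ?T x y \<longleftrightarrow> adj H x y" unfolding adj_induce by blast
    also have "\<dots> \<longleftrightarrow> (x, y) \<in> parcs (path_graph (P i))"
      using ipath_arcs[OF _ _ p(1)[OF that(1)] that(2,3)] symH irrefl by (auto simp: path_graph_def)
    finally show ?thesis .
  qed
  have path_sub: "x \<in> set (P i) \<and> y \<in> set (P i)" if "i < 3" "(x, y) \<in> parcs (path_graph (P i))" for i x y
    using simple_graph_path_graph[OF dist[OF that(1)]] that(2) by (auto simp: simple_graph_def path_graph_def)
  have between: "path_between ?T a (P i) b" if i: "i < 3" for i
  proof -
    have "set (vwalk_arcs (P i)) \<subseteq> parcs ?T"
      using arcs[OF i] path_sub[OF i] by (auto simp: path_graph_def)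
    then show ?thesis using dist[OF i] sub[OF i]
      by (simp add: path_between_def vpath_def vwalk_def pverts_induce P(1-3))
  qed
  have induced: "induced_subgraph (with_proj (path_graph (P i))) (with_proj ?T)" if i: "i < 3" for i
  proof -
    have "parcs (path_graph (P i)) = {e \<in> parcs ?T. fst e \<in> set (P i) \<and> snd e \<in> set (P i)}"
      using arcs[OF i] path_sub[OF i] by auto
    then show ?thesis
      using sub[OF i] wf_simple_graph[OF T] wf_simple_graph[OF simple_graph_path_graph[OF dist[OF i]]]
      by (auto simp: induced_subgraph_def subgraph_def compatible_def path_graph_def pverts_induce)
  qed
  have interior: "interior (P i) = set (q i)" if "i < 3" for i
    using dist[OF that] unfolding interior_def P(2,3) by (auto simp: P_def)
  have anti: "anticomplete ?T (interior (P i)) (interior (P j))" if "i < 3" "j < 3" "i \<noteq> j" for i j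
    using far[OF that] unfolding anticomplete_def interior[OF that(1)] interior[OF that(2)]
    by (auto simp: touch_def adj_induce)
  have "parcs ?T \<subseteq> (\<Union>i<3. parcs (path_graph (P i)))"
  proof
    fix e assume e: "e \<in> parcs ?T"
    obtain x y where xy: "e = (x, y)" by (cases e)
    then obtain i j where ij: "i < 3" "j < 3" "x \<in> set (P i)" "y \<in> set (P j)" and H: "adj H x y"
      using e unfolding U_def by (auto simp: adj_induce)
    have "\<exists>l<3. x \<in> set (P l) \<and> y \<in> set (P l)"
    proof (cases "x \<in> set (q i) \<and> y \<in> set (q j)")
      case True
      then have "i = j" using far[OF ij(1,2)] H unfolding touch_def by blast
      then show ?thesis using ij by blast
    next
      case False
      then have "x = a \<or> x = b \<or> y = a \<or> y = b" using ij(3,4) unfolding P(4) by auto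
      then show ?thesis using ij unfolding P(4) by blast
    qed
    then show "e \<in> (\<Union>i<3. parcs (path_graph (P i)))" using arcs e xy by blast
  qed
  moreover have "(\<Union>i<3. parcs (path_graph (P i))) \<subseteq> parcs ?T" using arcs path_sub by auto
  ultimately have parcs: "parcs ?T = (\<Union>i<3. parcs (path_graph (P i)))" by blast
  have ab: "a \<noteq> b" using dist[of 0] by (auto simp: P_def)
  have "hd (q 0 @ [b]) \<noteq> b" using dist[of 0] p(3)[of 0] by (cases "q 0") (auto simp: P_def)
  then have nadj: "\<not> adj ?T a b" using p(1)[of 0] by (auto simp: adj_induce P_def)
  have "2 \<le> vwalk_length (P i)" if "i < 3" for i
    using p(3)[OF that] P(5)[of i] by (cases "q i") auto
  moreover have "pair_graph ?T"
    using pair_graph_simple_graph[OF T] finite_subset[OF UH H(2)] by (simp add: pverts_induce)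
  moreover have "pverts ?T = (\<Union>i<3. pverts (path_graph (P i)))" by (simp add: pverts_induce path_graph_def U_def)
  ultimately have "theta ?T a b"
    unfolding theta_def using ab nadj between induced anti parcs by (intro conjI exI[of _ P]) blast+
  then show ?thesis unfolding U_def P_def .
qed

lemma path_betweenD:
  "path_between G a p b \<Longrightarrow> set (vwalk_arcs p) \<subseteq> parcs G \<and> p \<noteq> [] \<and> hd p = a \<and> last p = b"
  by (auto simp: path_between_def vpath_def vwalk_def)

lemma vwalk_length_lipschitz:
  fixes f :: "'a \<Rightarrow> int"
  assumes "\<And>x y. (x, y) \<in> set (vwalk_arcs p) \<Longrightarrow> \<bar>f x - f y\<bar> \<le> 1" "p \<noteq> []"
  shows "\<bar>f (hd p) - f (last p)\<bar> \<le> int (vwalk_length p)"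
  using assms
proof (induction p rule: vwalk_arcs.induct)
  case (3 x y p)
  have "\<bar>f (hd (y # p)) - f (last (y # p))\<bar> \<le> int (vwalk_length (y # p))"
    by (rule "3.IH") (use "3.prems" in auto)
  moreover have "\<bar>f x - f y\<bar> \<le> 1" using "3.prems"(1) by simp
  ultimately show ?case by simp
qed simp_all

context dyadic_graph begin

lemma no_triangle: "E x y \<Longrightarrow> E y z \<Longrightarrow> \<not> E x z"
  by (auto simp: E_iff dest: cen_unique)

lemma next_column_free:
  assumes "cen m y" "\<bar>x - y\<bar> = 1"
  shows "\<not> cen r x"
  using cen_far[OF assms(1), of r x] assms(2) two_le_pow by fastforce

text \<open>If a connected set on one side of a column \<open>y\<close> reaches three vertices of the star of \<open>y\<close>
  and the centre of \<open>y\<close> is present, then there is a long theta: the three contacts are the ends of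
  an induced claw in the connected set, and its legs are continued to the centre of \<open>y\<close>. The centre
  of the claw has three neighbours, so it lies in another column with a star. If the row of the
  centre of \<open>y\<close> is among the contacts, it is chosen; then the centre of \<open>y\<close> is adjacent to no other
  vertex of the claw.\<close>

lemma theta_of_contacts:
  assumes H: "simple_graph H" "pverts H \<subseteq> V" "\<And>u v. adj H u v \<longleftrightarrow> u \<in> pverts H \<and> v \<in> pverts H \<and> E u v"
    and c: "c \<in> pverts H" "cen m y" "row c = m" "pos c = y" and s: "s = 1 \<or> s = -1"
    and K: "conn E K" "K \<subseteq> pverts H" "\<And>v. v \<in> K \<Longrightarrow> 0 < s * (pos v - y)"
    and R: "R = {r. m \<le> r \<and> (\<exists>v\<in>pverts H. row v = r \<and> pos v = y) \<and> (\<exists>w\<in>K. row w = r \<and> pos w = y + s)}"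
      "3 \<le> card R"
  shows "\<exists>T. long_theta (2 ^ g) T \<and> induced_subgraph (with_proj T) (with_proj H)"
proof -
  have fin: "finite (pverts H)" using H(2) finite_subset by (fastforce simp: V_def)
  obtain r1 r2 r3 where r: "r1 \<in> R" "r2 \<in> R" "r3 \<in> R" "r1 \<noteq> r2" "r1 \<noteq> r3" "r2 \<noteq> r3" "m \<in> R \<Longrightarrow> r1 = m"
  proof -
    have finR: "finite R" using R(2) card.infinite by force
    obtain r1 where r1: "r1 \<in> R" "m \<in> R \<Longrightarrow> r1 = m" using R(2) by (metis card.empty ex_in_conv not_numeral_le_zero)
    have "2 \<le> card (R - {r1})" using R(2) r1(1) finR by simp
    then obtain r2 r3 where "r2 \<in> R - {r1}" "r3 \<in> R - {r1}" "r2 \<noteq> r3" using two_distinct by meson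
    then show ?thesis using that[of r1 r2 r3] r1 by blast
  qed
  define rr where "rr i = (if i = 0 then r1 else if i = 1 then r2 else r3)" for i :: nat
  have rR: "rr i \<in> R" for i using r by (simp add: rr_def)
  have r_inj: "i = j" if "rr i = rr j" "i < 3" "j < 3" for i j
    using that r by (auto simp: rr_def split: if_splits)
  have r_m: "m = rr 0" if "m \<in> R" using r(7)[OF that] by (simp add: rr_def)
  have "\<forall>i. \<exists>v. v \<in> pverts H \<and> row v = rr i \<and> pos v = y" using rR unfolding R(1) by blast
  then obtain l where l: "\<And>i. l i \<in> pverts H \<and> row (l i) = rr i \<and> pos (l i) = y" by metis
  have "\<forall>i. \<exists>w. w \<in> K \<and> row w = rr i \<and> pos w = y + s" using rR unfolding R(1) by blast
  then obtain t where t: "\<And>i. t i \<in> K \<and> row (t i) = rr i \<and> pos (t i) = y + s" by metis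
  have r_ge: "m \<le> rr i" for i using rR[of i] R(1) by simp
  have KV: "v \<in> V" "pos v \<noteq> y" if "v \<in> K" for v using that K(2,3) H(2) by fastforce+
  have contact: "row w = row v \<and> pos w = y + s" if w: "w \<in> K" and v: "pos v = y" "E v w" for v w
  proof -
    have "pos w \<noteq> pos v" using KV(2)[OF w] v(1) by simp
    then have "row w = row v" "\<bar>pos v - pos w\<bar> = 1" using v(2) by (auto simp: E_iff)
    moreover have "0 < s * (pos w - y)" using K(3) w .
    ultimately show ?thesis using v(1) s by auto
  qed
  have free: "\<not> cen r (y + s)" for r by (rule next_column_free[OF c(2)]) (use s in auto)
  have deg: "pos x = y + 2 * s \<and> row x = row u" if "u \<in> K" "pos u = y + s" "x \<in> K" "E u x" for u x
  proof -
    have "row u = row x" "\<bar>pos u - pos x\<bar> = 1" using that(2,4) free by (auto simp: E_iff)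
    moreover have "0 < s * (pos x - y)" using K(3) that(3) .
    ultimately show ?thesis using that(2) s by auto
  qed
  have t_dist: "t i \<noteq> t j" if "i < 3" "j < 3" "i \<noteq> j" for i j using t r_inj that by metis
  have irrefl: "\<not> E x x" for x using E_neq by blast
  have tf: "\<not> E u z" if "u \<in> K" "x \<in> K" "z \<in> K" "E u x" "E x z" for u x z using no_triangle that(4,5) .
  have deg1: "x = z" if "u \<in> {t 0, t 1, t 2}" "x \<in> K" "z \<in> K" "E u x" "E u z" for u x z
  proof -
    have "u \<in> K" "pos u = y + s" using that(1) t by auto
    then have "pos x = pos z" "row x = row z" using deg[of u x] deg[of u z] that by simp_all
    then show ?thesis by (simp add: prod_eq_iff)
  qed
  have tK: "t i \<in> K" for i using t by blast
  have t_dist3: "t 0 \<noteq> t 1" "t 0 \<noteq> t 2" "t 1 \<noteq> t 2" using t_dist by simp_all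
  obtain w p0 p1 p2 where claw: "w \<in> K" "set p0 \<union> set p1 \<union> set p2 \<subseteq> K"
    "p0 \<noteq> []" "p1 \<noteq> []" "p2 \<noteq> []" "hd p0 = t 0" "hd p1 = t 1" "hd p2 = t 2"
    "ipath E (p0 @ [w])" "ipath E (p1 @ [w])" "ipath E (p2 @ [w])"
    "\<not> touch E (set p0) (set p1)" "\<not> touch E (set p0) (set p2)" "\<not> touch E (set p1) (set p2)"
    by (rule induced_claw[OF irrefl _ K(1) tK tK tK t_dist3], erule (4) tf, erule (4) deg1, rule that)
  define p where "p i = (if i = 0 then p0 else if i = 1 then p1 else p2)" for i :: nat
  have i3: "i = 0 \<or> i = 1 \<or> i = 2" if "i < 3" for i :: nat using that by auto
  have psub: "set p0 \<subseteq> K" "set p1 \<subseteq> K" "set p2 \<subseteq> K" using claw(2) by blast+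
  have p: "set (p i) \<subseteq> K" "p i \<noteq> []" "hd (p i) = t i" "ipath E (p i @ [w])" if "i < 3" for i
    using i3[OF that] psub claw(3-11) by (elim disjE; simp add: p_def)+
  have far_sym: "\<not> touch E (set p1) (set p0)" "\<not> touch E (set p2) (set p0)" "\<not> touch E (set p2) (set p1)"
    using touch_sym claw(12-14) by blast+
  have p_far: "\<not> touch E (set (p i)) (set (p j))" if "i < 3" "j < 3" "i \<noteq> j" for i j
    using i3[OF that(1)] i3[OF that(2)] that(3) claw(12-14) far_sym by (elim disjE; simp add: p_def)
  have t_p: "t i \<in> set (p i)" if "i < 3" for i using p(2,3)[OF that] hd_in_set by metis
  have t_w: "t i \<noteq> w" if "i < 3" for i using t_p[OF that] ipath_distinct[OF p(4)[OF that]] by auto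
  have own: "i = j" if "i < 3" "j < 3" "t i \<in> set (p j)" for i j
    using t_p[OF that(1)] p_far[OF that(1,2)] that(3) unfolding touch_def by blast
  define e where "e i = (if rr i = m then [] else [l i])" for i
  define q where "q i = e i @ p i" for i
  have cl: "E c (l i)" if "rr i \<noteq> m" for i
    using that l[of i] r_ge[of i] c H(2) by (auto simp: E_iff)
  have c_t: "x = t i" if x: "x \<in> set (p i @ [w])" "E c x" and i: "i < 3" for x i
  proof -
    have xK: "x \<in> K" using x(1) p(1)[OF i] claw(1) by auto
    then have x': "row x = m" "pos x = y + s" using contact[OF xK c(4) x(2)] c(3) by auto
    then have "m \<in> R" using R(1) xK c by auto
    then have "x = t 0" using x' t[of 0] r_m by (auto simp: prod_eq_iff)
    then have "i = 0" using x(1) own[of 0 i] t_w[of 0] i by auto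
    then show ?thesis using \<open>x = t 0\<close> by simp
  qed
  have l_t: "x = t i" if x: "x \<in> K" "E (l i) x" for x i
    using contact[OF x(1) _ x(2)] l[of i] t[of i] by (auto simp: prod_eq_iff)
  have lt: "E (l i) (t i)" for i
    using l[of i] t[of i] KV(1)[of "t i"] H(2) s by (auto simp: E_iff)
  have notK: "c \<notin> K" "l i \<notin> K" for i using KV(2) c(4) l by blast+
  have full: "ipath E (c # q i @ [w])" if i: "i < 3" for i
  proof -
    have sub: "set (p i @ [w]) \<subseteq> K" using p(1)[OF i] claw(1) by auto
    have hd: "hd (p i @ [w]) = t i" using p(2,3)[OF i] by simp
    show ?thesis
    proof (cases "rr i = m")
      case True
      then have "t i \<in> V" "row (t i) = m" using t[of i] KV(1) by auto
      then have "E c (t i)" using c t[of i] H(2) s by (auto simp: E_iff)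
      then have "E c x \<longleftrightarrow> x = hd (p i @ [w])" if "x \<in> set (p i @ [w])" for x
        unfolding hd using c_t[OF that _ i] by blast
      then show ?thesis using True sub notK p(4)[OF i] by (auto simp: q_def e_def)
    next
      case False
      have "E (l i) x \<longleftrightarrow> x = hd (p i @ [w])" if "x \<in> set (p i @ [w])" for x
        unfolding hd using l_t[OF subsetD[OF sub that]] lt by blast
      then have 1: "ipath E (l i # p i @ [w])" using p(4)[OF i] sub notK by auto
      have "\<not> E c (t i)" using contact[of "t i" c] t[of i] c False by auto
      then have no: "\<not> E c x" if "x \<in> set (p i @ [w])" for x using c_t[OF that _ i] by blast
      have "E c x \<longleftrightarrow> x = l i" if x: "x \<in> set (l i # p i @ [w])" for x
      proof (cases "x = l i")
        case True
        then show ?thesis using cl[OF False] by simp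
      next
        case F: False
        then show ?thesis using no[of x] x by simp
      qed
      moreover have "c \<noteq> l i" using c(3) l[of i] False by auto
      ultimately show ?thesis using 1 False sub notK by (auto simp: q_def e_def)
    qed
  qed
  have ll: "l i \<noteq> l j \<and> \<not> E (l i) (l j)" if "i < 3" "j < 3" "i \<noteq> j" "rr i \<noteq> m" "rr j \<noteq> m" for i j
  proof -
    have "rr i \<noteq> rr j" using r_inj that by blast
    moreover have "\<not> cen (rr i) y" "\<not> cen (rr j) y" using cen_unique[OF c(2)] that(4,5) by auto
    moreover have "row (l i) = rr i" "row (l j) = rr j" "pos (l i) = y" "pos (l j) = y" using l by blast+
    ultimately have "row (l i) \<noteq> row (l j)" "\<not> E (l i) (l j)" by (simp_all add: E_iff)
    then show ?thesis by metis
  qed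
  have far: "\<not> touch E (set (q i)) (set (q j))" if ij: "i < 3" "j < 3" "i \<noteq> j" for i j
  proof
    assume "touch E (set (q i)) (set (q j))"
    then obtain u v where uv: "u \<in> set (q i)" "v \<in> set (q j)" "u = v \<or> E u v" unfolding touch_def by blast
    have mix: "\<not> (x = l a \<or> E (l a) x)" if "a < 3" "b < 3" "a \<noteq> b" "x \<in> set (p b)" for a b x
      using l_t[of x a] own[of a b] notK(2)[of a] that p(1)[of b] by blast
    consider "u \<in> set (p i)" "v \<in> set (p j)" | "u = l i" "v \<in> set (p j)" | "u \<in> set (p i)" "v = l j"
      | "u = l i" "v = l j" "rr i \<noteq> m" "rr j \<noteq> m"
      using uv(1,2) by (auto simp: q_def e_def split: if_splits)
    then show False
    proof cases
      case 1
      then show ?thesis using p_far[OF ij] uv(3) unfolding touch_def by blast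
    next
      case 2
      then show ?thesis using mix[OF ij 2(2)] uv(3) by metis
    next
      case 3
      then show ?thesis using mix[OF ij(2,1) ij(3)[symmetric] 3(1)] uv(3) sym by metis
    next
      case 4
      then show ?thesis using ll[OF ij 4(3,4)] uv(3) 4(1,2) by metis
    qed
  qed
  have inH: "set (c # q i @ [w]) \<subseteq> pverts H" if "i < 3" for i
    using p(1)[OF that] K(2) claw(1) c(1) l by (auto simp: q_def e_def)
  let ?U = "\<Union>i<3. set (c # q i @ [w])"
  let ?T = "induce H ?U"
  have theta: "theta ?T c w"
  proof (rule theta_of_ipaths[OF H(1) fin])
    fix i :: nat assume i: "i < 3"
    show "ipath (adj H) (c # q i @ [w])"
      using full[OF i] ipath_cong[of "c # q i @ [w]" E "adj H"] inH[OF i] H(3) by blast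
    show "set (c # q i @ [w]) \<subseteq> pverts H" by (rule inH[OF i])
    show "q i \<noteq> []" using p(2)[OF i] by (simp add: q_def)
  next
    fix i j :: nat assume "i < 3" "j < 3" "i \<noteq> j"
    then show "\<not> touch (adj H) (set (q i)) (set (q j))" using far H(3) unfolding touch_def by blast
  qed
  have "2 ^ g \<le> \<bar>pos c - pos w\<bar>"
  proof -
    have last_E: "E (last (p i)) w" if "i < 3" for i using ipath_join[OF p(4)[OF that]] p(2)[OF that] by simp
    have last_d: "last (p i) \<noteq> last (p j)" if "i < 3" "j < 3" "i \<noteq> j" for i j
      using p_far[OF that] p(2)[OF that(1)] p(2)[OF that(2)] last_in_set unfolding touch_def by (metis disjoint_iff)
    have "\<exists>r. cen r (pos w)"
    proof (rule ccontr)
      assume no: "\<not> ?thesis"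
      have h: "row (last (p i)) = row w \<and> (pos (last (p i)) = pos w + 1 \<or> pos (last (p i)) = pos w - 1)" if "i < 3" for i
        using last_E[OF that] no by (auto simp: E_iff)
      have "pos (last (p i)) \<noteq> pos (last (p j))" if "i < 3" "j < 3" "i \<noteq> j" for i j
        using last_d[OF that] h[OF that(1)] h[OF that(2)] by (auto simp: prod_eq_iff)
      from this[of 0 1] this[of 0 2] this[of 1 2] show False using h[of 0] h[of 1] h[of 2] by auto
    qed
    then show ?thesis using cen_far[OF c(2)] KV(2)[OF claw(1)] c(4) by (metis)
  qed
  then have len: "2 ^ g \<le> vwalk_length P" if P: "path_between ?T c P w" for P
  proof -
    note PD = path_betweenD[OF P]
    have "\<bar>pos u - pos v\<bar> \<le> 1" if uv: "(u, v) \<in> set (vwalk_arcs P)" for u v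
    proof -
      have "(u, v) \<in> parcs ?T" using PD uv by blast
      then have "E u v" unfolding adj_induce H(3) by blast
      then show ?thesis using E_pos by blast
    qed
    moreover have ends: "P \<noteq> []" "hd P = c" "last P = w" using PD by blast+
    ultimately have "\<bar>pos (hd P) - pos (last P)\<bar> \<le> int (vwalk_length P)"
      by (intro vwalk_length_lipschitz)
    then have "2 ^ g \<le> int (vwalk_length P)"
      using \<open>2 ^ g \<le> \<bar>pos c - pos w\<bar>\<close> unfolding ends by (rule order_trans[rotated])
    then have "int (2 ^ g) \<le> int (vwalk_length P)" unfolding of_nat_power of_nat_numeral .
    then show ?thesis unfolding of_nat_le_iff .
  qed
  have "\<exists>P. path_between ?T c P w" using theta unfolding theta_def by (meson zero_less_numeral)
  then have "\<exists>n P. path_between ?T c P w \<and> vwalk_length P = n" by blast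
  then have "\<exists>P. path_between ?T c P w \<and> vwalk_length P = path_dist ?T c w"
    unfolding path_dist_def by (rule LeastI_ex)
  then have "2 ^ g \<le> path_dist ?T c w" using len by metis
  then have "long_theta (2 ^ g) ?T" using theta unfolding long_theta_def by blast
  moreover have "induced_subgraph (with_proj ?T) (with_proj H)"
    by (rule induced_subgraph_induce[OF H(1)]) (use inH in blast)
  ultimately show ?thesis by blast
qed

end

section \<open>Induced subgraphs without long thetas\<close>

text \<open>The consequence of the absence of long thetas which bounds the tree-width: a connected part on
  one side of an active column has at most two contacts with its star.\<close>

locale few_contacts = dyadic_graph +
  fixes U :: "(nat \<times> nat) set"
  assumes UV: "U \<subseteq> V"
    and contact_rows: "\<And>m y c s K. c \<in> U \<Longrightarrow> cen m y \<Longrightarrow> row c = m \<Longrightarrow> pos c = y \<Longrightarrow> s = 1 \<or> s = -1 \<Longrightarrow>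
      conn E K \<Longrightarrow> K \<subseteq> U \<Longrightarrow> (\<And>v. v \<in> K \<Longrightarrow> 0 < s * (pos v - y)) \<Longrightarrow>
      card {r. m \<le> r \<and> (\<exists>v\<in>U. row v = r \<and> pos v = y) \<and> (\<exists>w\<in>K. row w = r \<and> pos w = y + s)} \<le> 2"
begin

lemma finU: "finite U"
proof -
  have "finite V" by (simp add: V_def)
  then show ?thesis using UV by (rule finite_subset[rotated])
qed

lemma contacts:
  assumes y: "act U y" and K: "conn E K" "K \<subseteq> U" and s: "s = 1 \<or> s = -1" "\<And>v. v \<in> K \<Longrightarrow> 0 < s * (pos v - y)"
  shows "card {w\<in>K. \<exists>v\<in>U \<inter> star y. E v w} \<le> 2" "card {v\<in>U \<inter> star y. \<exists>w\<in>K. E v w} \<le> 2"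
proof -
  obtain c where c: "c \<in> U" "pos c = y" "cen (row c) y" using y by (auto simp: act_def)
  let ?m = "row c"
  let ?R = "{r. ?m \<le> r \<and> (\<exists>v\<in>U. row v = r \<and> pos v = y) \<and> (\<exists>w\<in>K. row w = r \<and> pos w = y + s)}"
  have R: "card ?R \<le> 2" using contact_rows[OF c(1,3) _ c(2) s(1) K s(2)] by simp
  have "?R \<subseteq> row ` U" by blast
  then have finR: "finite ?R" using finU finite_subset by blast
  have side: "row w = row v \<and> pos w = y + s" if "w \<in> K" "pos v = y" "E v w" for v w
  proof -
    have w: "0 < s * (pos w - y)" using s(2) that(1) .
    then have "pos v \<noteq> pos w" using that(2) by auto
    then have "row v = row w" "\<bar>pos v - pos w\<bar> = 1" using that(3) by (auto simp: E_iff)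
    then show ?thesis using w that(2) s(1) by auto
  qed
  have star: "pos v = y \<and> ?m \<le> row v" if "v \<in> star y" for v using that by (simp add: star_cen[OF c(3)])
  show "card {w\<in>K. \<exists>v\<in>U \<inter> star y. E v w} \<le> 2"
  proof (rule order_trans[OF card_inj_on_le[of row _ ?R] R])
    show "inj_on row {w\<in>K. \<exists>v\<in>U \<inter> star y. E v w}"
    proof (rule inj_onI)
      fix x z assume xz: "x \<in> {w\<in>K. \<exists>v\<in>U \<inter> star y. E v w}" "z \<in> {w\<in>K. \<exists>v\<in>U \<inter> star y. E v w}" "row x = row z"
      then have "pos x = y + s" "pos z = y + s" using side star by blast+
      then have "pos x = pos z" by simp
      then show "x = z" using xz(3) by (simp add: prod_eq_iff)
    qed
    show "row ` {w\<in>K. \<exists>v\<in>U \<inter> star y. E v w} \<subseteq> ?R"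
    proof
      fix r assume "r \<in> row ` {w\<in>K. \<exists>v\<in>U \<inter> star y. E v w}"
      then obtain v w where vw: "w \<in> K" "v \<in> U" "v \<in> star y" "E v w" "r = row w" by blast
      then have "row w = row v" "pos w = y + s" "pos v = y" "?m \<le> row v" using side star by blast+
      then show "r \<in> ?R" using vw by auto
    qed
  qed (rule finR)
  show "card {v\<in>U \<inter> star y. \<exists>w\<in>K. E v w} \<le> 2"
  proof (rule order_trans[OF card_inj_on_le[of row _ ?R] R])
    show "inj_on row {v\<in>U \<inter> star y. \<exists>w\<in>K. E v w}"
    proof (rule inj_onI)
      fix x z assume xz: "x \<in> {v\<in>U \<inter> star y. \<exists>w\<in>K. E v w}" "z \<in> {v\<in>U \<inter> star y. \<exists>w\<in>K. E v w}" "row x = row z"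
      then have "pos x = pos z" using star by simp
      then show "x = z" using xz(3) by (simp add: prod_eq_iff)
    qed
    show "row ` {v\<in>U \<inter> star y. \<exists>w\<in>K. E v w} \<subseteq> ?R"
    proof
      fix r assume "r \<in> row ` {v\<in>U \<inter> star y. \<exists>w\<in>K. E v w}"
      then obtain v w where vw: "w \<in> K" "v \<in> U" "v \<in> star y" "E v w" "r = row v" by blast
      then have "row w = row v" "pos w = y + s" "pos v = y" "?m \<le> row v" using side star by blast+
      then show "r \<in> ?R" using vw by auto
    qed
  qed (rule finR)
qed

text \<open>The three kinds of parts of the graph which arise by successive deletions: parts of a single
  row; components of the graph within a nested strip; and parts around a column \<open>y\<close> that have no
  neighbours outside the star of \<open>y\<close>, for which the number of horizontal edges to these neighbours
  is bounded.\<close>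

definition row_part :: "(nat \<times> nat) set \<Rightarrow> bool" where
  "row_part C \<longleftrightarrow> conn E C \<and> (\<exists>r s t. C \<subseteq> {v\<in>U. row v = r \<and> s < pos v \<and> pos v < t} \<and>
     nbs E U C \<subseteq> {v. row v = r \<and> (pos v = s \<or> pos v = t)})"

definition strip_part :: "int \<Rightarrow> int \<Rightarrow> (nat \<times> nat) set \<Rightarrow> bool" where
  "strip_part a b C \<longleftrightarrow> nested U a b \<and> strip_end U a \<and> strip_end U b \<and> conn E C \<and>
     C \<subseteq> region a b \<inter> U \<and> nbs E U C \<subseteq> star a \<union> star b"

definition border :: "(nat \<times> nat) set \<Rightarrow> ((nat \<times> nat) \<times> (nat \<times> nat)) set" where
  "border C = {(v, w). v \<in> nbs E U C \<and> w \<in> C \<and> E v w \<and> row v = row w}"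

definition local_part :: "int \<Rightarrow> int \<Rightarrow> nat \<Rightarrow> int \<Rightarrow> (nat \<times> nat) set \<Rightarrow> bool" where
  "local_part a b m y C \<longleftrightarrow> nested U a b \<and> strip_end U a \<and> strip_end U b \<and> lowest U a b m y \<and>
     conn E C \<and> C \<subseteq> region a b \<inter> U \<and> (\<forall>v\<in>C. m \<le> row v) \<and> (\<forall>v\<in>C. \<not> (row v = m \<and> pos v = y)) \<and>
     nbs E U C \<subseteq> star y \<and> card (border C) \<le> 18"

definition part :: "(nat \<times> nat) set \<Rightarrow> bool" where
  "part C \<longleftrightarrow> C \<noteq> {} \<and> (row_part C \<or> (\<exists>a b. strip_part a b C) \<or> (\<exists>a b m y. local_part a b m y C))"

lemma nbs_component: "s \<in> C - B \<Longrightarrow> C \<subseteq> U \<Longrightarrow> nbs E U (component E (C - B) s) \<subseteq> nbs E U C \<union> B"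
  using comp_subset[of s "C - B" E] comp_step[of _ E "C - B" s] sym unfolding nbs_def by blast

lemma horizontal_card:
  assumes "finite B"
  shows "card {(v, w). v \<in> B \<and> E v w \<and> row v = row w} \<le> 2 * card B" "finite {(v, w). v \<in> B \<and> E v w \<and> row v = row w}"
proof -
  let ?f = "\<lambda>(v, i). (v, (row v, nat (pos v + i)))"
  have sub: "{(v, w). v \<in> B \<and> E v w \<and> row v = row w} \<subseteq> ?f ` (B \<times> {1, -1})"
  proof
    fix e assume "e \<in> {(v, w). v \<in> B \<and> E v w \<and> row v = row w}"
    then obtain v w where e: "e = (v, w)" "v \<in> B" "E v w" "row v = row w" by blast
    then have "pos w = pos v + 1 \<or> pos w = pos v - 1" by (auto simp: E_iff)
    then have "w = (row v, nat (pos v + 1)) \<or> w = (row v, nat (pos v + -1))"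
      using e(4) by (cases w) auto
    then show "e \<in> ?f ` (B \<times> {1, -1})" using e by force
  qed
  have fin: "finite (B \<times> {1, -1 :: int})" using assms by simp
  then show "finite {(v, w). v \<in> B \<and> E v w \<and> row v = row w}"
    using finite_subset[OF sub] by blast
  have "card {(v, w). v \<in> B \<and> E v w \<and> row v = row w} \<le> card (?f ` (B \<times> {1, -1}))"
    using sub fin by (intro card_mono) auto
  also have "\<dots> \<le> card (B \<times> {1, -1 :: int})" by (rule card_image_le[OF fin])
  also have "\<dots> = 2 * card B" by (simp add: card_cartesian_product)
  finally show "card {(v, w). v \<in> B \<and> E v w \<and> row v = row w} \<le> 2 * card B" .
qed

lemma finite_border: "finite (border C)"
proof -
  have "border C \<subseteq> U \<times> V" using E_V by (auto simp: border_def nbs_def)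
  moreover have "finite (U \<times> V)" using finU by (simp add: V_def)
  ultimately show ?thesis by (rule finite_subset)
qed

lemma end_contacts:
  assumes a: "strip_end U a" and C: "conn E C" "C \<subseteq> U" and s: "s = 1 \<or> s = -1" "\<And>v. v \<in> C \<Longrightarrow> 0 < s * (pos v - a)"
  shows "card {w\<in>C. \<exists>v\<in>U \<inter> star a. E v w} \<le> 2" "card {v\<in>U \<inter> star a. \<exists>w\<in>C. E v w} \<le> 2"
proof -
  have "card {w\<in>C. \<exists>v\<in>U \<inter> star a. E v w} \<le> 2 \<and> card {v\<in>U \<inter> star a. \<exists>w\<in>C. E v w} \<le> 2"
  proof (cases "act U a")
    case True
    then show ?thesis using contacts[OF True C s] by simp
  next
    case False
    then have "star a = {}" using strip_end_star a by blast
    then show ?thesis by simp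
  qed
  then show "card {w\<in>C. \<exists>v\<in>U \<inter> star a. E v w} \<le> 2" "card {v\<in>U \<inter> star a. \<exists>w\<in>C. E v w} \<le> 2" by auto
qed

lemma region_sides: "v \<in> region a b \<Longrightarrow> 0 < 1 * (pos v - a) \<and> 0 < -1 * (pos v - b)"
  by (auto simp: region_def)

lemma strip_part_contacts:
  assumes "strip_part a b C"
  shows "card {w\<in>C. \<exists>v\<in>U \<inter> (star a \<union> star b). E v w} \<le> 4" "card (nbs E U C) \<le> 4"
proof -
  have C: "conn E C" "C \<subseteq> U" "C \<subseteq> region a b" "strip_end U a" "strip_end U b" "nbs E U C \<subseteq> star a \<union> star b"
    using assms by (auto simp: strip_part_def)
  have 1: "card {w\<in>C. \<exists>v\<in>U \<inter> star a. E v w} \<le> 2" "card {v\<in>U \<inter> star a. \<exists>w\<in>C. E v w} \<le> 2"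
    using end_contacts[OF C(4,1,2), of 1] region_sides C(3) by blast+
  have 2: "card {w\<in>C. \<exists>v\<in>U \<inter> star b. E v w} \<le> 2" "card {v\<in>U \<inter> star b. \<exists>w\<in>C. E v w} \<le> 2"
    using end_contacts[OF C(5,1,2), of "-1"] region_sides C(3) by blast+
  have "{w\<in>C. \<exists>v\<in>U \<inter> (star a \<union> star b). E v w} = {w\<in>C. \<exists>v\<in>U \<inter> star a. E v w} \<union> {w\<in>C. \<exists>v\<in>U \<inter> star b. E v w}"
    by blast
  then show "card {w\<in>C. \<exists>v\<in>U \<inter> (star a \<union> star b). E v w} \<le> 4"
    using card_Un_le[of "{w\<in>C. \<exists>v\<in>U \<inter> star a. E v w}" "{w\<in>C. \<exists>v\<in>U \<inter> star b. E v w}"] 1 2 by simp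
  have "nbs E U C \<subseteq> {v\<in>U \<inter> star a. \<exists>w\<in>C. E v w} \<union> {v\<in>U \<inter> star b. \<exists>w\<in>C. E v w}"
    using C(6) unfolding nbs_def by blast
  then have "card (nbs E U C) \<le> card ({v\<in>U \<inter> star a. \<exists>w\<in>C. E v w} \<union> {v\<in>U \<inter> star b. \<exists>w\<in>C. E v w})"
    using finU by (intro card_mono) auto
  then show "card (nbs E U C) \<le> 4"
    using card_Un_le[of "{v\<in>U \<inter> star a. \<exists>w\<in>C. E v w}" "{v\<in>U \<inter> star b. \<exists>w\<in>C. E v w}"] 1 2 by simp
qed

lemma part_few_nbs:
  assumes "part C"
  shows "C \<subseteq> U \<and> card (nbs E U C) \<le> 19"
proof -
  consider "row_part C" | a b where "strip_part a b C" | a b m y where "local_part a b m y C"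
    using assms unfolding part_def by blast
  then show ?thesis
  proof cases
    case 1
    then obtain r s t where C: "C \<subseteq> {v\<in>U. row v = r \<and> s < pos v \<and> pos v < t}"
      "nbs E U C \<subseteq> {v. row v = r \<and> (pos v = s \<or> pos v = t)}" unfolding row_part_def by blast
    then have "nbs E U C \<subseteq> set [(r, nat s), (r, nat t)]" by (auto simp: prod_eq_iff)
    then have "card (nbs E U C) \<le> card (set [(r, nat s), (r, nat t)])" by (rule card_mono[rotated]) simp
    also have "\<dots> \<le> 2" using card_length[of "[(r, nat s), (r, nat t)]"] by simp
    finally show ?thesis using C by auto
  next
    case 2
    then show ?thesis using strip_part_contacts(2)[OF 2] by (auto simp: strip_part_def)
  next
    case 3
    then have C: "lowest U a b m y" "C \<subseteq> U" "\<forall>v\<in>C. \<not> (row v = m \<and> pos v = y)" "nbs E U C \<subseteq> star y" "card (border C) \<le> 18"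
      by (auto simp: local_part_def)
    have y: "cen m y" using C(1) by (simp add: lowest_def)
    have "nbs E U C \<subseteq> insert (m, nat y) (fst ` border C)"
    proof
      fix v assume v: "v \<in> nbs E U C"
      then obtain w where w: "w \<in> C" "E v w" by (auto simp: nbs_def)
      show "v \<in> insert (m, nat y) (fst ` border C)"
      proof (cases "row v = row w")
        case True
        then have "(v, w) \<in> border C" using v w by (auto simp: border_def)
        then show ?thesis by force
      next
        case False
        have vy: "pos v = y" using v C(4) by (auto simp: star_def)
        then have "pos w = y" "cen (row v) y \<or> cen (row w) y" using w(2) False by (auto simp: E_iff)
        then have "row v = m" using C(3) w(1) cen_unique[OF y] by blast
        then show ?thesis using vy by (auto simp: prod_eq_iff)
      qed
    qed
    then have "card (nbs E U C) \<le> card (insert (m, nat y) (fst ` border C))"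
      using finite_border by (intro card_mono) auto
    also have "\<dots> \<le> Suc (card (fst ` border C))" by (rule card_insert_le_m1) auto
    also have "\<dots> \<le> Suc (card (border C))" using card_image_le[OF finite_border] by simp
    finally show ?thesis using C by simp
  qed
qed

lemma row_part_split:
  assumes "row_part C" "v \<in> C" "s0 \<in> C - {v}"
  shows "row_part (component E (C - {v}) s0)"
proof -
  let ?D = "component E (C - {v}) s0"
  obtain r s t where C: "C \<subseteq> {v\<in>U. row v = r \<and> s < pos v \<and> pos v < t}"
    "nbs E U C \<subseteq> {v. row v = r \<and> (pos v = s \<or> pos v = t)}" using assms(1) unfolding row_part_def by blast
  have D: "conn E ?D" "?D \<subseteq> C - {v}" "s0 \<in> ?D"
    by (rule conn_comp[OF assms(3)], rule comp_subset[OF assms(3)], rule comp_self)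
  have N: "nbs E U ?D \<subseteq> nbs E U C \<union> {v}" using nbs_component[OF assms(3)] C(1) by blast
  have v: "row v = r" "s < pos v" "pos v < t" using assms(2) C(1) by auto
  have off: "pos u \<noteq> pos v" if "u \<in> ?D" for u
  proof
    assume "pos u = pos v"
    moreover have "u \<in> C" "u \<noteq> v" using that D(2) by blast+
    moreover from this have "row u = r" using C(1) by blast
    ultimately show False using v(1) by (simp add: prod_eq_iff)
  qed
  have adj: "\<exists>w\<in>?D. \<bar>pos x - pos w\<bar> \<le> 1" if "x \<in> nbs E U ?D" for x using that E_pos unfolding nbs_def by blast
  have x: "row x = r \<and> (pos x = s \<or> pos x = t \<or> pos x = pos v)" if "x \<in> nbs E U ?D" for x
    using N C(2) that v(1) by blast
  define i :: int where "i = (if pos s0 < pos v then -1 else 1)"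
  have i: "i = 1 \<or> i = -1" "0 < i * (pos s0 - pos v)" using off[OF D(3)] by (auto simp: i_def)
  have side: "0 < i * (pos u - pos v)" if "u \<in> ?D" for u
    using stays_on_side[OF i(1) D(1,3) i(2) off that] .
  have sub: "u \<in> U \<and> row u = r \<and> s < pos u \<and> pos u < t" if "u \<in> ?D" for u using D(2) C(1) that by blast
  show ?thesis
  proof (cases "i = 1")
    case True
    have "?D \<subseteq> {u\<in>U. row u = r \<and> pos v < pos u \<and> pos u < t}" using side sub True by auto
    moreover have "nbs E U ?D \<subseteq> {u. row u = r \<and> (pos u = pos v \<or> pos u = t)}"
    proof
      fix z assume z: "z \<in> nbs E U ?D"
      obtain w where "w \<in> ?D" "\<bar>pos z - pos w\<bar> \<le> 1" using adj[OF z] by blast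
      then have "pos z \<noteq> s" using side[of w] True v(2) by auto
      then show "z \<in> {u. row u = r \<and> (pos u = pos v \<or> pos u = t)}" using x[OF z] by blast
    qed
    ultimately show ?thesis unfolding row_part_def using D(1) by blast
  next
    case False
    then have i1: "i = -1" using i(1) by simp
    have "?D \<subseteq> {u\<in>U. row u = r \<and> s < pos u \<and> pos u < pos v}" using side sub i1 by auto
    moreover have "nbs E U ?D \<subseteq> {u. row u = r \<and> (pos u = s \<or> pos u = pos v)}"
    proof
      fix z assume z: "z \<in> nbs E U ?D"
      obtain w where "w \<in> ?D" "\<bar>pos z - pos w\<bar> \<le> 1" using adj[OF z] by blast
      then have "pos z \<noteq> t" using side[of w] i1 v(3) by auto
      then show "z \<in> {u. row u = r \<and> (pos u = s \<or> pos u = pos v)}" using x[OF z] by blast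
    qed
    ultimately show ?thesis unfolding row_part_def using D(1) by blast
  qed
qed

text \<open>A part of a strip that has no neighbours but in the stars of its ends and of its lowest active
  column, and avoids the latter, is a component within one of the two smaller strips.\<close>

lemma part_on_side:
  assumes n: "nested U a b" "strip_end U a" "strip_end U b" and low: "lowest U a b m y"
    and X: "conn E X" "X \<subseteq> region a b \<inter> U" "\<And>v. v \<in> X \<Longrightarrow> m \<le> row v" "X \<inter> star y = {}" "X \<noteq> {}"
    and N: "nbs E U X \<subseteq> star a \<union> star b \<union> star y"
  shows "strip_part a y X \<or> strip_part y b X"
proof -
  have y: "cen m y" "a < y" "y < b" "act U y" using low by (auto simp: lowest_def)
  note nh = nested_halves[OF n(1) low]
  have ye: "strip_end U y" using y(4) by (simp add: strip_end_def)
  have off: "pos v \<noteq> y" if v: "v \<in> X" for v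
  proof
    assume "pos v = y"
    then have "v \<in> star y" using X(2) X(3)[OF v] v UV by (auto simp: star_cen[OF y(1)])
    then show False using X(4) v by blast
  qed
  have avoid: "X \<inter> star a = {}" "X \<inter> star b = {}" using X(2) by (auto simp: region_def star_def)
  obtain d where d: "d \<in> X" using X(5) by blast
  have adj: "\<exists>w\<in>X. \<bar>pos x - pos w\<bar> \<le> 1" if "x \<in> nbs E U X" for x using that E_pos unfolding nbs_def by blast
  have "d \<in> region a y \<or> d \<in> region y b"
    using region_halves[of d a b m y] d X(2,3) y(1) off by blast
  then show ?thesis
  proof
    assume "d \<in> region a y"
    then have sub: "X \<subseteq> region a y" using conn_in_region[OF UV nh(1) X(1) _ d] X(2,4) avoid by blast
    have "nbs E U X \<subseteq> star a \<union> star y"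
    proof
      fix x assume x: "x \<in> nbs E U X"
      obtain w where "w \<in> X" "\<bar>pos x - pos w\<bar> \<le> 1" using adj[OF x] by blast
      then have "pos x < b" using sub y(3) by (fastforce simp: region_def)
      then show "x \<in> star a \<union> star y" using N x by (auto simp: star_def)
    qed
    then show ?thesis unfolding strip_part_def using nh n(2) ye X(1,2) sub by blast
  next
    assume "d \<in> region y b"
    then have sub: "X \<subseteq> region y b" using conn_in_region[OF UV nh(2) X(1) _ d] X(2,4) avoid by blast
    have "nbs E U X \<subseteq> star y \<union> star b"
    proof
      fix x assume x: "x \<in> nbs E U X"
      obtain w where "w \<in> X" "\<bar>pos x - pos w\<bar> \<le> 1" using adj[OF x] by blast
      then have "a < pos x" using sub y(2) by (fastforce simp: region_def)
      then show "x \<in> star y \<union> star b" using N x by (auto simp: star_def)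
    qed
    then show ?thesis unfolding strip_part_def using nh n(3) ye X(1,2) sub by blast
  qed
qed

lemma flat_strip_part:
  assumes C: "strip_part a b C" and no: "\<And>v. v \<in> C \<Longrightarrow> \<not> cen (row v) (pos v)"
  shows "row_part C"
proof (cases "C = {}")
  case True
  then show ?thesis by (auto simp: row_part_def conn_empty nbs_def)
next
  case False
  then obtain d where d: "d \<in> C" by blast
  have C': "conn E C" "C \<subseteq> region a b \<inter> U" "nbs E U C \<subseteq> star a \<union> star b" using C by (auto simp: strip_part_def)
  have "C \<subseteq> {v. row v = row d}"
  proof (rule conn_closed[OF C'(1) d])
    fix x z assume "x \<in> C" "x \<in> {v. row v = row d}" "z \<in> C" "E x z"
    then show "z \<in> {v. row v = row d}" using no[of x] no[of z] by (auto simp: E_iff)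
  qed simp
  then have rows: "row v = row d" if "v \<in> C" for v using that by blast
  then have "C \<subseteq> {v\<in>U. row v = row d \<and> a < pos v \<and> pos v < b}" using C'(2) by (auto simp: region_def)
  moreover have "nbs E U C \<subseteq> {v. row v = row d \<and> (pos v = a \<or> pos v = b)}"
  proof
    fix x assume x: "x \<in> nbs E U C"
    then obtain w where w: "w \<in> C" "E x w" by (auto simp: nbs_def)
    have "pos x = a \<or> pos x = b" using x C'(3) by (auto simp: star_def)
    moreover have "a < pos w" "pos w < b" using w(1) C'(2) by (auto simp: region_def)
    ultimately show "x \<in> {v. row v = row d \<and> (pos v = a \<or> pos v = b)}"
      using w(2) rows[OF w(1)] by (auto simp: E_iff)
  qed
  ultimately show ?thesis unfolding row_part_def using C'(1) by blast
qed

text \<open>A component \<open>C\<close> within a strip whose lowest active column \<open>y\<close> meets it is broken by deleting the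
  centre of \<open>y\<close> together with the leaves of this star that have contact with a component of \<open>C\<close>
  beside column \<open>y\<close> which reaches an end of the strip. There are at most four such components,
  and each of them has contact with at most two vertices of the star. What remains around \<open>y\<close> does not reach the
  ends of the strip any more.\<close>

lemma strip_part_split:
  assumes C: "strip_part a b C" and low: "lowest U a b m y" and meet: "C \<inter> star y \<noteq> {}"
    and high: "\<And>v. v \<in> C \<Longrightarrow> m \<le> row v"
  shows "\<exists>B\<subseteq>C. B \<noteq> {} \<and> card B \<le> 9 \<and> (\<forall>s\<in>C - B. part (component E (C - B) s))"
proof -
  have C': "nested U a b" "strip_end U a" "strip_end U b" "conn E C" "C \<subseteq> region a b" "C \<subseteq> U"
    "nbs E U C \<subseteq> star a \<union> star b" using C by (auto simp: strip_part_def)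
  have y: "cen m y" "a < y" "y < b" "act U y" using low by (auto simp: lowest_def)
  have star_y: "v \<in> star y \<longleftrightarrow> v \<in> V \<and> pos v = y \<and> m \<le> row v" for v by (simp add: star_cen[OF y(1)])
  have off_y: "pos v \<noteq> y" if "v \<in> C - star y" for v using that high C'(6) UV star_y by blast
  obtain c where c: "c \<in> U" "pos c = y" "row c = m" using y(4) cen_unique[OF y(1)] unfolding act_def by blast
  have cC: "c \<in> C"
  proof (rule ccontr)
    assume no: "c \<notin> C"
    obtain v where v: "v \<in> C" "v \<in> star y" using meet by blast
    have "v \<noteq> c" using v(1) no by blast
    then have "row v \<noteq> m" using v(2) c by (auto simp: star_y prod_eq_iff)
    then have "E c v" using v(2) c UV y(1) by (auto simp: star_y E_iff)
    then have "c \<in> nbs E U C" using c(1) no v(1) by (auto simp: nbs_def)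
    then show False using C'(7) c(2) y(2,3) by (auto simp: star_def)
  qed
  let ?R = "C - star y"
  define W where "W = {w\<in>C. \<exists>v\<in>U \<inter> (star a \<union> star b). E v w}"
  define L where "L w = {l\<in>U \<inter> star y. \<exists>x\<in>component E ?R w. E l x}" for w
  have W: "card W \<le> 4" "finite W" "W \<subseteq> C"
    using strip_part_contacts(1)[OF C] finite_subset[OF C'(6) finU] unfolding W_def by auto
  have comp_side: "\<exists>s. (s = 1 \<or> s = -1) \<and> (\<forall>v\<in>component E ?R w. 0 < s * (pos v - y))" if w: "w \<in> ?R" for w
  proof -
    define s :: int where "s = (if pos w < y then -1 else 1)"
    have s: "s = 1 \<or> s = -1" "0 < s * (pos w - y)" using off_y[OF w] by (auto simp: s_def)
    have "0 < s * (pos v - y)" if "v \<in> component E ?R w" for v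
      using stays_on_side[OF s(1) conn_comp[OF w] comp_self s(2) _ that] off_y comp_subset[OF w, of E] by blast
    then show ?thesis using s(1) by blast
  qed
  have contacts_le: "card (L w) \<le> 2" if w: "w \<in> ?R" for w
  proof -
    obtain s where "s = 1 \<or> s = -1" "\<forall>v\<in>component E ?R w. 0 < s * (pos v - y)" using comp_side[OF w] by blast
    moreover have "component E ?R w \<subseteq> U" using comp_subset[OF w, of E] C'(6) by blast
    ultimately show ?thesis unfolding L_def using contacts(2)[OF y(4) conn_comp[OF w]] by blast
  qed
  have far_end: "w \<in> ?R" if w: "w \<in> W" for w
  proof -
    obtain v where v: "w \<in> C" "v \<in> star a \<union> star b" "E v w" using w by (auto simp: W_def)
    have "w \<notin> star y"
    proof
      assume "w \<in> star y"
      then have d: "\<bar>pos v - y\<bar> \<le> 1" using v(3) E_pos by (fastforce simp: star_def)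
      have v': "pos v = a \<and> act U a \<or> pos v = b \<and> act U b"
        using v(2)
      proof
        assume va: "v \<in> star a"
        then have "act U a" using strip_end_star[OF _ C'(2)] by blast
        then show ?thesis using va by (simp add: star_def)
      next
        assume vb: "v \<in> star b"
        then have "act U b" using strip_end_star[OF _ C'(3)] by blast
        then show ?thesis using vb by (simp add: star_def)
      qed
      then obtain i where "cen i (pos v)" by (auto simp: act_def)
      moreover have "pos v \<noteq> y" using v' y(2,3) by auto
      ultimately have "2 ^ g \<le> \<bar>pos v - y\<bar>" using cen_far y(1) by blast
      then show False using d two_le_pow by linarith
    qed
    then show ?thesis using v(1) by blast
  qed
  have finL: "finite (L w)" for w using finU by (simp add: L_def)
  have "card (\<Union>w\<in>W. L w) \<le> (\<Sum>w\<in>W. card (L w))" by (rule card_UN_le[OF W(2)])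
  also have "\<dots> \<le> (\<Sum>w\<in>W. 2)" by (intro sum_mono contacts_le far_end)
  also have "\<dots> \<le> 8" using W(1) by simp
  finally have cardL: "card (\<Union>w\<in>W. L w) \<le> 8" .
  define B where "B = insert c (C \<inter> (\<Union>w\<in>W. L w))"
  have finB: "finite B" using finL W(2) by (simp add: B_def)
  have "card (C \<inter> (\<Union>w\<in>W. L w)) \<le> card (\<Union>w\<in>W. L w)" using finL W(2) by (intro card_mono) auto
  then have cardB: "card B \<le> 9"
    unfolding B_def using cardL finL W(2) by (intro card_insert_le_m1) auto
  have BC: "B \<subseteq> C" using cC by (auto simp: B_def)
  have "c \<in> star y" using c UV by (auto simp: star_y)
  then have B_star: "B \<subseteq> star y" unfolding B_def L_def by blast
  have "part (component E (C - B) s)" if s: "s \<in> C - B" for s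
  proof -
    let ?X = "component E (C - B) s"
    have X: "conn E ?X" "?X \<subseteq> C - B" "s \<in> ?X" by (rule conn_comp[OF s], rule comp_subset[OF s], rule comp_self)
    have N: "nbs E U ?X \<subseteq> nbs E U C \<union> B" by (rule nbs_component[OF s C'(6)])
    have XR: "?X \<subseteq> region a b \<inter> U" "\<And>v. v \<in> ?X \<Longrightarrow> m \<le> row v" using X(2) C'(5,6) high by blast+
    show ?thesis
    proof (cases "?X \<inter> star y = {}")
      case True
      have "nbs E U ?X \<subseteq> star a \<union> star b \<union> star y" using N C'(7) B_star by blast
      then have "strip_part a y ?X \<or> strip_part y b ?X"
        using part_on_side[OF C'(1-3) low X(1) XR True] X(3) by blast
      then show ?thesis unfolding part_def using X(3) by blast
    next
      case False
      have NB: "nbs E U ?X \<subseteq> B"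
      proof (rule ccontr)
        assume "\<not> ?thesis"
        then obtain x where x: "x \<in> nbs E U ?X" "x \<in> nbs E U C" using N by blast
        then obtain w where w: "w \<in> ?X" "E x w" by (auto simp: nbs_def)
        have "x \<in> U" "x \<in> star a \<union> star b" using x C'(7) by (auto simp: nbs_def)
        then have wW: "w \<in> W" using w X(2) by (auto simp: W_def)
        let ?K = "component E ?R w"
        have K: "?K \<subseteq> ?R" "w \<in> ?K" by (rule comp_subset[OF far_end[OF wW]], rule comp_self)
        obtain z where z: "z \<in> ?X" "z \<in> star y" using False by blast
        then have "z \<notin> ?K" using K(1) by blast
        then obtain p p' where p: "p \<in> ?X" "p \<in> ?K" "p' \<in> ?X" "p' \<notin> ?K" "E p p'"
          using connE[OF X(1) w(1) K(2) z(1)] by blast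
        have "p' \<in> star y"
          using comp_step[OF p(2) far_end[OF wW] _ p(5)] p(3,4) X(2) by blast
        then have "p' \<in> L w" using p(2,3) XR(1) sym[OF p(5)] by (auto simp: L_def)
        then have "p' \<in> B" using wW p(3) X(2) by (auto simp: B_def)
        then show False using p(3) X(2) by blast
      qed
      have "c \<notin> ?X" using X(2) by (auto simp: B_def)
      then have no_c: "\<forall>v\<in>?X. \<not> (row v = m \<and> pos v = y)" using c by (metis of_nat_eq_iff prod_eq_iff)
      have "border ?X \<subseteq> {(v, w). v \<in> B \<and> E v w \<and> row v = row w}" using NB by (auto simp: border_def)
      then have "card (border ?X) \<le> card {(v, w). v \<in> B \<and> E v w \<and> row v = row w}"
        using horizontal_card(2)[OF finB] by (intro card_mono)
      also have "\<dots> \<le> 18" using horizontal_card(1)[OF finB] cardB by linarith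
      finally have "local_part a b m y ?X"
        unfolding local_part_def using C'(1-3) low X(1) XR no_c NB B_star by blast
      then show ?thesis unfolding part_def using X(3) by blast
    qed
  qed
  then show ?thesis using BC cardB by (intro exI[of _ B]) (auto simp: B_def)
qed

lemma strip_or_row_part_split:
  assumes "strip_part a b C" "C \<noteq> {}"
  shows "\<exists>B\<subseteq>C. B \<noteq> {} \<and> card B \<le> 9 \<and> (\<forall>s\<in>C - B. part (component E (C - B) s))"
  using assms
proof (induction "nat (b - a)" arbitrary: a b rule: less_induct)
  case less
  have C: "nested U a b" "strip_end U a" "strip_end U b" "conn E C" "C \<subseteq> region a b \<inter> U"
    "nbs E U C \<subseteq> star a \<union> star b" using less.prems(1) by (auto simp: strip_part_def)
  show ?case
  proof (cases "\<exists>v\<in>C. cen (row v) (pos v)")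
    case False
    then have row: "row_part C" using flat_strip_part[OF less.prems(1)] by blast
    obtain v where v: "v \<in> C" using less.prems(2) by blast
    have "part (component E (C - {v}) s)" if "s \<in> C - {v}" for s
      using row_part_split[OF row v that] comp_self[of s E "C - {v}"] unfolding part_def by blast
    then show ?thesis using v by (intro exI[of _ "{v}"]) auto
  next
    case True
    then obtain v where v: "v \<in> C" "cen (row v) (pos v)" by blast
    then have "act U (pos v)" "a < pos v" "pos v < b" using C(5) by (auto simp: act_def region_def)
    then obtain m y where low: "lowest U a b m y" using lowest_exists by blast
    have y: "cen m y" "a < y" "y < b" using low by (auto simp: lowest_def)
    have level: "m \<le> row w" if "w \<in> C" "cen (row w) (pos w)" for w
    proof -
      have "act U (pos w)" "a < pos w" "pos w < b" using that C(5) by (auto simp: act_def region_def)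
      then show ?thesis using low that(2) unfolding lowest_def by blast
    qed
    have "C \<subseteq> {v. m \<le> row v}"
    proof (rule conn_closed[OF C(4) v(1)])
      show "v \<in> {v. m \<le> row v}" using level v by simp
      fix x z assume xz: "x \<in> C" "x \<in> {v. m \<le> row v}" "z \<in> C" "E x z"
      then have "row x \<le> row z \<or> cen (row z) (pos z)" by (auto simp: E_iff)
      then show "z \<in> {v. m \<le> row v}" using xz level[of z] by auto
    qed
    then have high: "\<And>v. v \<in> C \<Longrightarrow> m \<le> row v" by blast
    show ?thesis
    proof (cases "C \<inter> star y = {}")
      case False
      then show ?thesis using strip_part_split[OF less.prems(1) low _ high] by blast
    next
      case True
      have "nbs E U C \<subseteq> star a \<union> star b \<union> star y" using C(6) by blast
      then have "strip_part a y C \<or> strip_part y b C"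
        using part_on_side[OF C(1-3) low C(4,5) high True less.prems(2)] by blast
      then show ?thesis
        using less.hyps[of y a] less.hyps[of b y] y(2,3) less.prems(2) by auto
    qed
  qed
qed

text \<open>A part around column \<open>y\<close> is broken by deleting one leaf \<open>l\<close>. If the part has a horizontal edge
  to a neighbour, then \<open>l\<close> is chosen as the other contact of the component beside column \<open>y\<close> which
  this edge enters: this component is split off, and the lost edge makes up for the new one at
  \<open>l\<close>.\<close>

lemma local_part_split:
  assumes C: "local_part a b m y C" and ne: "C \<noteq> {}"
  shows "\<exists>B\<subseteq>C. B \<noteq> {} \<and> card B \<le> 9 \<and> (\<forall>s\<in>C - B. part (component E (C - B) s))"
proof -
  have C': "nested U a b" "strip_end U a" "strip_end U b" "lowest U a b m y" "conn E C" "C \<subseteq> region a b" "C \<subseteq> U"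
    "\<And>v. v \<in> C \<Longrightarrow> m \<le> row v" "\<And>v. v \<in> C \<Longrightarrow> \<not> (row v = m \<and> pos v = y)" "nbs E U C \<subseteq> star y" "card (border C) \<le> 18"
    using C by (auto simp: local_part_def)
  have y: "cen m y" "act U y" using C'(4) by (auto simp: lowest_def)
  have star_y: "v \<in> star y \<longleftrightarrow> v \<in> V \<and> pos v = y \<and> m \<le> row v" for v by (simp add: star_cen[OF y(1)])
  have off_y: "pos v \<noteq> y" if "v \<in> C - star y" for v using that C'(7,8) UV star_y by blast
  have CR: "C \<subseteq> region a b \<inter> U" using C'(6,7) by blast
  show ?thesis
  proof (cases "C \<inter> star y = {}")
    case True
    have "nbs E U C \<subseteq> star a \<union> star b \<union> star y" using C'(10) by blast
    then have "strip_part a y C \<or> strip_part y b C"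
      using part_on_side[OF C'(1-4) C'(5) CR C'(8) True ne] by blast
    then show ?thesis using strip_or_row_part_split ne by blast
  next
    case meet: False
    have generic: ?thesis
      if l: "l \<in> C" "l \<in> star y"
        and good: "\<And>s. s \<in> C - {l} \<Longrightarrow> component E (C - {l}) s \<inter> star y \<noteq> {} \<Longrightarrow> card (border (component E (C - {l}) s)) \<le> 18"
      for l
    proof -
      have "part (component E (C - {l}) s)" if s: "s \<in> C - {l}" for s
      proof -
        let ?X = "component E (C - {l}) s"
        have X: "conn E ?X" "?X \<subseteq> C - {l}" "s \<in> ?X" by (rule conn_comp[OF s], rule comp_subset[OF s], rule comp_self)
        have N: "nbs E U ?X \<subseteq> star y" using nbs_component[OF s C'(7)] C'(10) l(2) by blast
        have XR: "?X \<subseteq> region a b \<inter> U" "\<And>v. v \<in> ?X \<Longrightarrow> m \<le> row v" using X(2) CR C'(8) by blast+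
        show ?thesis
        proof (cases "?X \<inter> star y = {}")
          case True
          then have "strip_part a y ?X \<or> strip_part y b ?X"
            using part_on_side[OF C'(1-4) X(1) XR True] N X(3) by blast
          then show ?thesis unfolding part_def using X(3) by blast
        next
          case False
          have "local_part a b m y ?X"
            unfolding local_part_def using C'(1-4,9) X(1,2) XR N good[OF s False] by blast
          then show ?thesis unfolding part_def using X(3) by blast
        qed
      qed
      then show ?thesis using l(1) by (intro exI[of _ "{l}"]) auto
    qed
    have border_sub: "border (component E (C - {l}) s) \<subseteq> border C \<union> {(v, w). v \<in> {l} \<and> E v w \<and> row v = row w}"
      if "s \<in> C - {l}" for s l
      using nbs_component[OF that C'(7)] comp_subset[OF that, of E] by (auto simp: border_def)
    show ?thesis
    proof (cases "border C = {}")
      case True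
      obtain l where l: "l \<in> C" "l \<in> star y" using meet by blast
      show ?thesis
      proof (rule generic[OF l])
        fix s assume s: "s \<in> C - {l}"
        have "card (border (component E (C - {l}) s)) \<le> card {(v, w). v \<in> {l} \<and> E v w \<and> row v = row w}"
          using border_sub[OF s] True horizontal_card(2)[of "{l}"] by (intro card_mono) auto
        also have "\<dots> \<le> 2" using horizontal_card(1)[of "{l}"] by simp
        finally show "card (border (component E (C - {l}) s)) \<le> 18" by simp
      qed
    next
      case False
      then obtain v0 w0 where e0: "(v0, w0) \<in> border C" by auto
      then have e: "v0 \<in> nbs E U C" "v0 \<in> U" "v0 \<notin> C" "v0 \<in> star y" "w0 \<in> C" "E v0 w0" "row v0 = row w0"
        using C'(10) by (auto simp: border_def nbs_def)
      have "pos w0 \<noteq> y" using e(4,6,7) by (auto simp: E_iff star_y)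
      then have w0: "w0 \<in> C - star y" using e(5) by (auto simp: star_y)
      let ?K = "component E (C - star y) w0"
      have K: "conn E ?K" "?K \<subseteq> C - star y" "w0 \<in> ?K" by (rule conn_comp[OF w0], rule comp_subset[OF w0], rule comp_self)
      define i :: int where "i = (if pos w0 < y then -1 else 1)"
      have i: "i = 1 \<or> i = -1" "0 < i * (pos w0 - y)" using off_y[OF w0] by (auto simp: i_def)
      have side: "0 < i * (pos v - y)" if "v \<in> ?K" for v
        using stays_on_side[OF i(1) K(1,3) i(2) _ that] off_y K(2) by blast
      have two: "card {v\<in>U \<inter> star y. \<exists>w\<in>?K. E v w} \<le> 2"
        using contacts(2)[OF y(2) K(1) _ i(1) side] K(2) C'(7) by blast
      obtain z where z: "z \<in> C" "z \<in> star y" using meet by blast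
      then have "z \<notin> ?K" using K(2) by blast
      then obtain p l where p: "p \<in> C" "p \<in> ?K" "l \<in> C" "l \<notin> ?K" "E p l"
        using connE[OF C'(5) e(5) K(3) z(1)] by blast
      have l: "l \<in> star y" using comp_step[OF p(2) w0 _ p(5)] p(3,4) by blast
      have only: "x = v0 \<or> x = l" if "x \<in> U" "x \<in> star y" "w \<in> ?K" "E x w" for x w
      proof (rule ccontr)
        assume no: "\<not> ?thesis"
        have "v0 \<in> {v\<in>U \<inter> star y. \<exists>w\<in>?K. E v w}" using e(2,4,6) K(3) by blast
        moreover have "l \<in> {v\<in>U \<inter> star y. \<exists>w\<in>?K. E v w}" using p(2,3) sym[OF p(5)] l C'(7) by blast
        moreover have "x \<in> {v\<in>U \<inter> star y. \<exists>w\<in>?K. E v w}" using that by blast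
        ultimately have sub: "{v0, l, x} \<subseteq> {v\<in>U \<inter> star y. \<exists>w\<in>?K. E v w}" by simp
        have "finite {v\<in>U \<inter> star y. \<exists>w\<in>?K. E v w}" using finU by simp
        then have "card {v0, l, x} \<le> 2" using card_mono[OF _ sub] two by linarith
        moreover have "v0 \<noteq> l" using e(3) p(3) by blast
        ultimately show False using no by auto
      qed
      have "pos p \<noteq> y" "pos l = y" using off_y[of p] K(2) p(2) l by (auto simp: star_def)
      then have pl: "row l = row p" using p(5) by (auto simp: E_iff)
      show ?thesis
      proof (rule generic[OF p(3) l])
        fix s assume s: "s \<in> C - {l}" and X_meet: "component E (C - {l}) s \<inter> star y \<noteq> {}"
        let ?X = "component E (C - {l}) s"
        have X: "conn E ?X" "?X \<subseteq> C - {l}" "s \<in> ?X" by (rule conn_comp[OF s], rule comp_subset[OF s], rule comp_self)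
        have disj: "x \<notin> ?X" if x: "x \<in> ?K" for x
        proof
          assume xX: "x \<in> ?X"
          obtain u where u: "u \<in> ?X" "u \<in> star y" using X_meet by blast
          then have "u \<notin> ?K" using K(2) by blast
          then obtain r r' where r: "r \<in> ?X" "r \<in> ?K" "r' \<in> ?X" "r' \<notin> ?K" "E r r'"
            using connE[OF X(1) xX x u(1)] by blast
          have "r' \<in> star y" using comp_step[OF r(2) w0 _ r(5)] r(3,4) X(2) by blast
          then have "r' = v0 \<or> r' = l" using only[OF _ _ r(2) sym[OF r(5)]] r(3) X(2) C'(7) by blast
          then show False using r(3) X(2) e(3) by blast
        qed
        have "border ?X \<subseteq> (border C - {(v0, w0)}) \<union> ({(v, w). v \<in> {l} \<and> E v w \<and> row v = row w} - {(l, p)})"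
        proof
          fix q assume q: "q \<in> border ?X"
          then have "snd q \<in> ?X" by (auto simp: border_def)
          then have "snd q \<noteq> w0" "snd q \<noteq> p" using disj K(3) p(2) by blast+
          then show "q \<in> (border C - {(v0, w0)}) \<union> ({(v, w). v \<in> {l} \<and> E v w \<and> row v = row w} - {(l, p)})"
            using border_sub[OF s] q by auto
        qed
        then have "card (border ?X) \<le> card ((border C - {(v0, w0)}) \<union> ({(v, w). v \<in> {l} \<and> E v w \<and> row v = row w} - {(l, p)}))"
          using finite_border horizontal_card(2)[of "{l}"] by (intro card_mono) auto
        also have "\<dots> \<le> card (border C - {(v0, w0)}) + card ({(v, w). v \<in> {l} \<and> E v w \<and> row v = row w} - {(l, p)})"
          by (rule card_Un_le)
        also have "\<dots> \<le> 17 + 1"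
        proof (rule add_mono)
          show "card (border C - {(v0, w0)}) \<le> 17" using card_Diff_singleton[OF e0] C'(11) by simp
          have "(l, p) \<in> {(v, w). v \<in> {l} \<and> E v w \<and> row v = row w}" using sym[OF p(5)] pl by simp
          then have "card ({(v, w). v \<in> {l} \<and> E v w \<and> row v = row w} - {(l, p)}) = card {(v, w). v \<in> {l} \<and> E v w \<and> row v = row w} - 1"
            by (rule card_Diff_singleton)
          then show "card ({(v, w). v \<in> {l} \<and> E v w \<and> row v = row w} - {(l, p)}) \<le> 1"
            using horizontal_card(1)[of "{l}"] by simp
        qed
        finally show "card (border ?X) \<le> 18" by simp
      qed
    qed
  qed
qed

lemma part_split:
  assumes "part C"
  shows "\<exists>B\<subseteq>C. B \<noteq> {} \<and> card B \<le> 9 \<and> (\<forall>s\<in>C - B. part (component E (C - B) s))"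
proof -
  have ne: "C \<noteq> {}" using assms by (simp add: part_def)
  consider "row_part C" | a b where "strip_part a b C" | a b m y where "local_part a b m y C"
    using assms unfolding part_def by blast
  then show ?thesis
  proof cases
    case 1
    obtain v where v: "v \<in> C" using ne by blast
    have "part (component E (C - {v}) s)" if "s \<in> C - {v}" for s
      using row_part_split[OF 1 v that] comp_self[of s E "C - {v}"] unfolding part_def by blast
    then show ?thesis using v by (intro exI[of _ "{v}"]) auto
  next
    case 2
    then show ?thesis using strip_or_row_part_split ne by blast
  next
    case 3
    then show ?thesis using local_part_split[OF 3 ne] by simp
  qed
qed

lemma part_component:
  assumes "s \<in> U"
  shows "part (component E U s)"
proof -
  let ?C = "component E U s"
  have sub: "?C \<subseteq> U" by (rule comp_subset[OF assms])
  have nocen: "\<not> cen m (-1)" "\<not> cen m (2 ^ (k + g) + 1)" for m using cen_bounds by fastforce+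
  have "nbs E U ?C = {}" using comp_step[of _ E U s] assms sym by (auto simp: nbs_def)
  moreover have "?C \<subseteq> region (-1) (2 ^ (k + g) + 1)"
    using sub UV V_bounds nocen by (fastforce simp: region_def)
  ultimately have "strip_part (-1) (2 ^ (k + g) + 1) ?C"
    unfolding strip_part_def using nocen conn_comp[OF assms] sub by (auto simp: nested_def strip_end_def)
  then show ?thesis unfolding part_def using comp_self[of s E U] by blast
qed

lemma rooted_dec_exists: "\<exists>n par \<beta>. rooted_dec E U {} 28 n par \<beta>"
proof -
  interpret separable_family E U part 19 9
    by unfold_locales (use finU part_component part_few_nbs part_split in auto)
  show ?thesis using dec_whole by simp
qed

end

section \<open>The theorem\<close>

context dyadic_graph begin

lemma pverts_Ggk: "pverts (Ggk g k) = V"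
  by (simp add: Ggk_def undirected_def V_def)

lemma adj_Ggk: "adj (Ggk g k) = E"
  by (intro ext) (simp add: E_def)

lemma model_in_Ggk:
  assumes "induced_minor W (Ggk g k)"
  obtains X where "minor_model E V (adj W) (pverts W) X"
  using model_of_induced_minor[OF assms simple_graph_pair_graph[OF pair_graph_Ggk]]
  unfolding pverts_Ggk adj_Ggk by blast

lemma long_theta_or_small_treewidth:
  assumes ind: "induced_subgraph (with_proj H) (with_proj (Ggk g k))" and tw: "27 < treewidth H"
  shows "\<exists>T. long_theta (2 ^ g) T \<and> induced_subgraph (with_proj T) (with_proj H)"
proof (rule ccontr)
  assume no: "\<not> ?thesis"
  have UV: "pverts H \<subseteq> V"
    using ind by (simp add: induced_subgraph_def subgraph_def pverts_Ggk)
  have parcs: "parcs H = {e \<in> parcs (Ggk g k). fst e \<in> pverts H \<and> snd e \<in> pverts H}"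
    using ind by (simp add: induced_subgraph_def)
  have adj: "adj H u v \<longleftrightarrow> u \<in> pverts H \<and> v \<in> pverts H \<and> E u v" for u v
    unfolding parcs E_def by auto
  have simple: "simple_graph H"
    unfolding simple_graph_def adj using E_neq sym by blast
  interpret few_contacts g k "pverts H"
  proof unfold_locales
    fix m y c s K
    assume c: "c \<in> pverts H" "cen m y" "row c = m" "pos c = y" and s: "s = 1 \<or> s = -1"
      and K: "conn E K" "K \<subseteq> pverts H" "\<And>v. v \<in> K \<Longrightarrow> 0 < s * (pos v - y)"
    let ?R = "{r. m \<le> r \<and> (\<exists>v\<in>pverts H. row v = r \<and> pos v = y) \<and> (\<exists>w\<in>K. row w = r \<and> pos w = y + s)}"
    show "card ?R \<le> 2"
    proof (rule ccontr)
      assume "\<not> card ?R \<le> 2"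
      then have "3 \<le> card ?R" by simp
      then show False
        using theta_of_contacts[OF simple UV adj c s K HOL.refl] no by blast
    qed
  qed (rule UV)
  obtain n par \<beta> where "rooted_dec E (pverts H) {} 28 n par \<beta>" using rooted_dec_exists by blast
  then have "rooted_dec (adj H) (pverts H) {} 28 n par \<beta>"
    unfolding rooted_dec_def adj by simp
  then have "treewidth H \<le> 28 - 1"
    by (rule treewidth_le_of_rooted_dec[rotated]) (simp add: adj)
  then show False using tw by simp
qed

end

theorem theorem6p2:
  shows "\<exists>t0 L :: nat. 1 \<le> t0 \<and> 1 \<le> L \<and>
    (\<forall>g k :: nat. 1 \<le> g \<longrightarrow> 1 \<le> k \<longrightarrow>
       (\<not> induced_minor (wall t0) (Ggk g k) \<and>
        \<not> induced_minor (complete_bipartite t0 t0) (Ggk g k)) \<and>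
       (\<forall>H :: (nat \<times> nat) pair_pre_digraph.
          induced_subgraph (with_proj H) (with_proj (Ggk g k)) \<longrightarrow> treewidth H > L \<longrightarrow>
          (\<exists>(l :: nat) (T :: (nat \<times> nat) pair_pre_digraph).
             l \<ge> 2 ^ g - 1 \<and> long_theta l T \<and> induced_subgraph (with_proj T) (with_proj H))))"
  \<comment> \<open>With 100 vertices on each side there are 33 triples of leaves, more than the 30 branch sets
    to be avoided. The bags have at most 19 + 9 elements.\<close>
proof (rule exI[of _ 100], rule exI[of _ 27], intro conjI allI impI)
  fix g k :: nat assume "1 \<le> g"
  then interpret dyadic_graph g k by unfold_locales
  show "\<not> induced_minor (wall 100) (Ggk g k)"
  proof
    assume "induced_minor (wall 100) (Ggk g k)"
    then show False by (rule model_in_Ggk) (rule no_wall_minor, assumption, simp)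
  qed
  show "\<not> induced_minor (complete_bipartite 100 100) (Ggk g k)"
  proof
    assume "induced_minor (complete_bipartite 100 100) (Ggk g k)"
    then show False by (rule model_in_Ggk) (rule no_complete_bipartite_minor)
  qed
  fix H :: "(nat \<times> nat) pair_pre_digraph"
  assume "induced_subgraph (with_proj H) (with_proj (Ggk g k))" "treewidth H > 27"
  then obtain T where "long_theta (2 ^ g) T" "induced_subgraph (with_proj T) (with_proj H)"
    using long_theta_or_small_treewidth by blast
  then show "\<exists>l T. l \<ge> 2 ^ g - 1 \<and> long_theta l T \<and> induced_subgraph (with_proj T) (with_proj H)"
    by (intro exI[of _ "2 ^ g"] exI[of _ T]) simp
qed simp_all

end
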